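(* Every totally bounded abelian topological group that is a Baire space and has no infinite compact subsets is Pontryagin reflexive.
   Context: $\mathbb{T}=\mathbb{R}/\mathbb{Z}$ is the circle group. A topological group $G$ (written additively) is totally bounded if it is Hausdorff and for every nonempty open $U\subseteq G$ there is a finite $F\subseteq G$ with $G=F+U$. A space is Baire if every countable intersection of dense open subsets is dense. For an abelian topological group $G$, let $\widehat{G}$ be the group of continuous homomorphisms $G\to\mathbb{T}$. $G$ is Pontryagin reflexive if the canonical evaluation map $G\to\widehat{\widehat{G}}$, $g\mapsto(\chi\mapsto\chi(g))$, is a topological isomorphism when $\widehat{G}$ and then its dual $\widehat{\widehat{G}}$ carry the compact-open topology. *)

theory Defs
  imports "HOL-Analysis.Analysis" "HOL-Library.Function_Algebras"
begin

section \<open>The circle group\<close>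

text \<open>The quotient of the reals by the integers, with the quotient group structure and the
  quotient topology.\<close>

quotient_type circle = real / "\<lambda>x y::real. x - y \<in> \<int>"
  morphisms rep_circle to_circle
proof (rule equivpI)
  show "reflp (\<lambda>x y::real. x - y \<in> \<int>)"
    by (simp add: reflp_def)
  show "symp (\<lambda>x y::real. x - y \<in> \<int>)"
    by (auto simp: symp_def intro: minus_in_Ints_iff[THEN iffD1])
  show "transp (\<lambda>x y::real. x - y \<in> \<int>)"
    unfolding transp_def by (metis Ints_add add_diff_eq diff_add_cancel)
qed

instantiation circle :: ab_group_add
begin

lift_definition zero_circle :: circle is 0 .

lift_definition plus_circle :: "circle \<Rightarrow> circle \<Rightarrow> circle" is "(+)"
  by (metis Ints_add add_diff_add)

lift_definition uminus_circle :: "circle \<Rightarrow> circle" is uminus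
  by (metis Ints_minus minus_diff_minus)

lift_definition minus_circle :: "circle \<Rightarrow> circle \<Rightarrow> circle" is "(-)"
  by (metis (no_types, opaque_lifting) Ints_diff diff_diff_eq2 diff_add_eq add_diff_eq add.commute)

instance
  by standard (transfer; simp add: algebra_simps)+

end

instantiation circle :: topological_space
begin

definition open_circle :: "circle set \<Rightarrow> bool"
  where "open_circle U \<longleftrightarrow> open (to_circle -` U)"

instance
proof
  show "open (UNIV :: circle set)"
    by (simp add: open_circle_def)
  show "open (S \<inter> T)" if "open S" "open T" for S T :: "circle set"
    using that by (simp add: open_circle_def open_Int)
  show "open (\<Union>K)" if "\<forall>S\<in>K. open S" for K :: "circle set set"
    using that by (auto simp add: open_circle_def vimage_Union intro!: open_UN)
qed

end

lemma to_circle_eq_iff: "to_circle x = to_circle y \<longleftrightarrow> x - y \<in> \<int>"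
  by (rule circle.abs_eq_iff)

lemma to_circle_surj: "\<exists>x. t = to_circle x"
  by (metis Quotient_abs_rep Quotient_circle)

lemma to_circle_add: "to_circle x + to_circle y = to_circle (x + y)"
  by (rule plus_circle.abs_eq)

lemma to_circle_minus: "- to_circle x = to_circle (- x)"
  by (rule uminus_circle.abs_eq)

lemma open_image_to_circle:
  assumes "open U"
  shows "open (to_circle ` U)"
proof -
  have "to_circle -` (to_circle ` U) = (\<Union>n\<in>\<int>. (+) n ` U)"
  proof (intro set_eqI iffI)
    fix x assume "x \<in> to_circle -` (to_circle ` U)"
    then obtain u where "u \<in> U" "x - u \<in> \<int>"
      by (auto simp: to_circle_eq_iff)
    then show "x \<in> (\<Union>n\<in>\<int>. (+) n ` U)"
      by (auto intro!: bexI[of _ "x - u"] image_eqI[of _ _ u])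
  next
    fix x assume "x \<in> (\<Union>n\<in>\<int>. (+) n ` U)"
    then obtain n u where "n \<in> \<int>" "u \<in> U" "x = n + u"
      by auto
    then have "to_circle x = to_circle u"
      by (simp add: to_circle_eq_iff)
    with \<open>u \<in> U\<close> show "x \<in> to_circle -` (to_circle ` U)"
      by simp
  qed
  then show ?thesis
    unfolding open_circle_def using assms by (auto intro!: open_translation)
qed

lemma tendsto_to_circle: "(to_circle \<longlongrightarrow> to_circle x) (nhds x)"
  unfolding tendsto_def eventually_nhds by (metis open_circle_def vimage_eq)

lemma nhds_circle: "nhds (to_circle x) = filtermap to_circle (nhds x)"
proof (rule antisym)
  show "nhds (to_circle x) \<le> filtermap to_circle (nhds x)"
  proof (rule filter_leI)
    fix P assume "eventually P (filtermap to_circle (nhds x))"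
    then obtain U where "open U" "x \<in> U" "\<forall>u\<in>U. P (to_circle u)"
      by (auto simp: eventually_filtermap eventually_nhds)
    then show "eventually P (nhds (to_circle x))"
      unfolding eventually_nhds by (intro exI[of _ "to_circle ` U"]) (auto simp: open_image_to_circle)
  qed
  show "filtermap to_circle (nhds x) \<le> nhds (to_circle x)"
    using tendsto_to_circle by (simp add: filterlim_def)
qed

instance circle :: topological_ab_group_add
proof
  fix a b :: circle
  obtain x y where ab: "a = to_circle x" "b = to_circle y"
    using to_circle_surj by metis
  have "((\<lambda>p. to_circle (fst p + snd p)) \<longlongrightarrow> to_circle (x + y)) (nhds x \<times>\<^sub>F nhds y)"
    using tendsto_add_Pair[of x y] tendsto_to_circle by (rule filterlim_compose[rotated])
  then show "((\<lambda>p. fst p + snd p) \<longlongrightarrow> a + b) (nhds a \<times>\<^sub>F nhds b)"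
    by (simp add: ab nhds_circle prod_filtermap1 prod_filtermap2 filterlim_filtermap
        split_beta to_circle_add)
  have "((\<lambda>p. to_circle (- p)) \<longlongrightarrow> to_circle (- x)) (nhds x)"
    using tendsto_uminus_nhds[of x] tendsto_to_circle by (rule filterlim_compose[rotated])
  then show "(uminus \<longlongrightarrow> - a) (nhds a)"
    by (simp add: ab nhds_circle filterlim_filtermap to_circle_minus)
qed


section \<open>Totally bounded groups and Baire spaces\<close>

text \<open>In this section and the next, a topological abelian group is given by a topology \<open>X\<close> whose
  \<^const>\<open>topspace\<close> is a subgroup of an ambient type of sort \<^class>\<open>ab_group_add\<close>. A group that
  occupies a whole type of sort \<^class>\<open>topological_ab_group_add\<close> is given by \<^term>\<open>euclidean\<close>,
  which, in spite of its name, is the topology of an arbitrary \<^class>\<open>topological_space\<close>.\<close>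

definition totally_bounded_group :: "'a::ab_group_add topology \<Rightarrow> bool"
  where "totally_bounded_group X \<longleftrightarrow>
    Hausdorff_space X \<and>
    (\<forall>U. openin X U \<and> U \<noteq> {} \<longrightarrow> (\<exists>F. finite F \<and> F \<subseteq> topspace X \<and> topspace X = F + U))"

definition Baire_space :: "'a topology \<Rightarrow> bool"
  where "Baire_space X \<longleftrightarrow>
    (\<forall>D :: nat \<Rightarrow> 'a set. (\<forall>n. openin X (D n) \<and> X closure_of D n = topspace X) \<longrightarrow>
      X closure_of (\<Inter>n. D n) = topspace X)"


section \<open>Pontryagin duality\<close>

text \<open>A character is a function on the whole ambient type; so that distinct functions are distinct
  characters, it is required to be 0 outside the group. The characters then form a subgroup of the
  group of all functions under pointwise addition.\<close>

definition characters :: "'a::ab_group_add topology \<Rightarrow> ('a \<Rightarrow> circle) set"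
  where "characters X = {\<phi>. continuous_map X euclidean \<phi> \<and>
    (\<forall>x\<in>topspace X. \<forall>y\<in>topspace X. \<phi> (x + y) = \<phi> x + \<phi> y) \<and>
    (\<forall>x. x \<notin> topspace X \<longrightarrow> \<phi> x = 0)}"

text \<open>The dual group with the compact-open topology.\<close>

definition dual_group :: "'a::ab_group_add topology \<Rightarrow> ('a \<Rightarrow> circle) topology"
  where "dual_group X =
    topology_generated_by {{\<phi> \<in> characters X. \<phi> ` K \<subseteq> U} | K U. compactin X K \<and> open U}"

definition evaluation :: "'a::ab_group_add topology \<Rightarrow> 'a \<Rightarrow> ('a \<Rightarrow> circle) \<Rightarrow> circle"
  where "evaluation X x = (\<lambda>\<phi>. if \<phi> \<in> characters X then \<phi> x else 0)"

definition Pontryagin_reflexive :: "'a::ab_group_add topology \<Rightarrow> bool"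
  where "Pontryagin_reflexive X \<longleftrightarrow>
    homeomorphic_map X (dual_group (dual_group X)) (evaluation X) \<and>
    (\<forall>x\<in>topspace X. \<forall>y\<in>topspace X. evaluation X (x + y) = evaluation X x + evaluation X y)"

lemma topspace_dual_group [simp]: "topspace (dual_group X) = characters X"
proof -
  have "characters X = {\<phi> \<in> characters X. \<phi> ` {} \<subseteq> UNIV}" "compactin X {}" "open (UNIV::circle set)"
    by auto
  then have "characters X \<in> {{\<phi> \<in> characters X. \<phi> ` K \<subseteq> U} | K U. compactin X K \<and> open U}"
    by blast
  then show ?thesis
    unfolding dual_group_def topology_generated_by_topspace by blast
qed

lemma zero_in_characters: "0 \<in> characters X"
  by (simp add: characters_def zero_fun_def)

lemma add_in_characters:
  assumes "\<phi> \<in> characters X" "\<psi> \<in> characters X"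
  shows "\<phi> + \<psi> \<in> characters X"
proof -
  have "continuous_map (prod_topology euclidean euclidean) euclidean
      (\<lambda>p :: circle \<times> circle. fst p + snd p)"
    by (simp add: euclidean_product_topology continuous_on_add continuous_on_fst continuous_on_snd)
  moreover have "continuous_map X (prod_topology euclidean euclidean) (\<lambda>x. (\<phi> x, \<psi> x))"
    using assms by (intro continuous_map_pairedI) (auto simp: characters_def)
  ultimately have "continuous_map X euclidean ((\<lambda>p. fst p + snd p) \<circ> (\<lambda>x. (\<phi> x, \<psi> x)))"
    by (rule continuous_map_compose[rotated])
  then have "continuous_map X euclidean (\<phi> + \<psi>)"
    by (simp add: o_def plus_fun_def)
  then show ?thesis
    using assms by (auto simp: characters_def algebra_simps)
qed

lemma minus_in_characters:
  assumes "\<phi> \<in> characters X"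
  shows "- \<phi> \<in> characters X"
proof -
  have "(\<lambda>t :: circle. - t) \<midarrow>x\<rightarrow> - x" for x
    by (rule tendsto_minus) (rule tendsto_ident_at)
  then have "continuous_map euclidean euclidean (\<lambda>t :: circle. - t)"
    by (simp add: continuous_on_def)
  then have "continuous_map X euclidean ((\<lambda>t. - t) \<circ> \<phi>)"
    using assms by (intro continuous_map_compose) (auto simp: characters_def)
  then have "continuous_map X euclidean (- \<phi>)"
    by (simp add: o_def fun_Compl_def)
  then show ?thesis
    using assms by (auto simp: characters_def algebra_simps)
qed

lemma evaluation_in_characters:
  assumes "x \<in> topspace X"
  shows "evaluation X x \<in> characters (dual_group X)"
proof -
  have "openin (dual_group X) {\<phi> \<in> characters X. evaluation X x \<phi> \<in> U}" if "open U" for U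
  proof -
    have "{\<phi> \<in> characters X. evaluation X x \<phi> \<in> U} = {\<phi> \<in> characters X. \<phi> ` {x} \<subseteq> U}"
      by (auto simp: evaluation_def)
    moreover have "compactin X {x}"
      using assms by simp
    ultimately show ?thesis
      unfolding dual_group_def using that by (intro topology_generated_by_Basis) blast
  qed
  then have "continuous_map (dual_group X) euclidean (evaluation X x)"
    by (simp add: continuous_map_def)
  then show ?thesis
    by (auto simp: characters_def[of "dual_group X"] evaluation_def add_in_characters)
qed

end

theory Submission
  imports Defs
begin

text \<open>Since all compact subsets of \<open>G\<close> are finite, its dual carries the topology of pointwise
  convergence on \<open>G\<close>, so three things have to be shown.

  The topology of \<open>G\<close> is generated by continuous characters. With an invariant mean \<open>M\<close> in place of
  Haar measure, let \<open>\<phi>\<close> be the autocorrelation of a bump function near 0. For uniformly continuous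
  \<open>F\<close>, the functional \<open>M (\<psi> * cnj F)\<close> on the normalized continuous positive definite functions, if
  positive somewhere, attains its supremum: almost maximal \<open>\<psi>\<close> are almost eigenfunctions of the
  convolution with \<open>F\<close>, hence almost equicontinuous, and the Arzela--Ascoli theorem applies. It is
  attained at an extreme point, and extreme points are characters. Applied to differences of
  translates of \<open>\<phi>\<close>, this yields the required Bohr neighbourhoods.

  Every character of the dual is an evaluation, by orthogonality of characters with respect to an
  invariant mean on the dual.

  Every compact set \<open>K\<close> of characters is finite. Otherwise there is a countable family of
  infinite subsets of \<open>K\<close> such that every continuous function has small oscillation on one of them. By
  Baire's theorem one of these sets oscillates little on a fixed open subset of \<open>G\<close>, uniformly,
  so it is equicontinuous up to translation, and hence finite.\<close>

section \<open>Invariant means\<close>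

text \<open>The first fact, together with the Hausdorff axiom, makes the evaluation map injective
  and open; the second makes it surjective, the third continuous. The completion of a totally
  bounded group is compact, and its Haar measure would supply the analysis. Invariant means exist on
  every abelian group and let the argument stay on the group itself, but they are only finitely
  additive and come with no complete L2 space. Total boundedness makes up for this: finitely many
  translates of a nonempty open set cover the group, so the mean of |f|^2 is positive for every
  bounded continuous \<open>f\<close> other than 0, and bounded equicontinuous families are
  precompact in the uniform norm. The normalized positive definite functions need not be compact in
  that norm. Only a positive supremum forces a maximizing sequence to be close to an equicontinuous
  one, which explains the sign condition. The absence of infinite compact sets serves the second
  fact, Baire category the third.\<close>

lemma bounded_times_comp:
  fixes f g :: "'b \<Rightarrow> complex"
  assumes "bounded (f ` S)" "bounded (g ` S)"
  shows "bounded ((\<lambda>x. f x * g x) ` S)"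
proof -
  obtain B C where "\<And>x. x \<in> S \<Longrightarrow> norm (f x) \<le> B" "\<And>x. x \<in> S \<Longrightarrow> norm (g x) \<le> C"
    using assms unfolding bounded_iff by blast
  then have "norm (f x * g x) \<le> B * C" if "x \<in> S" for x
    using that by (metis norm_ge_zero norm_mult mult_mono' )
  then show ?thesis unfolding bounded_iff by blast
qed

lemma bounded_cnj_comp: "bounded (f ` S) \<Longrightarrow> bounded ((\<lambda>x. cnj (f x)) ` S)"
  unfolding bounded_iff by simp

lemma bounded_const_comp: "bounded ((\<lambda>x. c) ` S)"
  by (simp add: image_constant_conv)

lemma bounded_sum_comp:
  fixes f :: "'i \<Rightarrow> 'b \<Rightarrow> complex"
  assumes "\<And>i. i \<in> I \<Longrightarrow> bounded (f i ` S)"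
  shows "bounded ((\<lambda>x. \<Sum>i\<in>I. f i x) ` S)"
  using assms
  by (induction I rule: infinite_finite_induct) (auto intro!: bounded_plus_comp simp: bounded_const_comp)

lemmas bounded_comp_intros =
  bounded_plus_comp bounded_minus_comp bounded_times_comp bounded_cnj_comp bounded_const_comp
  bounded_sum_comp

text \<open>The carrier is a set because the mean is taken twice: on a whole type for the group, and
  on the set of characters inside a function type for its dual. Via differences,
  \<open>mean_norm_le\<close> also shows that \<open>M f\<close> depends only on the values of
  \<open>f\<close> on \<open>H\<close>.\<close>

locale invariant_mean =
  fixes H :: "'b::ab_group_add set" and M :: "('b \<Rightarrow> complex) \<Rightarrow> complex"
  assumes zero_mem: "0 \<in> H"
    and add_mem: "x \<in> H \<Longrightarrow> y \<in> H \<Longrightarrow> x + y \<in> H"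
    and uminus_mem: "x \<in> H \<Longrightarrow> - x \<in> H"
    and mean_add: "bounded (f ` H) \<Longrightarrow> bounded (g ` H) \<Longrightarrow> M (\<lambda>x. f x + g x) = M f + M g"
    and mean_cmult: "bounded (f ` H) \<Longrightarrow> M (\<lambda>x. c * f x) = c * M f"
    and mean_norm_le: "(\<And>x. x \<in> H \<Longrightarrow> norm (f x) \<le> B) \<Longrightarrow> norm (M f) \<le> B"
    and mean_one: "M (\<lambda>_. 1) = 1"
    and mean_translate: "bounded (f ` H) \<Longrightarrow> h \<in> H \<Longrightarrow> M (\<lambda>x. f (h + x)) = M f"
    and mean_nonneg: "bounded (f ` H) \<Longrightarrow> (\<And>x. x \<in> H \<Longrightarrow> 0 \<le> Re (f x)) \<Longrightarrow> 0 \<le> Re (M f)"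

section \<open>Construction of an invariant mean from averages over boxes\<close>

definition translate_avg :: "nat \<Rightarrow> 'b::ab_group_add \<Rightarrow> ('b \<Rightarrow> complex) \<Rightarrow> 'b \<Rightarrow> complex"
  where "translate_avg n g f = (\<lambda>x. (\<Sum>k<Suc n. f (((+) g ^^ k) x)) / of_nat (Suc n))"

text \<open>These are averages over the Folner boxes of all sums of k_i g_i with 0 \<le> k_i \<le>
  n, counted with multiplicity.\<close>

primrec box_avg :: "nat \<Rightarrow> 'b::ab_group_add list \<Rightarrow> ('b \<Rightarrow> complex) \<Rightarrow> complex"
  where
    "box_avg n [] f = f 0"
  | "box_avg n (g # gs) f = box_avg n gs (translate_avg n g f)"

lemma funpow_add_commute: "((+) g ^^ k) (h + x) = h + ((+) g ^^ k) x"
  for g :: "'b::ab_group_add"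
  by (induction k) (auto simp: algebra_simps)

lemma box_avg_add: "box_avg n gs (\<lambda>x. f x + f' x) = box_avg n gs f + box_avg n gs f'"
proof (induction gs arbitrary: f f')
  case (Cons g gs)
  have "translate_avg n g (\<lambda>x. f x + f' x) = (\<lambda>x. translate_avg n g f x + translate_avg n g f' x)"
    by (simp add: translate_avg_def sum.distrib add_divide_distrib algebra_simps)
  then show ?case by (simp add: Cons)
qed simp

lemma box_avg_cmult: "box_avg n gs (\<lambda>x. c * f x) = c * box_avg n gs f"
proof (induction gs arbitrary: f)
  case (Cons g gs)
  have "translate_avg n g (\<lambda>x. c * f x) = (\<lambda>x. c * translate_avg n g f x)"
    by (simp add: translate_avg_def sum_distrib_left distrib_left del: sum.lessThan_Suc)
  then show ?case by (simp add: Cons)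
qed simp

lemma box_avg_one: "box_avg n gs (\<lambda>x. 1) = 1"
proof (induction gs)
  case (Cons g gs)
  have "translate_avg n g (\<lambda>x. 1) = (\<lambda>x. 1)"
    using of_nat_neq_0[of n, where 'a=complex]
    by (simp add: translate_avg_def del: of_nat_Suc sum.lessThan_Suc)
  then show ?case using Cons by simp
qed simp

lemma translate_avg_in_convex:
  assumes "convex C" "g \<in> H" "\<And>x y. x \<in> H \<Longrightarrow> y \<in> H \<Longrightarrow> x + y \<in> H"
    "\<And>x. x \<in> H \<Longrightarrow> f x \<in> C" "x \<in> H"
  shows "translate_avg n g f x \<in> C"
proof -
  have mem: "((+) g ^^ k) x \<in> H" for k
    using assms by (induction k) auto
  have "(\<Sum>k<Suc n. (1 / real (Suc n)) *\<^sub>R f (((+) g ^^ k) x)) \<in> C"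
    using assms mem by (intro convex_sum) (auto simp del: sum.lessThan_Suc)
  also have "(\<Sum>k<Suc n. (1 / real (Suc n)) *\<^sub>R f (((+) g ^^ k) x)) = translate_avg n g f x"
    by (simp add: translate_avg_def sum_divide_distrib scaleR_conv_of_real add_divide_distrib
        del: sum.lessThan_Suc)
  finally show ?thesis .
qed

text \<open>An average is a convex combination of values on \<open>H\<close>. Discs give the norm
  bounds, a half plane gives positivity.\<close>

lemma box_avg_in_convex:
  assumes "convex C" "set gs \<subseteq> H" "0 \<in> H" "\<And>x y. x \<in> H \<Longrightarrow> y \<in> H \<Longrightarrow> x + y \<in> H"
    "\<And>x. x \<in> H \<Longrightarrow> f x \<in> C"
  shows "box_avg n gs f \<in> C"
  using assms(2,5)
proof (induction gs arbitrary: f)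
  case (Cons g gs)
  have "translate_avg n g f x \<in> C" if "x \<in> H" for x
    using translate_avg_in_convex[OF assms(1) _ assms(4), of g f x] Cons.prems that by auto
  then show ?case using Cons by simp
qed (use assms(3) in simp)

text \<open>In the direction of \<open>h\<close> the sum over multiples telescopes and leaves two
  boundary terms, each bounded by \<open>B\<close>. Averaging in the other directions commutes with
  the shift and preserves the bound.\<close>

lemma box_avg_translate:
  assumes "set gs \<subseteq> H" "0 \<in> H" "\<And>x y. x \<in> H \<Longrightarrow> y \<in> H \<Longrightarrow> x + y \<in> H"
    and "\<And>x. x \<in> H \<Longrightarrow> norm (f x) \<le> B" and "h \<in> set gs"
  shows "norm (box_avg n gs (\<lambda>x. f (h + x)) - box_avg n gs f) \<le> 2 * B / real (Suc n)"
  using assms(1,4,5)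
proof (induction gs arbitrary: f)
  case (Cons g gs)
  have diff: "box_avg n gs u - box_avg n gs v = box_avg n gs (\<lambda>x. u x - v x)" for u v
    using box_avg_add[of n gs u "\<lambda>x. -1 * v x"] box_avg_cmult[of n gs "-1" v] by simp
  show ?case
  proof (cases "h = g")
    case True
    have "norm (translate_avg n g (\<lambda>x. f (h + x)) x - translate_avg n g f x) \<le> 2 * B / real (Suc n)"
      if x: "x \<in> H" for x
    proof -
      have mem: "((+) g ^^ k) x \<in> H" for k
        using x Cons.prems(1) assms(3) by (induction k) auto
      have "(\<Sum>k<Suc n. f (h + ((+) g ^^ k) x)) - (\<Sum>k<Suc n. f (((+) g ^^ k) x))
          = (\<Sum>k<Suc n. f (((+) g ^^ Suc k) x) - f (((+) g ^^ k) x))"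
        using True by (simp add: sum_subtractf del: sum.lessThan_Suc)
      also have "\<dots> = f (((+) g ^^ Suc n) x) - f x"
        by (subst sum_lessThan_telescope) simp
      finally have "translate_avg n g (\<lambda>x. f (h + x)) x - translate_avg n g f x
          = (f (((+) g ^^ Suc n) x) - f x) / of_nat (Suc n)"
        unfolding translate_avg_def diff_divide_distrib[symmetric] by (simp only: )
      moreover have "norm (f (((+) g ^^ Suc n) x) - f x) \<le> B + B"
        using Cons.prems(2)[OF mem] Cons.prems(2)[OF x] by (rule norm_triangle_le_diff[OF add_mono])
      ultimately show ?thesis
        by (simp add: norm_divide divide_right_mono del: of_nat_Suc funpow.simps)
    qed
    then have "box_avg n gs (\<lambda>x. translate_avg n g (\<lambda>x. f (h + x)) x - translate_avg n g f x)
        \<in> cball 0 (2 * B / real (Suc n))"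
      using Cons.prems(1) assms(2,3)
      by (intro box_avg_in_convex[of _ gs H]) (auto simp del: of_nat_Suc)
    then show ?thesis by (simp add: diff del: of_nat_Suc)
  next
    case False
    have "norm (translate_avg n g f x) \<le> B" if "x \<in> H" for x
      using translate_avg_in_convex[of "cball 0 B" g H f x n] Cons.prems assms(3) that by auto
    moreover have "translate_avg n g (\<lambda>x. f (h + x)) = (\<lambda>x. translate_avg n g f (h + x))"
      by (simp add: translate_avg_def funpow_add_commute)
    ultimately show ?thesis
      using Cons False by auto
  qed
qed simp

text \<open>The box averages lie in a product of discs, compact by Tychonoff, and \<open>M\<close>
  is a cluster point of them. All axioms are closed conditions on finitely many coordinates, so they
  pass to the cluster point.\<close>

theorem ex_invariant_mean:
  fixes H :: "'b::ab_group_add set"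
  assumes zero: "0 \<in> H" and add: "\<And>x y. x \<in> H \<Longrightarrow> y \<in> H \<Longrightarrow> x + y \<in> H"
    and neg: "\<And>x. x \<in> H \<Longrightarrow> - x \<in> H"
  obtains M where "invariant_mean H M"
proof -
  \<comment> \<open>The conjunct \<open>0 \<le> B\<close> gives a nonempty disc to unbounded
    functions too; \<open>A\<close> takes the value 0 there and so stays in the product
    \<open>K\<close>.\<close>
  define bnd :: "('b \<Rightarrow> complex) \<Rightarrow> real" where
    "bnd f = (SOME B. 0 \<le> B \<and> (bounded (f ` H) \<longrightarrow> (\<forall>x\<in>H. norm (f x) \<le> B)))" for f
  have bnd: "0 \<le> bnd f \<and> (bounded (f ` H) \<longrightarrow> (\<forall>x\<in>H. norm (f x) \<le> bnd f))" for f
    unfolding bnd_def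
    by (rule someI_ex) (metis bounded_iff image_eqI norm_ge_zero order_trans zero order_refl)
  define L where "L F = (SOME l. set l = F)" for F :: "'b set"
  have L: "set (L F) = F" if "finite F" for F
    unfolding L_def using finite_list[OF that] by (rule someI_ex)
  define A where "A = (\<lambda>(F, n) f. if bounded (f ` H) then box_avg n (L F) f else 0)"
  \<comment> \<open>The generators must exhaust \<open>H\<close> and the side length of the box must
    tend to infinity.\<close>
  define \<F> where "\<F> = filtermap A (finite_subsets_at_top H \<times>\<^sub>F sequentially)"
  have "\<F> \<noteq> bot"
    by (simp add: \<F>_def filtermap_bot_iff prod_filter_eq_bot)
  have fin: "eventually (\<lambda>F. finite F \<and> F \<subseteq> H) (finite_subsets_at_top H)"
    unfolding eventually_finite_subsets_at_top by blast
  have evI: "eventually P \<F>" if "\<And>F n. finite F \<Longrightarrow> F \<subseteq> H \<Longrightarrow> P (A (F, n))" for P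
  proof -
    have "eventually (\<lambda>i. (finite (fst i) \<and> fst i \<subseteq> H) \<and> True) (finite_subsets_at_top H \<times>\<^sub>F sequentially)"
      using fin eventually_True by (rule eventually_prodI)
    then show ?thesis
      unfolding \<F>_def eventually_filtermap
      by (rule eventually_mono) (metis prod.collapse that)
  qed
  define K where "K = PiE UNIV (\<lambda>f. cball (0::complex) (bnd f))"
  have "compact K"
    using compactin_PiE[of "\<lambda>_. euclidean" UNIV "\<lambda>f. cball (0::complex) (bnd f)"]
    by (simp add: K_def euclidean_product_topology)
  moreover have "eventually (\<lambda>m. m \<in> K) \<F>"
  proof (rule evI)
    fix F n assume F: "finite F" "F \<subseteq> H"
    have "box_avg n (L F) f \<in> cball 0 (bnd f)" if "bounded (f ` H)" for f
      using F L[of F] zero add bnd[of f] that by (intro box_avg_in_convex[of _ _ H]) auto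
    then show "A (F, n) \<in> K"
      using bnd by (auto simp: A_def K_def PiE_def)
  qed
  ultimately obtain M where "M \<in> K" and M: "inf (nhds M) \<F> \<noteq> bot"
    using \<open>\<F> \<noteq> bot\<close> unfolding compact_filter by blast
  have cl: "M \<in> C" if "closed C" "eventually (\<lambda>m. m \<in> C) \<F>" for C
  proof (rule ccontr)
    assume "M \<notin> C"
    then have "eventually (\<lambda>m. m \<in> - C) (nhds M)"
      using that(1) by (intro eventually_nhds_in_open) auto
    with that(2) have "eventually (\<lambda>_. False) (inf (nhds M) \<F>)"
      unfolding eventually_inf by blast
    with M show False by (simp add: trivial_limit_def)
  qed
  have ev: "continuous_on UNIV (\<lambda>m::('b \<Rightarrow> complex) \<Rightarrow> complex. m f)" for f
    by simp
  have eq: "u M = v M" if "continuous_on UNIV u" "continuous_on UNIV v"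
    "\<And>F n. finite F \<Longrightarrow> F \<subseteq> H \<Longrightarrow> u (A (F, n)) = v (A (F, n))"
    for u v :: "(('b \<Rightarrow> complex) \<Rightarrow> complex) \<Rightarrow> complex"
    using cl[OF closed_Collect_eq[OF that(1,2)]] evI[of "\<lambda>m. m \<in> {m. u m = v m}"] that(3) by simp
  have le: "u M \<le> v M" if "continuous_on UNIV u" "continuous_on UNIV v"
    "\<And>F n. finite F \<Longrightarrow> F \<subseteq> H \<Longrightarrow> u (A (F, n)) \<le> v (A (F, n))"
    for u v :: "(('b \<Rightarrow> complex) \<Rightarrow> complex) \<Rightarrow> real"
    using cl[OF closed_Collect_le[OF that(1,2)]] evI[of "\<lambda>m. m \<in> {m. u m \<le> v m}"] that(3) by simp
  have "invariant_mean H M"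
  proof
    fix f g :: "'b \<Rightarrow> complex" and c :: complex
    assume f: "bounded (f ` H)"
    {
      assume g: "bounded (g ` H)"
      show "M (\<lambda>x. f x + g x) = M f + M g"
        by (rule eq[of "\<lambda>m. m (\<lambda>x. f x + g x)" "\<lambda>m. m f + m g"])
          (auto simp: A_def box_avg_add f g bounded_plus_comp intro!: continuous_on_add)
    }
    show "M (\<lambda>x. c * f x) = c * M f"
      by (rule eq[of "\<lambda>m. m (\<lambda>x. c * f x)" "\<lambda>m. c * m f"])
        (auto simp: A_def box_avg_cmult f bounded_times_comp bounded_const_comp
          intro!: continuous_on_mult_left)
    {
      assume pos: "\<And>x. x \<in> H \<Longrightarrow> 0 \<le> Re (f x)"
      show "0 \<le> Re (M f)"
      proof (rule le[of "\<lambda>_. 0" "\<lambda>m. Re (m f)"])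
        fix F n assume F: "finite F" "F \<subseteq> H"
        have "box_avg n (L F) f \<in> {z. 0 \<le> Re z}"
          using F L[of F] zero add pos
          by (intro box_avg_in_convex[of _ _ H]) (auto simp: convex_halfspace_Re_ge)
        then show "0 \<le> Re (A (F, n) f)" by (simp add: A_def)
      qed (auto intro!: continuous_on_Re)
    }
    fix h assume h: "h \<in> H"
    have "(f \<circ> (+) h) ` H \<subseteq> f ` H" using h add by auto
    then have fh: "bounded ((\<lambda>x. f (h + x)) ` H)"
      using f by (auto intro: bounded_subset simp: image_comp o_def)
    \<comment> \<open>Invariance is the one axiom that the averages satisfy only approximately, once
      \<open>h\<close> is among the generators and the box is long.\<close>
    have "M \<in> {m. norm (m (\<lambda>x. f (h + x)) - m f) \<le> e}" if "0 < e" for e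
    proof (rule cl)
      show "closed {m. norm (m (\<lambda>x. f (h + x)) - m f :: complex) \<le> e}"
        by (intro closed_Collect_le continuous_on_norm continuous_on_diff ev continuous_on_const)
      have "(\<lambda>n. 2 * bnd f / real (Suc n)) \<longlonglongrightarrow> 0"
        using LIMSEQ_Suc[OF lim_const_over_n[of "2 * bnd f"]] by simp
      then have 1: "eventually (\<lambda>n. 2 * bnd f / real (Suc n) < e) sequentially"
        using that by (rule order_tendstoD)
      have 2: "eventually (\<lambda>F. finite F \<and> F \<subseteq> H \<and> h \<in> F) (finite_subsets_at_top H)"
        unfolding eventually_finite_subsets_at_top using h by (intro exI[of _ "{h}"]) auto
      have "eventually (\<lambda>i. A i \<in> {m. norm (m (\<lambda>x. f (h + x)) - m f) \<le> e})
          (finite_subsets_at_top H \<times>\<^sub>F sequentially)"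
        using eventually_prodI[OF 2 1]
      proof (rule eventually_mono)
        fix i :: "'b set \<times> nat"
        assume i: "(finite (fst i) \<and> fst i \<subseteq> H \<and> h \<in> fst i) \<and> 2 * bnd f / real (Suc (snd i)) < e"
        then have "norm (box_avg (snd i) (L (fst i)) (\<lambda>x. f (h + x)) - box_avg (snd i) (L (fst i)) f)
            \<le> 2 * bnd f / real (Suc (snd i))"
          using L[of "fst i"] zero add bnd[of f] f by (intro box_avg_translate[of _ H]) auto
        also have "\<dots> \<le> e" using i by simp
        finally show "A i \<in> {m. norm (m (\<lambda>x. f (h + x)) - m f) \<le> e}"
          by (cases i) (simp add: A_def f fh)
      qed
      then show "eventually (\<lambda>m. m \<in> {m. norm (m (\<lambda>x. f (h + x)) - m f) \<le> e}) \<F>"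
        by (simp add: \<F>_def eventually_filtermap)
    qed
    then have "norm (M (\<lambda>x. f (h + x)) - M f) \<le> 0 + e" if "0 < e" for e
      using that by simp
    then have "norm (M (\<lambda>x. f (h + x)) - M f) \<le> 0"
      by (rule field_le_epsilon)
    then show "M (\<lambda>x. f (h + x)) = M f" by simp
  next
    fix f :: "'b \<Rightarrow> complex" and B
    assume B: "\<And>x. x \<in> H \<Longrightarrow> norm (f x) \<le> B"
    have f: "bounded (f ` H)" unfolding bounded_iff using B by blast
    show "norm (M f) \<le> B"
    proof (rule le[of "\<lambda>m. norm (m f)" "\<lambda>_. B"])
      fix F n assume F: "finite F" "F \<subseteq> H"
      have "box_avg n (L F) f \<in> cball 0 B"
        using F L[of F] zero add B by (intro box_avg_in_convex[of _ _ H]) auto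
      then show "norm (A (F, n) f) \<le> B" by (simp add: A_def f)
    qed (auto intro!: continuous_on_norm)
  next
    show "M (\<lambda>_. 1) = 1"
      by (rule eq[of "\<lambda>m. m (\<lambda>_. 1)" "\<lambda>_. 1"])
        (auto simp: A_def box_avg_one bounded_const_comp)
  qed (use zero add neg in auto)
  then show ?thesis by (rule that)
qed

section \<open>Calculus of means and strict positivity\<close>

context invariant_mean
begin

lemma mean_const: "M (\<lambda>_. c) = c"
  using mean_cmult[OF bounded_const_comp[of 1], of c] mean_one by simp

lemma mean_diff:
  assumes "bounded (f ` H)" "bounded (g ` H)"
  shows "M (\<lambda>x. f x - g x) = M f - M g"
proof -
  have "bounded ((\<lambda>x. -1 * g x) ` H)"
    by (intro bounded_comp_intros assms)
  then show ?thesis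
    using mean_add[OF assms(1), of "\<lambda>x. -1 * g x"] mean_cmult[OF assms(2), of "-1"] by simp
qed

lemma mean_cong:
  assumes "bounded (f ` H)" "\<And>x. x \<in> H \<Longrightarrow> f x = g x"
  shows "M f = M g"
proof -
  have "g ` H = f ` H" using assms(2) by auto
  then have "M f - M g = M (\<lambda>x. f x - g x)" using assms(1) by (simp add: mean_diff)
  moreover have "norm (M (\<lambda>x. f x - g x)) \<le> 0" using assms(2) by (intro mean_norm_le) simp
  ultimately show ?thesis by simp
qed

lemma mean_sum:
  assumes "\<And>i. i \<in> I \<Longrightarrow> bounded (f i ` H)"
  shows "M (\<lambda>x. \<Sum>i\<in>I. f i x) = (\<Sum>i\<in>I. M (f i))"
  using assms
  by (induction I rule: infinite_finite_induct)
    (auto simp: mean_const mean_add bounded_sum_comp)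

lemma mean_mono:
  assumes "bounded (f ` H)" "bounded (g ` H)" "\<And>x. x \<in> H \<Longrightarrow> Re (f x) \<le> Re (g x)"
  shows "Re (M f) \<le> Re (M g)"
  using mean_nonneg[of "\<lambda>x. g x - f x"] assms by (simp add: mean_diff bounded_minus_comp)

text \<open>The functions \<i> f and - \<i> f have real part 0, so positivity bounds Im (M f) from
  both sides. This is what makes means commute with conjugation.\<close>

lemma mean_Im_zero:
  assumes "bounded (f ` H)" "\<And>x. x \<in> H \<Longrightarrow> Im (f x) = 0"
  shows "Im (M f) = 0"
proof -
  have "0 \<le> Re (M (\<lambda>x. \<i> * f x))" "0 \<le> Re (M (\<lambda>x. - \<i> * f x))"
    using assms by (intro mean_nonneg bounded_comp_intros; simp)+
  then show ?thesis
    using mean_cmult[OF assms(1), of \<i>] mean_cmult[OF assms(1), of "- \<i>"] by simp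
qed

lemma mean_cnj:
  assumes "bounded (f ` H)"
  shows "M (\<lambda>x. cnj (f x)) = cnj (M f)"
proof -
  have Re: "bounded ((\<lambda>x. complex_of_real (Re (f x))) ` H)"
    and Im: "bounded ((\<lambda>x. complex_of_real (Im (f x))) ` H)"
    using assms abs_Re_le_cmod abs_Im_le_cmod unfolding bounded_iff
    by (simp, meson order_trans)+
  have i: "bounded ((\<lambda>x. \<i> * complex_of_real (Im (f x))) ` H)"
    by (intro bounded_comp_intros Im)
  define r s where "r = M (\<lambda>x. complex_of_real (Re (f x)))" and "s = M (\<lambda>x. complex_of_real (Im (f x)))"
  have "Im r = 0" "Im s = 0"
    unfolding r_def s_def using Re Im by (auto intro: mean_Im_zero)
  moreover have "M f = r + \<i> * s"
    using mean_add[OF Re i] mean_cmult[OF Im, of \<i>] by (simp add: r_def s_def flip: complex_eq)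
  moreover have "M (\<lambda>x. cnj (f x)) = r - \<i> * s"
  proof -
    have "(\<lambda>x. cnj (f x)) = (\<lambda>x. complex_of_real (Re (f x)) - \<i> * complex_of_real (Im (f x)))"
      by (auto simp: complex_eq_iff)
    then show ?thesis using mean_diff[OF Re i] mean_cmult[OF Im, of \<i>] by (simp add: r_def s_def)
  qed
  ultimately show ?thesis by (simp add: complex_eq_iff)
qed

text \<open>Orthogonality relation: translation by \<open>h\<close> multiplies the mean by the
  factor \<xi> h, which is not 1.\<close>

lemma mean_nontrivial_character:
  assumes "\<And>x y. x \<in> H \<Longrightarrow> y \<in> H \<Longrightarrow> \<xi> (x + y) = \<xi> x * \<xi> y" "\<And>x. x \<in> H \<Longrightarrow> norm (\<xi> x) = 1"
    and "h \<in> H" "\<xi> h \<noteq> 1"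
  shows "M \<xi> = 0"
proof -
  have b: "bounded (\<xi> ` H)" unfolding bounded_iff using assms(2) by auto
  then have "M (\<lambda>x. \<xi> (h + x)) = M \<xi>" using assms(3) by (rule mean_translate)
  moreover have "M (\<lambda>x. \<xi> h * \<xi> x) = M (\<lambda>x. \<xi> (h + x))"
    using b assms by (intro mean_cong bounded_comp_intros) auto
  ultimately show ?thesis
    using mean_cmult[OF b, of "\<xi> h"] assms(4) by auto
qed

lemma bounded_translate:
  assumes "bounded (f ` H)" "h \<in> H"
  shows "bounded ((\<lambda>x. f (h + x)) ` H)"
proof -
  have "(\<lambda>x. f (h + x)) ` H \<subseteq> f ` H" using assms(2) add_mem by auto
  with assms(1) show ?thesis by (rule bounded_subset)
qed

text \<open>The translates of \<open>f\<close> by the elements of \<open>F\<close> all have the same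
  mean, and their sum is at least \<delta> everywhere because the translates of \<open>S\<close>
  cover \<open>H\<close>.\<close>

lemma mean_lower_bound:
  assumes F: "finite F" "F \<subseteq> H" "\<And>x. x \<in> H \<Longrightarrow> \<exists>a\<in>F. x - a \<in> S"
    and f: "bounded (f ` H)" "\<And>x. x \<in> H \<Longrightarrow> 0 \<le> Re (f x)" "\<And>x. x \<in> H \<Longrightarrow> x \<in> S \<Longrightarrow> \<delta> \<le> Re (f x)"
  shows "\<delta> / card F \<le> Re (M f)"
proof -
  have "F \<noteq> {}" using F(3) zero_mem by blast
  then have card: "0 < card F" using F(1) by (simp add: card_gt_0_iff)
  have b: "bounded ((\<lambda>x. f (- a + x)) ` H)" if "a \<in> F" for a
    using that F(2) uminus_mem by (intro bounded_translate f) auto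
  have "Re (M (\<lambda>_. complex_of_real \<delta>)) \<le> Re (M (\<lambda>x. \<Sum>a\<in>F. f (- a + x)))"
  proof (rule mean_mono)
    fix x assume x: "x \<in> H"
    then obtain a where a: "a \<in> F" "x - a \<in> S" using F(3) by blast
    have mem: "- c + x \<in> H" if "c \<in> F" for c
      using that F(2) x uminus_mem add_mem by blast
    have "\<delta> \<le> Re (f (- a + x))"
      using f(3)[OF mem] a by simp
    also have "\<dots> \<le> (\<Sum>a\<in>F. Re (f (- a + x)))"
      using F(1) a(1) f(2) mem by (intro member_le_sum) auto
    finally show "Re (complex_of_real \<delta>) \<le> Re (\<Sum>a\<in>F. f (- a + x))" by simp
  qed (intro bounded_comp_intros b; simp)+
  also have "M (\<lambda>x. \<Sum>a\<in>F. f (- a + x)) = (\<Sum>a\<in>F. M (\<lambda>x. f (- a + x)))"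
    using b by (rule mean_sum)
  also have "\<dots> = (\<Sum>a\<in>F. M f)"
    using F(2) uminus_mem by (intro sum.cong refl mean_translate[OF f(1)]) auto
  finally show ?thesis using card by (simp add: mean_const field_simps)
qed

end

text \<open>Rounding every coordinate to a finite net leaves finitely many patterns;
  \<open>F\<close> picks one element of \<open>H\<close> for each pattern that occurs. Bounded
  families are thus controlled by finitely many of their own members.\<close>

lemma finite_net:
  fixes z :: "'i \<Rightarrow> 'b \<Rightarrow> complex"
  assumes "finite I" "\<And>i. i \<in> I \<Longrightarrow> bounded (z i ` H)" "0 < \<eta>"
  obtains F where "finite F" "F \<subseteq> H" "\<And>h. h \<in> H \<Longrightarrow> \<exists>f\<in>F. \<forall>i\<in>I. norm (z i h - z i f) < \<eta>"
proof -
  have "\<forall>i\<in>I. \<exists>k. finite k \<and> z i ` H \<subseteq> (\<Union>x\<in>k. ball x (\<eta> / 2))"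
  proof
    fix i assume "i \<in> I"
    then have "compact (closure (z i ` H))" using assms(2) by (simp add: compact_closure)
    then obtain k where "finite k" "closure (z i ` H) \<subseteq> (\<Union>x\<in>k. ball x (\<eta> / 2))"
      using \<open>0 < \<eta>\<close> unfolding compact_eq_totally_bounded by (meson half_gt_zero)
    then show "\<exists>k. finite k \<and> z i ` H \<subseteq> (\<Union>x\<in>k. ball x (\<eta> / 2))"
      by (meson closure_subset order_trans)
  qed
  then obtain k where k: "\<And>i. i \<in> I \<Longrightarrow> finite (k i)"
    "\<And>i. i \<in> I \<Longrightarrow> z i ` H \<subseteq> (\<Union>x\<in>k i. ball x (\<eta> / 2))"
    by metis
  have "\<forall>i\<in>I. \<forall>h\<in>H. \<exists>x\<in>k i. dist x (z i h) < \<eta> / 2"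
    using k(2) by fastforce
  then obtain c where c: "\<And>i h. i \<in> I \<Longrightarrow> h \<in> H \<Longrightarrow> c i h \<in> k i"
    "\<And>i h. i \<in> I \<Longrightarrow> h \<in> H \<Longrightarrow> dist (c i h) (z i h) < \<eta> / 2"
    by metis
  define \<phi> where "\<phi> h = (\<lambda>i\<in>I. c i h)" for h
  have "finite (\<phi> ` H)"
    using c(1) by (intro finite_subset[OF _ finite_PiE[OF assms(1) k(1)]]) (auto simp: \<phi>_def)
  then obtain F where F: "F \<subseteq> H" "finite F" "\<phi> ` H = \<phi> ` F"
    using finite_subset_image[of "\<phi> ` H" \<phi> H] by blast
  have "\<exists>f\<in>F. \<forall>i\<in>I. norm (z i h - z i f) < \<eta>" if h: "h \<in> H" for h
  proof -
    obtain f where f: "f \<in> F" "\<phi> h = \<phi> f" using F(3) h by blast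
    have "norm (z i h - z i f) < \<eta>" if i: "i \<in> I" for i
    proof -
      have "c i h = c i f" using f(2) i unfolding \<phi>_def by (metis restrict_apply')
      then have "dist (c i h) (z i h) < \<eta> / 2" "dist (c i h) (z i f) < \<eta> / 2"
        using c(2)[OF i h] c(2)[OF i, of f] f(1) F(1) by auto
      then show ?thesis by (metis dist_norm dist_triangle_half_l dist_commute)
    qed
    with f(1) show ?thesis by blast
  qed
  with F show ?thesis using that by blast
qed

section \<open>Uniform continuity and uniform compactness on a topological group\<close>

definition uniformly_continuous_group :: "('a::topological_ab_group_add \<Rightarrow> complex) \<Rightarrow> bool"
  where "uniformly_continuous_group f \<longleftrightarrow>
    (\<forall>e>0. \<exists>W. open W \<and> 0 \<in> W \<and> (\<forall>w\<in>W. \<forall>x. norm (f (x + w) - f x) < e))"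

lemma open_translation_group:
  fixes U :: "'a::topological_ab_group_add set"
  assumes "open U"
  shows "open {x. x - a \<in> U}" "open {x. x + a \<in> U}"
proof -
  have *: "open {x. x + a \<in> U}" for a
  proof (subst openin_subopen[of euclidean, simplified], intro ballI)
    fix x assume "x \<in> {x. x + a \<in> U}"
    moreover have "((\<lambda>y. y + a) \<longlongrightarrow> x + a) (nhds x)"
      by (intro tendsto_intros) (simp add: filterlim_ident)
    ultimately have "eventually (\<lambda>y. y + a \<in> U) (nhds x)"
      using assms by (auto intro: topological_tendstoD)
    then show "\<exists>T. open T \<and> x \<in> T \<and> T \<subseteq> {x. x + a \<in> U}"
      unfolding eventually_nhds by blast
  qed
  show "open {x. x + a \<in> U}" by (rule *)
  show "open {x. x - a \<in> U}" using *[of "-a"] by simp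
qed

lemma open_uminus_group:
  fixes U :: "'a::topological_ab_group_add set"
  assumes "open U"
  shows "open {x. - x \<in> U}"
proof (subst openin_subopen[of euclidean, simplified], intro ballI)
  fix x assume "x \<in> {x. - x \<in> U}"
  then have "eventually (\<lambda>y. - y \<in> U) (nhds x)"
    using assms tendsto_uminus_nhds[of x] by (auto intro: topological_tendstoD)
  then show "\<exists>T. open T \<and> x \<in> T \<and> T \<subseteq> {x. - x \<in> U}"
    unfolding eventually_nhds by blast
qed

lemma open_add_nhds:
  fixes U :: "'a::topological_ab_group_add set"
  assumes "open U" "0 \<in> U"
  obtains W where "open W" "0 \<in> W" "\<And>x y. x \<in> W \<Longrightarrow> y \<in> W \<Longrightarrow> x + y \<in> U" "\<And>x. x \<in> W \<Longrightarrow> - x \<in> W"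
proof -
  have "eventually (\<lambda>p. fst p + snd p \<in> U) (nhds 0 \<times>\<^sub>F nhds (0::'a))"
    using tendsto_add_Pair[of "0::'a" 0] assms by (auto intro: topological_tendstoD)
  then obtain P Q where PQ: "eventually P (nhds (0::'a))" "eventually Q (nhds (0::'a))"
    "\<And>x y. P x \<Longrightarrow> Q y \<Longrightarrow> x + y \<in> U"
    unfolding eventually_prod_filter by auto
  have "eventually (\<lambda>x. P x \<and> Q x) (nhds (0::'a))" using PQ(1,2) by (rule eventually_conj)
  then obtain S where S: "open S" "0 \<in> S" "\<And>x. x \<in> S \<Longrightarrow> P x \<and> Q x"
    unfolding eventually_nhds by blast
  let ?W = "S \<inter> {x. - x \<in> S}"
  have "open ?W" using S(1) open_uminus_group[OF S(1)] by blast
  then show ?thesis by (rule that) (use S PQ(3) in auto)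
qed

lemma uniformly_continuous_group_continuous:
  assumes "uniformly_continuous_group f"
  shows "continuous_on UNIV f"
  unfolding continuous_on_def
proof (intro ballI tendstoI)
  fix x and e :: real assume "0 < e"
  then obtain W where W: "open W" "0 \<in> W" "\<And>w. w \<in> W \<Longrightarrow> norm (f (x + w) - f x) < e"
    using assms unfolding uniformly_continuous_group_def by meson
  have "eventually (\<lambda>y. y \<in> {y. y - x \<in> W}) (nhds x)"
    using open_translation_group(1)[OF W(1), of x] W(2) by (intro eventually_nhds_in_open) auto
  then have "eventually (\<lambda>y. dist (f y) (f x) < e) (nhds x)"
  proof (rule eventually_mono)
    fix y assume "y \<in> {y. y - x \<in> W}"
    then show "dist (f y) (f x) < e" using W(3)[of "y - x"] by (simp add: dist_norm)
  qed
  then show "eventually (\<lambda>y. dist (f y) (f x) < e) (at x within UNIV)"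
    by (simp add: eventually_at_filter eventually_mono)
qed

lemma Cauchy_bcontfun_convergent:
  fixes f :: "nat \<Rightarrow> ('a::topological_space \<Rightarrow>\<^sub>C 'b::complete_space)"
  assumes "Cauchy f"
  shows "convergent f"
proof -
  have "uniformly_Cauchy_on UNIV (\<lambda>n. apply_bcontfun (f n))"
    using assms unfolding Cauchy_def uniformly_Cauchy_on_def by (metis dist_fun_lt_imp_dist_val_lt)
  then obtain g where "uniform_limit UNIV (\<lambda>n. apply_bcontfun (f n)) g sequentially"
    using Cauchy_uniformly_convergent unfolding uniformly_convergent_on_def by blast
  then show ?thesis
    by (metis uniform_limit_bcontfunE[OF _ sequentially_bot] convergentI)
qed

locale totally_bounded_mean = invariant_mean UNIV M
  for M :: "('a::topological_ab_group_add \<Rightarrow> complex) \<Rightarrow> complex" +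
  assumes totally_bounded: "open U \<Longrightarrow> 0 \<in> U \<Longrightarrow> \<exists>F. finite F \<and> (\<forall>x. \<exists>a\<in>F. x - a \<in> (U :: 'a::topological_ab_group_add set))"
begin

text \<open>Total boundedness replaces compactness of the domain: by uniform equicontinuity the
  values on a finite set determine each function up to a small error on the whole group. The limit
  is therefore uniform on the group.\<close>

lemma Arzela_Ascoli_group:
  fixes u :: "nat \<Rightarrow> 'a \<Rightarrow> complex"
  assumes bd: "\<And>n x. norm (u n x) \<le> C"
    and equi: "\<And>e. 0 < e \<Longrightarrow> \<exists>W. open W \<and> 0 \<in> W \<and> (\<forall>n. \<forall>w\<in>W. \<forall>x. norm (u n (x + w) - u n x) < e)"
  obtains r l where "strict_mono r" "uniform_limit UNIV (\<lambda>n. u (r n)) l sequentially"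
proof -
  have cont: "continuous_on UNIV (u n)" for n
    using equi by (intro uniformly_continuous_group_continuous)
      (unfold uniformly_continuous_group_def, meson)
  have u: "u n \<in> bcontfun" for n
    using cont bd by (rule bcontfun_normI)
  define v where "v n = Bcontfun (u n)" for n
  have v: "apply_bcontfun (v n) = u n" for n
    using u by (simp add: v_def Bcontfun_inverse)
  have "compact (closure (range v))"
    unfolding compact_eq_totally_bounded
  proof (intro conjI allI impI)
    show "complete (closure (range v))"
      unfolding complete_def using Cauchy_bcontfun_convergent closed_sequentially[OF closed_closure]
      by (metis convergent_def)
    fix e :: real assume e: "0 < e"
    then have "0 < e / 8" by simp
    then obtain W where W: "open W" "0 \<in> W" "\<And>n w x. w \<in> W \<Longrightarrow> norm (u n (x + w) - u n x) < e / 8"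
      using equi by meson
    obtain F where F: "finite F" "\<And>x. \<exists>a\<in>F. x - a \<in> W"
      using totally_bounded[OF W(1,2)] by blast
    obtain N where N: "finite N" "\<And>n. \<exists>m\<in>N. \<forall>a\<in>F. norm (u n a - u m a) < e / 8"
      using finite_net[of F "\<lambda>a n. u n a" UNIV "e / 8"] F(1) bd e unfolding bounded_iff
      by (metis (no_types, lifting) UNIV_I \<open>0 < e / 8\<close> imageE)
    \<comment> \<open>Three errors of e / 8 fit into e / 2, and closed balls are used so that their
      union contains the closure as well.\<close>
    have "range v \<subseteq> (\<Union>m\<in>N. cball (v m) (e / 2))"
    proof
      fix f assume "f \<in> range v"
      then obtain n where f: "f = v n" by blast
      obtain m where m: "m \<in> N" "\<And>a. a \<in> F \<Longrightarrow> norm (u n a - u m a) < e / 8"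
        using N(2) by blast
      have "dist (v m) (v n) \<le> e / 2"
      proof (rule dist_bound, unfold v dist_norm)
        fix x
        obtain a where a: "a \<in> F" "x - a \<in> W" using F(2) by blast
        have "norm (u n x - u n a) < e / 8" "norm (u m x - u m a) < e / 8"
          using W(3)[OF a(2), of _ a] by simp_all
        then show "norm (u m x - u n x) \<le> e / 2"
          using m(2)[OF a(1)] dist_triangle[of "u m x" "u n x" "u m a"] e
            dist_triangle[of "u m a" "u n x" "u n a"]
          by (simp add: dist_norm norm_minus_commute)
      qed
      then show "f \<in> (\<Union>m\<in>N. cball (v m) (e / 2))" using m(1) f by auto
    qed
    then have "closure (range v) \<subseteq> (\<Union>m\<in>N. cball (v m) (e / 2))"
      using N(1) by (intro closure_minimal closed_UN) auto
    also have "\<dots> \<subseteq> (\<Union>m\<in>N. ball (v m) e)"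
      using e by (intro UN_mono) auto
    finally show "\<exists>k. finite k \<and> closure (range v) \<subseteq> (\<Union>x\<in>k. ball x e)"
      using N(1) by (intro exI[of _ "v ` N"]) auto
  qed
  moreover have "\<forall>n. v n \<in> closure (range v)"
    by (simp add: subsetD[OF closure_subset])
  ultimately obtain l r where r: "strict_mono r" "(v \<circ> r) \<longlonglongrightarrow> l"
    unfolding compact_def by metis
  have "uniform_limit UNIV (\<lambda>n. apply_bcontfun ((v \<circ> r) n)) l sequentially"
    using tendsto_bcontfun_uniform_limit[OF r(2)] .
  then show ?thesis using r(1) by (intro that[of r l]) (simp_all add: v)
qed

end

section \<open>Positive definite functions\<close>

text \<open>A list allows repeated points, so that test data can be combined by mere
  concatenation.\<close>

definition quadratic_form :: "('a::ab_group_add \<Rightarrow> complex) \<Rightarrow> (complex \<times> 'a) list \<Rightarrow> complex"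
  where "quadratic_form \<psi> l = (\<Sum>p\<leftarrow>l. \<Sum>q\<leftarrow>l. fst p * cnj (fst q) * \<psi> (snd p - snd q))"

definition pos_def :: "('a::ab_group_add \<Rightarrow> complex) \<Rightarrow> bool"
  where "pos_def \<psi> \<longleftrightarrow> (\<forall>l. quadratic_form \<psi> l \<in> \<real>\<^sub>\<ge>\<^sub>0)"

text \<open>For \<open>norm c = 1\<close> this is the convolution of \<psi> with a measure of two
  atoms, of weights 1 and c, and its adjoint. A single translate of a positive definite function is
  in general not positive definite; this is the simplest combination that is, and the free phase
  \<open>c\<close> recovers the translates.\<close>

definition symm_translate :: "complex \<Rightarrow> 'a::ab_group_add \<Rightarrow> ('a \<Rightarrow> complex) \<Rightarrow> 'a \<Rightarrow> complex"
  where "symm_translate c g \<psi> = (\<lambda>x. 2 * \<psi> x + c * \<psi> (x + g) + cnj c * \<psi> (x - g))"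

text \<open>The test data are doubled by a copy shifted by \<open>g\<close> and rotated by
  \<open>c\<close>; the diagonal terms give 2 \<psi>, the mixed terms the two translates.\<close>

lemma quadratic_form_symm_translate:
  assumes "norm c = 1"
  shows "quadratic_form (symm_translate c g \<psi>) l
    = quadratic_form \<psi> (l @ map (\<lambda>p. (c * fst p, snd p + g)) l)"
proof -
  have c: "c * (cnj c * z) = z" for z
    using assms complex_norm_square[of c] by (simp flip: mult.assoc)
  have d: "x + g - (y + g) = x - y" "x - (y + g) = x - y - g" "x + g - y = x - y + g" for x y :: 'a
    by (simp_all add: algebra_simps)
  show ?thesis
    by (simp add: quadratic_form_def symm_translate_def o_def sum_list_addf[symmetric] d algebra_simps c)
qed

lemma pos_def_symm_translate: "pos_def \<psi> \<Longrightarrow> norm c = 1 \<Longrightarrow> pos_def (symm_translate c g \<psi>)"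
  by (simp add: pos_def_def quadratic_form_symm_translate)

lemma pos_def_zero:
  assumes "pos_def \<psi>"
  shows "0 \<le> Re (\<psi> 0)" "Im (\<psi> 0) = 0"
  using assms[unfolded pos_def_def, rule_format, of "[(1, 0)]"]
  by (auto simp: quadratic_form_def complex_nonneg_Reals_iff)

lemma pos_def_scale:
  assumes "pos_def \<psi>" "0 \<le> r"
  shows "pos_def (\<lambda>x. complex_of_real r * \<psi> x)"
proof -
  have "quadratic_form (\<lambda>x. complex_of_real r * \<psi> x) l = complex_of_real r * quadratic_form \<psi> l" for l
    by (simp add: quadratic_form_def sum_list_const_mult[symmetric] algebra_simps)
  then show ?thesis
    using assms by (auto simp: pos_def_def intro: nonneg_Reals_mult_I)
qed

lemma pos_def_uminus:
  assumes "pos_def \<psi>"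
  shows "\<psi> (- g) = cnj (\<psi> g)"
proof -
  have "Im (symm_translate c g \<psi> 0) = 0" if "norm c = 1" for c
    using pos_def_zero(2)[OF pos_def_symm_translate[OF assms that]] .
  from this[of 1] this[of \<i>] show ?thesis
    using pos_def_zero(2)[OF assms] by (simp add: symm_translate_def complex_eq_iff)
qed

lemma norm_le_if_Re_rotate_le:
  assumes "\<And>c. norm c = 1 \<Longrightarrow> Re (c * z) \<le> r"
  shows "norm z \<le> r"
proof (cases "z = 0")
  case True
  then show ?thesis using assms[of 1] by simp
next
  case False
  have "cnj z / norm z * z = norm z"
    using False complex_norm_square[of z] by (simp add: field_simps power2_eq_square)
  then show ?thesis
    using assms[of "cnj z / norm z"] False by (simp add: norm_divide)
qed

text \<open>At 0 the symmetric translate has real part 2 Re (\<psi> 0) + 2 Re (c \<psi> g) \<ge> 0,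
  for every phase \<open>c\<close>.\<close>

lemma pos_def_norm_le:
  assumes "pos_def \<psi>"
  shows "norm (\<psi> g) \<le> Re (\<psi> 0)"
proof -
  have "Re (c * - \<psi> g) \<le> Re (\<psi> 0)" if "norm c = 1" for c
  proof -
    have "0 \<le> Re (symm_translate c g \<psi> 0)"
      using pos_def_zero(1)[OF pos_def_symm_translate[OF assms that]] .
    then show ?thesis by (simp add: symm_translate_def pos_def_uminus[OF assms])
  qed
  then have "norm (- \<psi> g) \<le> Re (\<psi> 0)" by (rule norm_le_if_Re_rotate_le)
  then show ?thesis by simp
qed

lemma pos_def_limit:
  assumes "\<And>n. pos_def (\<psi> n)" "\<And>x. (\<lambda>n. \<psi> n x) \<longlonglongrightarrow> \<phi> x"
  shows "pos_def \<phi>"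
  unfolding pos_def_def
proof
  fix l
  have lim: "(\<lambda>n. \<Sum>p\<leftarrow>k. f n p) \<longlonglongrightarrow> (\<Sum>p\<leftarrow>k. g p)" if "\<And>p. (\<lambda>n. f n p) \<longlonglongrightarrow> g p"
    for k and f :: "nat \<Rightarrow> complex \<times> 'a \<Rightarrow> complex" and g
    by (induction k) (auto intro!: tendsto_add that)
  have "(\<lambda>n. quadratic_form (\<psi> n) l) \<longlonglongrightarrow> quadratic_form \<phi> l"
    unfolding quadratic_form_def by (intro lim tendsto_mult_left assms(2))
  then show "quadratic_form \<phi> l \<in> \<real>\<^sub>\<ge>\<^sub>0"
    by (rule closed_sequentially[OF closed_nonneg_Reals_complex, rotated])
      (use assms(1) in \<open>simp add: pos_def_def\<close>)
qed

section \<open>Autocorrelation and the inner product of mean square\<close>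

context invariant_mean
begin

definition autocorrelation :: "('b \<Rightarrow> complex) \<Rightarrow> 'b \<Rightarrow> complex"
  where "autocorrelation f x = M (\<lambda>y. f (x + y) * cnj (f y))"

definition pairing :: "('b \<Rightarrow> complex) \<Rightarrow> ('b \<Rightarrow> complex) \<Rightarrow> real"
  where "pairing F \<psi> = Re (M (\<lambda>y. \<psi> y * cnj (F y)))"

lemma pairing_add:
  assumes "bounded (F ` H)" "bounded (\<psi> ` H)" "bounded (\<phi> ` H)"
  shows "pairing F (\<lambda>x. \<psi> x + \<phi> x) = pairing F \<psi> + pairing F \<phi>"
proof -
  have "M (\<lambda>y. \<psi> y * cnj (F y) + \<phi> y * cnj (F y)) = M (\<lambda>y. \<psi> y * cnj (F y)) + M (\<lambda>y. \<phi> y * cnj (F y))"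
    by (intro mean_add bounded_comp_intros assms)
  then show ?thesis by (simp add: pairing_def distrib_right)
qed

lemma pairing_cmult:
  assumes "bounded (F ` H)" "bounded (\<psi> ` H)"
  shows "pairing F (\<lambda>x. c * \<psi> x) = Re (c * M (\<lambda>y. \<psi> y * cnj (F y)))"
proof -
  have "M (\<lambda>y. c * (\<psi> y * cnj (F y))) = c * M (\<lambda>y. \<psi> y * cnj (F y))"
    by (intro mean_cmult bounded_comp_intros assms)
  then show ?thesis by (simp add: pairing_def mult.assoc)
qed

lemma pairing_scale:
  assumes "bounded (F ` H)" "bounded (\<psi> ` H)"
  shows "pairing F (\<lambda>x. complex_of_real r * \<psi> x) = r * pairing F \<psi>"
  using pairing_cmult[OF assms, of "complex_of_real r"] by (simp add: pairing_def)

lemma pairing_commute: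
  assumes "bounded (F ` H)" "bounded (\<psi> ` H)"
  shows "pairing \<psi> F = pairing F \<psi>"
proof -
  have "M (\<lambda>y. cnj (F y * cnj (\<psi> y))) = cnj (M (\<lambda>y. F y * cnj (\<psi> y)))"
    by (intro mean_cnj bounded_comp_intros assms)
  then show ?thesis by (simp add: pairing_def mult.commute)
qed

lemma pairing_bound:
  assumes "\<And>x. x \<in> H \<Longrightarrow> norm (\<psi> x) \<le> e" "\<And>x. x \<in> H \<Longrightarrow> norm (F x) \<le> B" "0 \<le> e"
  shows "\<bar>pairing F \<psi>\<bar> \<le> e * B"
proof -
  have "norm (M (\<lambda>y. \<psi> y * cnj (F y))) \<le> e * B"
    using assms by (intro mean_norm_le) (auto simp: norm_mult intro!: mult_mono)
  then show ?thesis unfolding pairing_def using abs_Re_le_cmod order_trans by blast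
qed

end

context totally_bounded_mean
begin

lemma autocorrelation_diff:
  assumes "bounded (range f)"
  shows "autocorrelation f (x - z) = M (\<lambda>y. f (x + y) * cnj (f (z + y)))"
proof -
  have "bounded (range (\<lambda>y. f (x - z + y) * cnj (f y)))"
    by (intro bounded_comp_intros assms bounded_translate) simp
  from mean_translate[OF this, of z] show ?thesis
    by (simp add: autocorrelation_def algebra_simps)
qed

text \<open>By invariance the quadratic form is the mean of |G|^2, where \<open>G\<close> is the
  corresponding combination of translates of \<open>f\<close>.\<close>

lemma pos_def_autocorrelation:
  assumes f: "bounded (range f)"
  shows "pos_def (autocorrelation f)"
  unfolding pos_def_def
proof
  fix l :: "(complex \<times> 'a) list"
  define n a x where "n = length l" and "a i = fst (l ! i)" and "x i = snd (l ! i)" for i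
  define G where "G y = (\<Sum>i<n. a i * f (x i + y))" for y
  have ft: "bounded (range (\<lambda>y. f (z + y)))" for z
    by (rule bounded_translate[OF f]) simp
  have G: "bounded (range G)"
    unfolding G_def by (intro bounded_comp_intros ft)
  have b: "bounded (range (\<lambda>y. a i * cnj (a j) * (f (x i + y) * cnj (f (x j + y)))))" for i j
    by (intro bounded_comp_intros ft)
  have "quadratic_form (autocorrelation f) l
      = (\<Sum>i<n. \<Sum>j<n. a i * cnj (a j) * autocorrelation f (x i - x j))"
    by (simp add: quadratic_form_def sum_list_sum_nth n_def a_def x_def atLeast0LessThan)
  also have "\<dots> = (\<Sum>i<n. \<Sum>j<n. M (\<lambda>y. a i * cnj (a j) * (f (x i + y) * cnj (f (x j + y)))))"
    unfolding autocorrelation_diff[OF f]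
    by (intro sum.cong refl mean_cmult[symmetric] bounded_comp_intros ft)
  also have "\<dots> = M (\<lambda>y. \<Sum>i<n. \<Sum>j<n. a i * cnj (a j) * (f (x i + y) * cnj (f (x j + y))))"
    using b by (simp add: mean_sum bounded_sum_comp)
  also have "\<dots> = M (\<lambda>y. G y * cnj (G y))"
    by (simp add: G_def sum_product algebra_simps)
  finally have eq: "quadratic_form (autocorrelation f) l = M (\<lambda>y. G y * cnj (G y))" .
  have GG: "bounded (range (\<lambda>y. G y * cnj (G y)))"
    by (intro bounded_comp_intros G)
  show "quadratic_form (autocorrelation f) l \<in> \<real>\<^sub>\<ge>\<^sub>0"
    unfolding eq complex_nonneg_Reals_iff
    using mean_nonneg[OF GG] mean_Im_zero[OF GG] by simp
qed

definition normalized_pos_def :: "('a \<Rightarrow> complex) set"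
  where "normalized_pos_def = {\<psi>. continuous_on UNIV \<psi> \<and> pos_def \<psi> \<and> \<psi> 0 = 1}"

lemma pos_def_bounded: "pos_def \<psi> \<Longrightarrow> bounded (range \<psi>)" for \<psi> :: "'a \<Rightarrow> complex"
  unfolding bounded_iff using pos_def_norm_le by blast

lemma normalized_norm_le: "\<psi> \<in> normalized_pos_def \<Longrightarrow> norm (\<psi> x) \<le> 1"
  unfolding normalized_pos_def_def using pos_def_norm_le[of \<psi> x] by simp

lemma continuous_symm_translate:
  fixes \<psi> :: "'a \<Rightarrow> complex"
  assumes "continuous_on UNIV \<psi>"
  shows "continuous_on UNIV (symm_translate c g \<psi>)"
proof -
  have t: "continuous_on UNIV (\<lambda>x. \<psi> (x + h))" for h
  proof (rule continuous_on_compose2[OF assms])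
    show "continuous_on UNIV (\<lambda>x. x + h)"
      unfolding continuous_on_def by (intro ballI tendsto_intros)
  qed simp
  show ?thesis
    unfolding symm_translate_def
    using assms t[of g] t[of "- g"] by (auto intro!: continuous_intros)
qed

text \<open>Homogeneity extends the bound to the cone of all continuous positive definite functions,
  in particular to symmetric translates.\<close>

lemma pairing_le_of_normalized:
  assumes F: "bounded (range F)" and \<kappa>: "\<And>\<psi>. \<psi> \<in> normalized_pos_def \<Longrightarrow> pairing F \<psi> \<le> \<kappa>"
    and \<psi>: "continuous_on UNIV \<psi>" "pos_def \<psi>"
  shows "pairing F \<psi> \<le> \<kappa> * Re (\<psi> 0)"
proof (cases "\<psi> 0 = 0")
  case True
  then have "\<psi> = (\<lambda>_. 0)" using pos_def_norm_le[OF \<psi>(2)] by (auto simp: fun_eq_iff)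
  then show ?thesis by (simp add: pairing_def mean_const)
next
  case False
  define r where "r = Re (\<psi> 0)"
  have r: "0 < r" "\<psi> 0 = complex_of_real r"
    using pos_def_zero[OF \<psi>(2)] False by (auto simp: r_def complex_eq_iff)
  have "(\<lambda>x. complex_of_real (1 / r) * \<psi> x) \<in> normalized_pos_def"
    unfolding normalized_pos_def_def using r \<psi> pos_def_scale[OF \<psi>(2), of "1 / r"]
    by (auto intro!: continuous_intros)
  from \<kappa>[OF this] have "1 / r * pairing F \<psi> \<le> \<kappa>"
    unfolding pairing_scale[OF F pos_def_bounded[OF \<psi>(2)]] .
  then show ?thesis using r(1) by (simp add: r_def field_simps)
qed

text \<open>This is the convolution of \<psi> with the function y \<mapsto> cnj (F (- y)); the real
  part of its value at 0 is the pairing.\<close>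

definition correlation :: "('a \<Rightarrow> complex) \<Rightarrow> ('a \<Rightarrow> complex) \<Rightarrow> 'a \<Rightarrow> complex"
  where "correlation F \<psi> g = M (\<lambda>y. \<psi> (g + y) * cnj (F y))"

lemma pairing_symm_translate:
  assumes F: "bounded (range F)" and \<psi>: "bounded (range \<psi>)"
  shows "pairing F (symm_translate c g \<psi>)
    = 2 * pairing F \<psi> + Re (c * (correlation F \<psi> g + cnj (correlation F \<psi> (- g))))"
proof -
  have t: "bounded (range (\<lambda>x. \<psi> (h + x)))" for h
    by (rule bounded_translate[OF \<psi>]) simp
  have eq: "symm_translate c g \<psi> = (\<lambda>x. (2 * \<psi> x + c * \<psi> (g + x)) + cnj c * \<psi> (- g + x))"
    by (simp add: symm_translate_def add.commute)
  have "pairing F (symm_translate c g \<psi>) = pairing F (\<lambda>x. 2 * \<psi> x) + pairing F (\<lambda>x. c * \<psi> (g + x))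
      + pairing F (\<lambda>x. cnj c * \<psi> (- g + x))"
    unfolding eq
    by (subst pairing_add, intro F, intro bounded_comp_intros t \<psi>, intro bounded_comp_intros t,
        subst pairing_add, intro F, intro bounded_comp_intros \<psi>, intro bounded_comp_intros t, rule refl)
  also have "\<dots> = 2 * pairing F \<psi> + Re (c * correlation F \<psi> g) + Re (cnj c * correlation F \<psi> (- g))"
    unfolding pairing_cmult[OF F \<psi>] pairing_cmult[OF F t] by (simp add: pairing_def correlation_def)
  also have "Re (cnj c * correlation F \<psi> (- g)) = Re (c * cnj (correlation F \<psi> (- g)))"
    by simp
  finally show ?thesis by (simp add: algebra_simps)
qed

text \<open>By maximality of \<open>\<kappa>\<close> the function \<open>\<kappa> \<psi> - \<psi> * F\<close> is positive definite up to symmetrization, so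
  that it is bounded by its value at 0.\<close>

lemma near_eigenfunction:
  assumes F: "bounded (range F)" and \<kappa>: "\<And>\<psi>. \<psi> \<in> normalized_pos_def \<Longrightarrow> pairing F \<psi> \<le> \<kappa>"
    and \<psi>: "\<psi> \<in> normalized_pos_def"
  shows "norm (complex_of_real \<kappa> * \<psi> g - (correlation F \<psi> g + cnj (correlation F \<psi> (- g))) / 2)
    \<le> \<kappa> - pairing F \<psi>"
proof -
  have pd: "continuous_on UNIV \<psi>" "pos_def \<psi>" "\<psi> 0 = 1"
    using \<psi> by (auto simp: normalized_pos_def_def)
  \<comment> \<open>A symmetric translate involves both \<open>g\<close> and \<open>- g\<close>, so
    only the hermitian part s / 2 of the correlation appears.\<close>
  define s where "s = correlation F \<psi> g + cnj (correlation F \<psi> (- g))"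
  have "Re (c * (s - 2 * complex_of_real \<kappa> * \<psi> g)) \<le> 2 * (\<kappa> - pairing F \<psi>)" if c: "norm c = 1" for c
  proof -
    have "pairing F (symm_translate c g \<psi>) \<le> \<kappa> * Re (symm_translate c g \<psi> 0)"
      by (intro pairing_le_of_normalized F \<kappa> continuous_symm_translate pos_def_symm_translate pd c)
    moreover have "Re (symm_translate c g \<psi> 0) = 2 + 2 * Re (c * \<psi> g)"
      using pd by (simp add: symm_translate_def pos_def_uminus)
    ultimately show ?thesis
      unfolding pairing_symm_translate[OF F pos_def_bounded[OF pd(2)]] s_def[symmetric]
      by (simp add: algebra_simps)
  qed
  then have "norm (s - 2 * complex_of_real \<kappa> * \<psi> g) \<le> 2 * (\<kappa> - pairing F \<psi>)"
    by (rule norm_le_if_Re_rotate_le)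
  moreover have "complex_of_real \<kappa> * \<psi> g - s / 2 = - (1 / 2) * (s - 2 * complex_of_real \<kappa> * \<psi> g)"
    by (simp add: field_simps)
  then have "norm (complex_of_real \<kappa> * \<psi> g - s / 2) = norm (s - 2 * complex_of_real \<kappa> * \<psi> g) / 2"
    by (simp only: norm_mult) simp
  ultimately show ?thesis unfolding s_def by simp
qed

end

definition unitary_character :: "('a::topological_ab_group_add \<Rightarrow> complex) \<Rightarrow> bool"
  where "unitary_character \<xi> \<longleftrightarrow>
    continuous_on UNIV \<xi> \<and> (\<forall>x y. \<xi> (x + y) = \<xi> x * \<xi> y) \<and> (\<forall>x. norm (\<xi> x) = 1)"

lemma ex_seq_tendsto_Sup:
  fixes S :: "real set"
  assumes "S \<noteq> {}" "bdd_above S"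
  obtains s where "\<And>n. s n \<in> S" "s \<longlonglongrightarrow> Sup S"
  using closure_contains_Sup[OF assms] unfolding closure_sequential by blast

section \<open>Attained suprema and extreme points\<close>

context totally_bounded_mean
begin

lemma bounded_range_translate: "bounded (range f) \<Longrightarrow> bounded (range (\<lambda>x. f (h + x)))"
  for f :: "'a \<Rightarrow> complex"
  by (rule bounded_translate) simp_all

lemma normalized_bounded: "\<psi> \<in> normalized_pos_def \<Longrightarrow> bounded (range \<psi>)"
  by (simp add: normalized_pos_def_def pos_def_bounded)

lemma norm_correlation_le:
  assumes "\<And>x. norm (F x) \<le> B" "\<And>x. norm (\<psi> x) \<le> 1"
  shows "norm (correlation F \<psi> g) \<le> B"
  unfolding correlation_def
proof (rule mean_norm_le)
  fix y
  have "norm (\<psi> (g + y)) * norm (F y) \<le> 1 * B"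
    using assms by (intro mult_mono) auto
  then show "norm (\<psi> (g + y) * cnj (F y)) \<le> B"
    by (simp add: norm_mult)
qed

text \<open>Invariance moves the shift from \<psi> to \<open>F\<close>, so the modulus of continuity
  comes from \<open>F\<close> alone and is uniform in \<psi>.\<close>

lemma norm_correlation_diff_le:
  assumes F: "bounded (range F)" and \<psi>: "\<And>x. norm (\<psi> x) \<le> 1"
    and w: "\<And>x. norm (F (x - w) - F x) \<le> e"
  shows "norm (correlation F \<psi> (g + w) - correlation F \<psi> g) \<le> e"
proof -
  have b: "bounded (range \<psi>)" unfolding bounded_iff using \<psi> by blast
  note bi = bounded_comp_intros bounded_range_translate[OF F] bounded_range_translate[OF b] F
  have "correlation F \<psi> (g + w) = M (\<lambda>y. \<psi> (g + w + (- w + y)) * cnj (F (- w + y)))"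
    unfolding correlation_def by (rule mean_translate[symmetric]) (intro bi, simp)
  also have "(\<lambda>y. \<psi> (g + w + (- w + y)) * cnj (F (- w + y))) = (\<lambda>y. \<psi> (g + y) * cnj (F (- w + y)))"
    by (simp add: algebra_simps)
  finally have "correlation F \<psi> (g + w) - correlation F \<psi> g
      = M (\<lambda>y. \<psi> (g + y) * cnj (F (- w + y)) - \<psi> (g + y) * cnj (F y))"
    unfolding correlation_def by (subst mean_diff) (intro bi, intro bi, simp)
  also have "norm \<dots> \<le> e"
  proof (rule mean_norm_le)
    fix y
    have "norm (\<psi> (g + y) * cnj (F (- w + y)) - \<psi> (g + y) * cnj (F y))
        = norm (\<psi> (g + y)) * norm (F (y - w) - F y)"
      by (simp add: norm_mult flip: right_diff_distrib complex_cnj_diff)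
    also have "\<dots> \<le> 1 * e" using \<psi> w by (intro mult_mono) auto
    finally show "norm (\<psi> (g + y) * cnj (F (- w + y)) - \<psi> (g + y) * cnj (F y)) \<le> e" by simp
  qed
  finally show ?thesis .
qed

lemma pairing_uniform_limit:
  assumes F: "\<And>x. norm (F x) \<le> B" and \<psi>: "\<And>n. bounded (range (\<psi> n))" "bounded (range \<phi>)"
    and lim: "uniform_limit UNIV \<psi> \<phi> sequentially"
  shows "(\<lambda>n. pairing F (\<psi> n)) \<longlonglongrightarrow> pairing F \<phi>"
proof (rule tendstoI)
  fix e :: real assume e: "0 < e"
  have Fb: "bounded (range F)" unfolding bounded_iff using F by blast
  have B: "0 \<le> B" using F norm_ge_zero order_trans by blast
  define d where "d = e / (2 * (B + 1))"
  have d: "0 < d" "d * B < e" using e B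
    by (simp_all add: d_def field_simps add_nonneg_pos)
  have "eventually (\<lambda>n. \<forall>x\<in>UNIV. dist (\<psi> n x) (\<phi> x) < d) sequentially"
    using lim d(1) by (rule uniform_limitD)
  then show "eventually (\<lambda>n. dist (pairing F (\<psi> n)) (pairing F \<phi>) < e) sequentially"
  proof (rule eventually_mono)
    fix n assume n: "\<forall>x\<in>UNIV. dist (\<psi> n x) (\<phi> x) < d"
    have m: "bounded (range (\<lambda>x. - 1 * \<phi> x))"
      by (intro bounded_comp_intros \<psi>)
    have "pairing F (\<lambda>x. \<psi> n x + - 1 * \<phi> x) = pairing F (\<psi> n) - pairing F \<phi>"
      using pairing_add[OF Fb \<psi>(1)[of n] m] pairing_scale[OF Fb \<psi>(2), of "- 1"] by simp
    moreover have "\<bar>pairing F (\<lambda>x. \<psi> n x + - 1 * \<phi> x)\<bar> \<le> d * B"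
      using n d(1) F by (intro pairing_bound) (auto simp: dist_norm less_imp_le)
    ultimately show "dist (pairing F (\<psi> n)) (pairing F \<phi>) < e"
      using d(2) by (simp add: dist_norm)
  qed
qed

text \<open>The functions \<open>u n\<close> are equicontinuous, with a modulus inherited from
  \<open>F\<close>, and by \<open>near_eigenfunction\<close> they differ from \<kappa> \<psi> n by
  at most \<kappa> - pairing F (\<psi> n), which tends to 0. A uniformly convergent subsequence of
  \<open>u\<close> carries \<psi> along.\<close>

lemma maximizing_sequence:
  assumes F: "uniformly_continuous_group F" "\<And>x. norm (F x) \<le> B"
    and \<kappa>: "\<And>\<psi>. \<psi> \<in> normalized_pos_def \<Longrightarrow> pairing F \<psi> \<le> \<kappa>" "0 < \<kappa>"
    and \<psi>: "\<And>n. \<psi> n \<in> normalized_pos_def" "(\<lambda>n. pairing F (\<psi> n)) \<longlonglongrightarrow> \<kappa>"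
  obtains r \<phi> where "strict_mono r" "\<phi> \<in> normalized_pos_def" "pairing F \<phi> = \<kappa>"
    "uniform_limit UNIV (\<lambda>n. \<psi> (r n)) \<phi> sequentially"
proof -
  have Fb: "bounded (range F)" unfolding bounded_iff using F(2) by blast
  define u where "u n g = (correlation F (\<psi> n) g + cnj (correlation F (\<psi> n) (- g))) / 2" for n g
  have "norm (u n g) \<le> B" for n g
  proof -
    have "norm (correlation F (\<psi> n) g + cnj (correlation F (\<psi> n) (- g))) \<le> B + B"
      using norm_correlation_le[OF F(2) normalized_norm_le[OF \<psi>(1)]]
      by (intro norm_triangle_le add_mono) auto
    then show ?thesis by (simp add: u_def norm_divide)
  qed
  moreover have "\<exists>W. open W \<and> 0 \<in> W \<and> (\<forall>n. \<forall>w\<in>W. \<forall>g. norm (u n (g + w) - u n g) < e)"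
    if e: "0 < e" for e
  proof -
    from e have "0 < e / 2" by simp
    then obtain V where V: "open V" "0 \<in> V" "\<And>w x. w \<in> V \<Longrightarrow> norm (F (x + w) - F x) < e / 2"
      using F(1) unfolding uniformly_continuous_group_def by meson
    let ?W = "V \<inter> {x. - x \<in> V}"
    have "norm (u n (g + w) - u n g) < e" if w: "w \<in> ?W" for n w g
    proof -
      have 1: "norm (correlation F (\<psi> n) (g + w) - correlation F (\<psi> n) g) \<le> e / 2"
        using V(3)[of "- w"] w less_imp_le
        by (intro norm_correlation_diff_le[OF Fb normalized_norm_le[OF \<psi>(1)]]) auto
      have "norm (correlation F (\<psi> n) (- g + - w) - correlation F (\<psi> n) (- g)) \<le> e / 2"
        using V(3)[of w] w less_imp_le
        by (intro norm_correlation_diff_le[OF Fb normalized_norm_le[OF \<psi>(1)]]) auto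
      then have 2: "norm (cnj (correlation F (\<psi> n) (- (g + w)) - correlation F (\<psi> n) (- g))) \<le> e / 2"
        by (simp only: complex_mod_cnj) (simp add: algebra_simps)
      have "u n (g + w) - u n g = ((correlation F (\<psi> n) (g + w) - correlation F (\<psi> n) g)
          + cnj (correlation F (\<psi> n) (- (g + w)) - correlation F (\<psi> n) (- g))) / 2"
        by (simp add: u_def field_simps)
      also have "norm \<dots> \<le> e / 2"
        using norm_triangle_le[OF add_mono[OF 1 2]] by (simp add: norm_divide)
      finally show ?thesis using e by simp
    qed
    moreover have "open ?W" using V(1) open_uminus_group[OF V(1)] by blast
    ultimately show ?thesis using V(2) by (intro exI[of _ ?W]) auto
  qed
  ultimately obtain r l where r: "strict_mono r" and l: "uniform_limit UNIV (\<lambda>n. u (r n)) l sequentially"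
    by (rule Arzela_Ascoli_group)
  \<comment> \<open>Division by \<kappa> is where its positivity is needed; it also explains the
    tolerance \<kappa> e / 2 below.\<close>
  define \<phi> where "\<phi> x = l x / complex_of_real \<kappa>" for x
  have lim: "uniform_limit UNIV (\<lambda>n. \<psi> (r n)) \<phi> sequentially"
  proof (rule uniform_limitI)
    fix e :: real assume "0 < e"
    with \<kappa>(2) have e: "0 < \<kappa> * e / 2" by simp
    have "(\<lambda>n. \<kappa> - pairing F (\<psi> (r n))) \<longlonglongrightarrow> \<kappa> - \<kappa>"
      using LIMSEQ_subseq_LIMSEQ[OF \<psi>(2) r] by (intro tendsto_intros) (simp add: o_def)
    then have "eventually (\<lambda>n. \<kappa> - pairing F (\<psi> (r n)) < \<kappa> * e / 2) sequentially"
      using e by (intro order_tendstoD) auto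
    moreover have "eventually (\<lambda>n. \<forall>x\<in>UNIV. dist (u (r n) x) (l x) < \<kappa> * e / 2) sequentially"
      using l e by (rule uniform_limitD)
    ultimately show "eventually (\<lambda>n. \<forall>x\<in>UNIV. dist (\<psi> (r n) x) (\<phi> x) < e) sequentially"
    proof eventually_elim
      case (elim n)
      show ?case
      proof
        fix x
        have "norm (complex_of_real \<kappa> * \<psi> (r n) x - u (r n) x) \<le> \<kappa> - pairing F (\<psi> (r n))"
          unfolding u_def using near_eigenfunction[OF Fb \<kappa>(1) \<psi>(1)] .
        moreover have "norm (u (r n) x - l x) < \<kappa> * e / 2"
          using elim(2) by (simp add: dist_norm)
        ultimately have "norm (complex_of_real \<kappa> * \<psi> (r n) x - l x) < \<kappa> * e"
          using elim(1) norm_diff_triangle_le[of "complex_of_real \<kappa> * \<psi> (r n) x" "u (r n) x" _ "l x"]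
          by (smt (verit) field_sum_of_halves)
        moreover have "\<psi> (r n) x - \<phi> x = (complex_of_real \<kappa> * \<psi> (r n) x - l x) / complex_of_real \<kappa>"
          using \<kappa>(2) by (simp add: \<phi>_def field_simps)
        then have "norm (\<psi> (r n) x - \<phi> x) = norm (complex_of_real \<kappa> * \<psi> (r n) x - l x) / \<kappa>"
          using \<kappa>(2) by (simp only: norm_divide) simp
        ultimately show "dist (\<psi> (r n) x) (\<phi> x) < e"
          using \<kappa>(2) by (simp only: dist_norm pos_divide_less_eq mult.commute)
      qed
    qed
  qed
  have pt: "(\<lambda>n. \<psi> (r n) x) \<longlonglongrightarrow> \<phi> x" for x
    using lim by (rule tendsto_uniform_limitI) simp
  have \<phi>: "\<phi> \<in> normalized_pos_def"
  proof -
    have "continuous_on UNIV \<phi>"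
      using lim \<psi>(1) by (intro uniform_limit_theorem[OF _ lim]) (auto simp: normalized_pos_def_def)
    moreover have "pos_def \<phi>"
      using \<psi>(1) by (intro pos_def_limit[OF _ pt]) (auto simp: normalized_pos_def_def)
    moreover have "(\<lambda>n. 1) \<longlonglongrightarrow> \<phi> 0"
      using pt[of 0] \<psi>(1) by (simp add: normalized_pos_def_def)
    then have "\<phi> 0 = 1" by (simp add: LIMSEQ_const_iff)
    ultimately show ?thesis by (simp add: normalized_pos_def_def)
  qed
  have "(\<lambda>n. pairing F (\<psi> (r n))) \<longlonglongrightarrow> pairing F \<phi>"
    using pairing_uniform_limit[OF F(2) normalized_bounded[OF \<psi>(1)] normalized_bounded[OF \<phi>] lim] .
  moreover have "(\<lambda>n. pairing F (\<psi> (r n))) \<longlonglongrightarrow> \<kappa>"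
    using LIMSEQ_subseq_LIMSEQ[OF \<psi>(2) r] by (simp add: o_def)
  ultimately have "pairing F \<phi> = \<kappa>" by (rule LIMSEQ_unique)
  with r \<phi> lim show ?thesis using that by blast
qed

lemma pairing_lincomb:
  assumes "bounded (range \<alpha>)" "bounded (range \<beta>)"
  shows "pairing (\<lambda>x. complex_of_real s * \<alpha> x + complex_of_real t * \<beta> x)
      (\<lambda>x. complex_of_real s * \<alpha> x + complex_of_real t * \<beta> x)
    = s\<^sup>2 * pairing \<alpha> \<alpha> + t\<^sup>2 * pairing \<beta> \<beta> + 2 * s * t * pairing \<alpha> \<beta>"
proof -
  note bi = bounded_comp_intros assms
  have bs: "bounded (range (\<lambda>x. complex_of_real s * \<alpha> x))" "bounded (range (\<lambda>x. complex_of_real t * \<beta> x))"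
    by (intro bi)+
  have b: "bounded (range (\<lambda>x. complex_of_real s * \<alpha> x + complex_of_real t * \<beta> x))"
    by (intro bi)
  have r: "pairing F (\<lambda>x. complex_of_real s * \<alpha> x + complex_of_real t * \<beta> x)
      = s * pairing F \<alpha> + t * pairing F \<beta>" if "bounded (range F)" for F
    by (simp only: pairing_add[OF that bs] pairing_scale[OF that assms(1)] pairing_scale[OF that assms(2)])
  have l: "pairing (\<lambda>x. complex_of_real s * \<alpha> x + complex_of_real t * \<beta> x) F
      = s * pairing \<alpha> F + t * pairing \<beta> F" if "bounded (range F)" for F
    using r[OF that] pairing_commute[OF b that] pairing_commute[OF assms(1) that]
      pairing_commute[OF assms(2) that] by simp
  show ?thesis
    unfolding r[OF b] l[OF assms(1)] l[OF assms(2)] pairing_commute[OF assms(1,2)]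
    by (simp add: power2_eq_square algebra_simps)
qed

text \<open>The mean square is quadratic, so continuity of the pairing in one argument does not
  suffice; the mean square of the difference is expanded.\<close>

lemma pairing_self_limit:
  assumes h: "\<And>n. h n \<in> normalized_pos_def" and \<psi>: "\<psi> \<in> normalized_pos_def"
    and lim: "uniform_limit UNIV h \<psi> sequentially"
  shows "(\<lambda>n. pairing (h n) (h n)) \<longlonglongrightarrow> pairing \<psi> \<psi>"
proof -
  \<comment> \<open>The coefficients 1 and - 1 are written out to match
    \<open>pairing_lincomb\<close>.\<close>
  define D where "D n y = complex_of_real 1 * \<psi> y + complex_of_real (- 1) * h n y" for n y
  have D: "pairing (D n) (D n) = pairing \<psi> \<psi> + pairing (h n) (h n) - 2 * pairing \<psi> (h n)" for n
    using pairing_lincomb[OF normalized_bounded[OF \<psi>] normalized_bounded[OF h[of n]], of 1 "- 1"]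
    by (simp add: D_def[abs_def] pairing_commute[OF normalized_bounded[OF \<psi>] normalized_bounded[OF h[of n]]])
  have "(\<lambda>n. pairing (D n) (D n)) \<longlonglongrightarrow> 0"
  proof (rule tendstoI)
    fix e :: real assume e: "0 < e"
    then have "eventually (\<lambda>n. \<forall>x\<in>UNIV. dist (h n x) (\<psi> x) < e / 4) sequentially"
      using lim by (intro uniform_limitD) auto
    then show "eventually (\<lambda>n. dist (pairing (D n) (D n)) 0 < e) sequentially"
    proof (rule eventually_mono)
      fix n assume n: "\<forall>x\<in>UNIV. dist (h n x) (\<psi> x) < e / 4"
      have "norm (D n x) \<le> e / 4" for x
        using n by (simp add: D_def dist_norm norm_minus_commute less_imp_le)
      moreover have "norm (D n x) \<le> 2" for x
        using norm_triangle_le_diff[OF add_mono[OF normalized_norm_le[OF \<psi>] normalized_norm_le[OF h]], of x n x]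
        by (simp add: D_def)
      ultimately have "\<bar>pairing (D n) (D n)\<bar> \<le> e / 4 * 2"
        using e by (intro pairing_bound) auto
      then show "dist (pairing (D n) (D n)) 0 < e" using e by simp
    qed
  qed
  moreover have "(\<lambda>n. pairing \<psi> (h n)) \<longlonglongrightarrow> pairing \<psi> \<psi>"
    by (rule pairing_uniform_limit[OF normalized_norm_le[OF \<psi>] normalized_bounded[OF h]
          normalized_bounded[OF \<psi>] lim])
  ultimately have "(\<lambda>n. pairing (D n) (D n) - pairing \<psi> \<psi> + 2 * pairing \<psi> (h n))
      \<longlonglongrightarrow> 0 - pairing \<psi> \<psi> + 2 * pairing \<psi> \<psi>"
    by (intro tendsto_intros)
  then show ?thesis by (simp add: D)
qed

text \<open>If f x \<noteq> 0, a translate of |f|^2 is bounded below on a neighbourhood of 0, and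
  finitely many translates of that neighbourhood cover the group.\<close>

lemma pairing_definite:
  assumes f: "continuous_on UNIV f" "bounded (range f)" and "pairing f f \<le> 0"
  shows "f x = 0"
proof (rule ccontr)
  assume "f x \<noteq> 0"
  define \<delta> where "\<delta> = norm (f x) / 2"
  have \<delta>: "0 < \<delta>" "\<delta> < norm (f x)" using \<open>f x \<noteq> 0\<close> by (auto simp: \<delta>_def)
  define U where "U = {y. \<delta> < norm (f y)}"
  have "open U"
    unfolding U_def by (intro open_Collect_less continuous_intros f(1))
  then have "open {y. y + x \<in> U}" by (rule open_translation_group)
  moreover have "0 \<in> {y. y + x \<in> U}" using \<delta> by (simp add: U_def)
  ultimately obtain A where A: "finite A" "\<And>y. \<exists>a\<in>A. y - a \<in> {y. y + x \<in> U}"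
    using totally_bounded by blast
  have b: "bounded (range (\<lambda>y. f y * cnj (f y)))" by (intro bounded_comp_intros f(2))
  have bx: "bounded (range (\<lambda>y. f (x + y) * cnj (f (x + y))))"
    by (intro bounded_comp_intros bounded_range_translate f(2))
  have "\<delta>\<^sup>2 / card A \<le> Re (M (\<lambda>y. f (x + y) * cnj (f (x + y))))"
  proof (rule mean_lower_bound[OF A(1) _ A(2) bx])
    fix y assume "y \<in> {y. y + x \<in> U}"
    then have "\<delta> < norm (f (x + y))" by (simp add: U_def add.commute)
    then have "\<delta>\<^sup>2 \<le> (norm (f (x + y)))\<^sup>2" using \<delta> by (intro power_mono) auto
    then show "\<delta>\<^sup>2 \<le> Re (f (x + y) * cnj (f (x + y)))"
      by (simp add: complex_norm_square[symmetric] del: complex_cnj_mult)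
  qed auto
  also have "\<dots> = pairing f f"
    unfolding pairing_def using mean_translate[OF b, of x] by simp
  finally have "\<delta>\<^sup>2 / card A \<le> 0" using assms(3) by simp
  moreover have "A \<noteq> {}" using A(2) by blast
  then have "0 < card A" using A(1) by (simp add: card_gt_0_iff)
  ultimately show False using \<delta>(1) by (simp add: field_simps)
qed

text \<open>Among the maximizers of the pairing with \<open>F\<close>, one of largest mean square is an extreme point
  by strict convexity. Comparing it with its two symmetric translates shows that it is
  multiplicative.\<close>

lemma extremal_multiplicative:
  assumes F: "bounded (range F)"
    and \<kappa>: "\<And>\<phi>. \<phi> \<in> normalized_pos_def \<Longrightarrow> pairing F \<phi> \<le> \<kappa>"
    and \<psi>: "\<psi> \<in> normalized_pos_def" "pairing F \<psi> = \<kappa>"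
    and max: "\<And>\<phi>. \<phi> \<in> normalized_pos_def \<Longrightarrow> pairing F \<phi> = \<kappa> \<Longrightarrow> pairing \<phi> \<phi> \<le> pairing \<psi> \<psi>"
  shows "\<psi> (x + g) = \<psi> g * \<psi> x"
proof -
  have pd: "continuous_on UNIV \<psi>" "pos_def \<psi>" "\<psi> 0 = 1"
    using \<psi>(1) by (auto simp: normalized_pos_def_def)
  have key: "symm_translate c g \<psi> x = (2 + 2 * complex_of_real (Re (c * \<psi> g))) * \<psi> x"
    if c: "norm c = 1" for c
  proof -
    define \<theta> \<theta>' where "\<theta> = symm_translate c g \<psi>" and "\<theta>' = symm_translate (- c) g \<psi>"
    define s s' where "s = Re (\<theta> 0)" and "s' = Re (\<theta>' 0)"
    have c': "norm (- c) = 1" using c by simp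
    have \<theta>: "continuous_on UNIV \<theta>" "pos_def \<theta>" and \<theta>': "continuous_on UNIV \<theta>'" "pos_def \<theta>'"
      unfolding \<theta>_def \<theta>'_def
      by (intro continuous_symm_translate pos_def_symm_translate pd c c')+
    have s_eq: "s = 2 + 2 * Re (c * \<psi> g)" and s'_eq: "s' = 2 - 2 * Re (c * \<psi> g)"
      using pd by (simp_all add: s_def s'_def \<theta>_def \<theta>'_def symm_translate_def pos_def_uminus)
    \<comment> \<open>Opposite phases cancel the translates. After normalization this exhibits
      \<psi> as a convex combination with weights s / 4 and s' / 4.\<close>
    have sum: "\<theta> y + \<theta>' y = 4 * \<psi> y" for y
      by (simp add: \<theta>_def \<theta>'_def symm_translate_def)
    have s0: "\<theta> 0 = complex_of_real s" "\<theta>' 0 = complex_of_real s'" "0 \<le> s" "0 \<le> s'"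
      using pos_def_zero[OF \<theta>(2)] pos_def_zero[OF \<theta>'(2)]
      by (auto simp: s_def s'_def complex_eq_iff)
    have "pairing F (\<lambda>y. \<theta> y + \<theta>' y) = 4 * \<kappa>"
      using pairing_scale[OF F normalized_bounded[OF \<psi>(1)], of 4] \<psi>(2) by (simp add: sum)
    then have sumF: "pairing F \<theta> + pairing F \<theta>' = 4 * \<kappa>"
      using pairing_add[OF F pos_def_bounded[OF \<theta>(2)] pos_def_bounded[OF \<theta>'(2)]] by simp
    have le: "pairing F \<theta> \<le> \<kappa> * s" "pairing F \<theta>' \<le> \<kappa> * s'"
      unfolding s_def s'_def
      by (rule pairing_le_of_normalized[OF F \<kappa> \<theta>], assumption)
        (rule pairing_le_of_normalized[OF F \<kappa> \<theta>'], assumption)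
    have ss: "s + s' = 4" by (simp add: s_eq s'_eq)
    have "\<kappa> * s + \<kappa> * s' = 4 * \<kappa>" using ss by (metis distrib_left mult.commute)
    \<comment> \<open>Both upper bounds are attained because their sum is; the normalized pieces are
      therefore maximizers as well.\<close>
    with le sumF have eqF: "pairing F \<theta> = \<kappa> * s" "pairing F \<theta>' = \<kappa> * s'" by linarith+
    have "\<theta> x = complex_of_real s * \<psi> x"
    \<comment> \<open>A positive definite function with value 0 at 0 vanishes, and then the other
      summand is all of 4 \<psi>.\<close>
    proof (cases "s = 0 \<or> s' = 0")
      case True
      then show ?thesis
        using pos_def_norm_le[OF \<theta>(2), of x] pos_def_norm_le[OF \<theta>'(2), of x] sum[of x] ss
        unfolding s_def[symmetric] s'_def[symmetric] by auto
    next
      case False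
      then have pos: "0 < s" "0 < s'" using s0 by auto
      define \<alpha> \<alpha>' where "\<alpha> y = complex_of_real (1 / s) * \<theta> y" and "\<alpha>' y = complex_of_real (1 / s') * \<theta>' y" for y
      have \<alpha>: "\<alpha> \<in> normalized_pos_def" "\<alpha>' \<in> normalized_pos_def"
        unfolding normalized_pos_def_def \<alpha>_def \<alpha>'_def
        using pos s0 \<theta> \<theta>' pos_def_scale[OF \<theta>(2), of "1 / s"] pos_def_scale[OF \<theta>'(2), of "1 / s'"]
        by (auto intro!: continuous_intros)
      have "pairing F \<alpha> = \<kappa>" "pairing F \<alpha>' = \<kappa>"
        unfolding \<alpha>_def \<alpha>'_def pairing_scale[OF F pos_def_bounded[OF \<theta>(2)]]
          pairing_scale[OF F pos_def_bounded[OF \<theta>'(2)]] eqF using pos by simp_all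
      then have m: "pairing \<alpha> \<alpha> \<le> pairing \<psi> \<psi>" "pairing \<alpha>' \<alpha>' \<le> pairing \<psi> \<psi>"
        using max \<alpha> by auto
      define t where "t = s / 4"
      have t: "0 < t" "t < 1" "1 - t = s' / 4" using pos ss by (auto simp: t_def)
      have \<psi>_eq: "\<psi> = (\<lambda>y. complex_of_real t * \<alpha> y + complex_of_real (1 - t) * \<alpha>' y)"
      proof
        fix y show "\<psi> y = complex_of_real t * \<alpha> y + complex_of_real (1 - t) * \<alpha>' y"
          unfolding t(3) using pos sum[of y] by (simp add: t_def \<alpha>_def \<alpha>'_def field_simps)
      qed
      note b = normalized_bounded[OF \<alpha>(1)] normalized_bounded[OF \<alpha>(2)]
      have e1: "pairing \<psi> \<psi> = t\<^sup>2 * pairing \<alpha> \<alpha> + (1 - t)\<^sup>2 * pairing \<alpha>' \<alpha>' + 2 * t * (1 - t) * pairing \<alpha> \<alpha>'"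
        using pairing_lincomb[OF b, of t "1 - t"] \<psi>_eq by simp
      define D where "D y = complex_of_real 1 * \<alpha> y + complex_of_real (- 1) * \<alpha>' y" for y
      have e2: "pairing D D = pairing \<alpha> \<alpha> + pairing \<alpha>' \<alpha>' - 2 * pairing \<alpha> \<alpha>'"
        using pairing_lincomb[OF b, of 1 "- 1"] by (simp add: D_def[abs_def])
      \<comment> \<open>The identity of strict convexity: the defect is t (1 - t) times the mean
        square of the difference, and maximality of \<psi> forces it to vanish.\<close>
      have "pairing \<psi> \<psi> = t * pairing \<alpha> \<alpha> + (1 - t) * pairing \<alpha>' \<alpha>' - t * (1 - t) * pairing D D"
        unfolding e1 e2 by (simp add: power2_eq_square algebra_simps)
      also have "t * pairing \<alpha> \<alpha> + (1 - t) * pairing \<alpha>' \<alpha>' \<le> t * pairing \<psi> \<psi> + (1 - t) * pairing \<psi> \<psi>"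
        using m t by (intro add_mono mult_left_mono) auto
      finally have "t * (1 - t) * pairing D D \<le> 0" by (simp add: algebra_simps)
      moreover have "0 < t * (1 - t)" using t by simp
      ultimately have "pairing D D \<le> 0" using mult_pos_pos not_le by blast
      moreover have "continuous_on UNIV D"
        unfolding D_def using \<alpha> by (auto simp: normalized_pos_def_def intro!: continuous_intros)
      moreover have "bounded (range D)"
        unfolding D_def by (intro bounded_comp_intros b)
      ultimately have "D x = 0" by (intro pairing_definite)
      then have "\<alpha> x = \<alpha>' x" by (simp add: D_def)
      then have "\<psi> x = \<alpha> x" using fun_cong[OF \<psi>_eq, of x] by (simp add: algebra_simps)
      then show ?thesis using pos by (simp add: \<alpha>_def)
    qed
    then show ?thesis by (simp add: \<theta>_def s_eq)
  qed
  \<comment> \<open>The phases 1 and \<i> give the sum and the difference of the two translates,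
    hence each translate separately.\<close>
  have "\<psi> (x + g) + \<psi> (x - g) = 2 * complex_of_real (Re (\<psi> g)) * \<psi> x"
    using key[of 1] by (simp add: symm_translate_def algebra_simps)
  moreover have "\<i> * (\<psi> (x + g) - \<psi> (x - g)) = \<i> * (2 * \<i> * complex_of_real (Im (\<psi> g)) * \<psi> x)"
    using key[of \<i>] by (simp add: symm_translate_def algebra_simps)
  then have "\<psi> (x + g) - \<psi> (x - g) = 2 * \<i> * complex_of_real (Im (\<psi> g)) * \<psi> x"
    by simp
  ultimately have "2 * \<psi> (x + g) = 2 * ((complex_of_real (Re (\<psi> g)) + \<i> * complex_of_real (Im (\<psi> g))) * \<psi> x)"
    by (simp add: algebra_simps)
  then show ?thesis by (simp flip: complex_eq)
qed

lemma one_normalized: "(\<lambda>_. 1) \<in> normalized_pos_def"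
  using pos_def_autocorrelation[OF bounded_const_comp, of 1]
  by (simp add: normalized_pos_def_def autocorrelation_def[abs_def] mean_one)

text \<open>Two successive maximizations produce the extreme point: first of the pairing with
  \<open>F\<close>, then of the mean square among its maximizers. \<open>maximizing_sequence\<close>
  serves both, since any sequence of maximizers is maximizing.\<close>

theorem ex_unitary_character_pairing:
  assumes F: "uniformly_continuous_group F" "bounded (range F)"
    and \<phi>: "continuous_on UNIV \<phi>" "pos_def \<phi>" and pos: "0 < pairing F \<phi>"
  obtains \<xi> where "unitary_character \<xi>" "pairing F \<phi> \<le> pairing F \<xi> * Re (\<phi> 0)"
proof -
  obtain B where B: "\<And>x. norm (F x) \<le> B" using F(2) unfolding bounded_iff by blast
  define P where "P = pairing F ` normalized_pos_def"
  define \<kappa> where "\<kappa> = Sup P"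
  have "bdd_above P"
  proof (rule bdd_aboveI)
    fix p assume "p \<in> P"
    then obtain \<psi> where \<psi>: "p = pairing F \<psi>" "\<psi> \<in> normalized_pos_def" unfolding P_def by blast
    have "\<bar>pairing F \<psi>\<bar> \<le> 1 * B" by (rule pairing_bound[OF normalized_norm_le[OF \<psi>(2)] B]) simp
    with \<psi>(1) show "p \<le> B" by simp
  qed
  have ne: "P \<noteq> {}" using one_normalized unfolding P_def by blast
  have le: "pairing F \<psi> \<le> \<kappa>" if "\<psi> \<in> normalized_pos_def" for \<psi>
    using that \<open>bdd_above P\<close> unfolding \<kappa>_def P_def by (auto intro: cSUP_upper)
  have \<phi>le: "pairing F \<phi> \<le> \<kappa> * Re (\<phi> 0)"
    by (intro pairing_le_of_normalized F le \<phi>)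
  have \<kappa>: "0 < \<kappa>"
    using pos \<phi>le pos_def_zero(1)[OF \<phi>(2)] by (smt (verit) mult_nonpos_nonneg)
  obtain p where p: "\<And>n. p n \<in> P" "p \<longlonglongrightarrow> \<kappa>"
    using ex_seq_tendsto_Sup[OF ne \<open>bdd_above P\<close>] unfolding \<kappa>_def by blast
  then have "\<forall>n. \<exists>\<psi>. \<psi> \<in> normalized_pos_def \<and> p n = pairing F \<psi>" unfolding P_def by blast
  then obtain f where f: "\<And>n. f n \<in> normalized_pos_def" "\<And>n. p n = pairing F (f n)" by metis
  then have "(\<lambda>n. pairing F (f n)) \<longlonglongrightarrow> \<kappa>" using p(2) by (simp flip: f(2))
  from maximizing_sequence[OF F(1) B le \<kappa> f(1) this] obtain \<psi>\<^sub>0 where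
    \<psi>\<^sub>0: "\<psi>\<^sub>0 \<in> normalized_pos_def" "pairing F \<psi>\<^sub>0 = \<kappa>" by blast
  define Q where "Q = (\<lambda>\<psi>. pairing \<psi> \<psi>) ` {\<psi> \<in> normalized_pos_def. pairing F \<psi> = \<kappa>}"
  have "bdd_above Q"
  proof (rule bdd_aboveI)
    fix q assume "q \<in> Q"
    then obtain \<psi> where \<psi>: "q = pairing \<psi> \<psi>" "\<psi> \<in> normalized_pos_def" unfolding Q_def by blast
    have "\<bar>pairing \<psi> \<psi>\<bar> \<le> 1 * 1"
      by (rule pairing_bound[OF normalized_norm_le[OF \<psi>(2)] normalized_norm_le[OF \<psi>(2)]]) simp
    with \<psi>(1) show "q \<le> 1" by simp
  qed
  have "Q \<noteq> {}" using \<psi>\<^sub>0 unfolding Q_def by blast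
  then obtain q where q: "\<And>n. q n \<in> Q" "q \<longlonglongrightarrow> Sup Q"
    using ex_seq_tendsto_Sup[OF _ \<open>bdd_above Q\<close>] by blast
  then have "\<forall>n. \<exists>\<psi>. \<psi> \<in> normalized_pos_def \<and> pairing F \<psi> = \<kappa> \<and> q n = pairing \<psi> \<psi>"
    unfolding Q_def by blast
  then obtain h where h: "\<And>n. h n \<in> normalized_pos_def" "\<And>n. pairing F (h n) = \<kappa>"
    "\<And>n. q n = pairing (h n) (h n)" by metis
  have "(\<lambda>n. pairing F (h n)) \<longlonglongrightarrow> \<kappa>" using h(2) by simp
  from maximizing_sequence[OF F(1) B le \<kappa> h(1) this] obtain r \<psi> where
    r: "strict_mono r" and \<psi>: "\<psi> \<in> normalized_pos_def" "pairing F \<psi> = \<kappa>"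
    and lim: "uniform_limit UNIV (\<lambda>n. h (r n)) \<psi> sequentially" by blast
  have "(\<lambda>n. q (r n)) \<longlonglongrightarrow> Sup Q"
    using LIMSEQ_subseq_LIMSEQ[OF q(2) r] by (simp add: o_def)
  then have "Sup Q = pairing \<psi> \<psi>"
    using pairing_self_limit[OF h(1) \<psi>(1) lim] unfolding h(3) by (rule LIMSEQ_unique)
  then have max: "pairing \<theta> \<theta> \<le> pairing \<psi> \<psi>" if "\<theta> \<in> normalized_pos_def" "pairing F \<theta> = \<kappa>" for \<theta>
    using that cSup_upper[OF _ \<open>bdd_above Q\<close>] unfolding Q_def by auto
  have mult: "\<psi> (x + y) = \<psi> x * \<psi> y" for x y
    by (subst mult.commute) (rule extremal_multiplicative[OF F(2) le \<psi> max])
  have \<psi>0: "\<psi> 0 = 1" using \<psi>(1) by (simp add: normalized_pos_def_def)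
  \<comment> \<open>The values at \<open>x\<close> and \<open>- x\<close> have product 1 and norms
    at most 1.\<close>
  have "norm (\<psi> x) = 1" for x
  proof -
    have "norm (\<psi> x) * norm (\<psi> (- x)) = 1"
      using mult[of x "- x"] \<psi>0 by (simp flip: norm_mult)
    then show ?thesis
      using normalized_norm_le[OF \<psi>(1), of x]
        mult_left_le[OF normalized_norm_le[OF \<psi>(1), of "- x"] norm_ge_zero[of "\<psi> x"]] by simp
  qed
  then have "unitary_character \<psi>"
    using \<psi>(1) mult by (simp add: unitary_character_def normalized_pos_def_def)
  then show ?thesis using \<phi>le \<psi>(2) by (intro that) auto
qed

end

section \<open>Bohr neighbourhoods in totally bounded groups\<close>

text \<open>The set \<open>dyadic_nbhd V N j\<close> is the dilation by the dyadic rational \<open>j / 2 ^ N\<close> in the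
  Birkhoff--Kakutani construction: the sum of the \<open>V n\<close> over the binary digits of \<open>j / 2 ^ N\<close>,
  truncated to the whole group from 2 on.\<close>

primrec dyadic_nbhd :: "(nat \<Rightarrow> 'a::ab_group_add set) \<Rightarrow> nat \<Rightarrow> nat \<Rightarrow> 'a set"
  where
    "dyadic_nbhd V 0 = (\<lambda>j. if j = 0 then {0} else if j = 1 then V 0 else UNIV)"
  | "dyadic_nbhd V (Suc N) = (\<lambda>j. if even j then dyadic_nbhd V N (j div 2)
      else {x + w | x w. x \<in> dyadic_nbhd V N (j div 2) \<and> w \<in> V (Suc N)})"

text \<open>This is binary addition with carry: if the last digit is already 1, two elements of V
  (Suc N) combine to one of V N, which is passed to the higher digits.\<close>

lemma dyadic_nbhd_add:
  assumes "\<And>n x y. x \<in> V (Suc n) \<Longrightarrow> y \<in> V (Suc n) \<Longrightarrow> x + y \<in> V n"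
    and "x \<in> dyadic_nbhd V N j" "w \<in> V N"
  shows "x + w \<in> dyadic_nbhd V N (Suc j)"
  using assms(2,3)
proof (induction N arbitrary: j x w)
  case 0
  then show ?case by (auto split: if_splits)
next
  case (Suc N)
  show ?case
  proof (cases "even j")
    case True
    then show ?thesis using Suc.prems by auto
  next
    case False
    then obtain y v where y: "x = y + v" "y \<in> dyadic_nbhd V N (j div 2)" "v \<in> V (Suc N)"
      using Suc.prems by auto
    then have "y + (v + w) \<in> dyadic_nbhd V N (Suc (j div 2))"
      using assms(1) Suc.prems(2) by (intro Suc.IH)
    moreover have "Suc j div 2 = Suc (j div 2)" using False by presburger
    ultimately show ?thesis using False by (simp add: y(1) add.assoc)
  qed
qed

lemma dyadic_nbhd_double: "dyadic_nbhd V (N + m) (2 ^ m * j) = dyadic_nbhd V N j"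
proof (induction m)
  case (Suc m)
  have "2 ^ Suc m * j div 2 = 2 ^ m * j" "even (2 ^ Suc m * j)" by simp_all
  then show ?case using Suc by (simp only: add_Suc_right dyadic_nbhd.simps if_True)
qed simp

lemma dyadic_nbhd_mono:
  assumes "\<And>n x y. x \<in> V (Suc n) \<Longrightarrow> y \<in> V (Suc n) \<Longrightarrow> x + y \<in> V n" "\<And>n. 0 \<in> V n"
    and "j \<le> k"
  shows "dyadic_nbhd V N j \<subseteq> dyadic_nbhd V N k"
  using assms(3)
proof (induction rule: dec_induct)
  case (step k)
  have "dyadic_nbhd V N k \<subseteq> dyadic_nbhd V N (Suc k)"
    using dyadic_nbhd_add[of V _ N k 0] assms(1,2) by force
  with step.IH show ?case by blast
qed simp

definition dyadic_gauge :: "(nat \<Rightarrow> 'a::ab_group_add set) \<Rightarrow> 'a \<Rightarrow> real"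
  where "dyadic_gauge V x = Inf {real j / 2 ^ N | j N. x \<in> dyadic_nbhd V N j}"

lemma dyadic_gauge_le: "x \<in> dyadic_nbhd V N j \<Longrightarrow> dyadic_gauge V x \<le> real j / 2 ^ N"
  unfolding dyadic_gauge_def by (rule cInf_lower) (auto intro!: bdd_belowI[of _ 0])

lemma dyadic_gauge_nonempty: "{real j / 2 ^ N | j N. x \<in> dyadic_nbhd V N j} \<noteq> {}"
proof -
  have "x \<in> dyadic_nbhd V 0 2" by simp
  then show ?thesis by blast
qed

text \<open>An admissible dyadic number is first rounded up to a multiple of 1 / 2 ^ N, and adding
  \<open>w\<close> costs one more step of that size.\<close>

lemma dyadic_gauge_add_le:
  assumes V: "\<And>n x y. x \<in> V (Suc n) \<Longrightarrow> y \<in> V (Suc n) \<Longrightarrow> x + y \<in> V n" "\<And>n. 0 \<in> V n"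
    and w: "w \<in> V N"
  shows "dyadic_gauge V (x + w) \<le> dyadic_gauge V x + 2 / 2 ^ N"
proof -
  have "dyadic_gauge V (x + w) - 2 / 2 ^ N \<le> r"
    if r: "r \<in> {real j / 2 ^ M | j M. x \<in> dyadic_nbhd V M j}" for r
  proof -
    obtain j M where j: "r = real j / 2 ^ M" "x \<in> dyadic_nbhd V M j" using r by blast
    define k where "k = 2 ^ N * j div 2 ^ M"
    have "2 ^ N * j = 2 ^ M * k + 2 ^ N * j mod 2 ^ M" "2 ^ N * j mod 2 ^ M < 2 ^ M"
      "2 ^ M * Suc k = 2 ^ M * k + 2 ^ M"
      by (simp_all add: k_def)
    then have "2 ^ N * j \<le> 2 ^ M * Suc k" by linarith
    then have "dyadic_nbhd V (M + N) (2 ^ N * j) \<subseteq> dyadic_nbhd V (N + M) (2 ^ M * Suc k)"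
      unfolding add.commute[of N M] by (intro dyadic_nbhd_mono V)
    then have "x \<in> dyadic_nbhd V N (Suc k)"
      using j(2) unfolding dyadic_nbhd_double by blast
    then have "x + w \<in> dyadic_nbhd V N (Suc (Suc k))"
      using w by (rule dyadic_nbhd_add[rotated]) (rule V(1))
    from dyadic_gauge_le[OF this] have "dyadic_gauge V (x + w) \<le> (real k + 2) / 2 ^ N"
      by (simp add: add.commute)
    moreover have "2 ^ M * k \<le> 2 ^ N * j" unfolding k_def by (rule times_div_less_eq_dividend)
    then have "real (2 ^ M * k) \<le> real (2 ^ N * j)" by (simp only: of_nat_le_iff)
    then have "real k / 2 ^ N \<le> r"
      by (simp add: j(1) field_simps)
    ultimately show ?thesis by (simp add: add_divide_distrib)
  qed
  then have "dyadic_gauge V (x + w) - 2 / 2 ^ N \<le> dyadic_gauge V x"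
    unfolding dyadic_gauge_def[of V x] by (intro cInf_greatest[OF dyadic_gauge_nonempty])
  then show ?thesis by simp
qed

text \<open>The bump is 1 minus the gauge, cut off at 0. Where it is nonzero the gauge is below 1,
  and the dyadic set at 1 is \<open>U\<close> itself.\<close>

lemma ex_uniformly_continuous_bump:
  fixes U :: "'a::topological_ab_group_add set"
  assumes "open U" "0 \<in> U"
  obtains f :: "'a \<Rightarrow> real" where "uniformly_continuous_group (\<lambda>x. complex_of_real (f x))"
    "f 0 = 1" "\<And>x. 0 \<le> f x" "\<And>x. f x \<le> 1" "\<And>x. f x \<noteq> 0 \<Longrightarrow> x \<in> U"
proof -
  define nxt :: "'a set \<Rightarrow> 'a set" where
    "nxt U = (SOME W. open W \<and> 0 \<in> W \<and> (\<forall>x\<in>W. \<forall>y\<in>W. x + y \<in> U) \<and> (\<forall>x\<in>W. - x \<in> W))" for U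
  have nxt: "open (nxt U) \<and> 0 \<in> nxt U \<and> (\<forall>x\<in>nxt U. \<forall>y\<in>nxt U. x + y \<in> U) \<and> (\<forall>x\<in>nxt U. - x \<in> nxt U)"
    if "open U" "0 \<in> U" for U
    unfolding nxt_def by (rule someI_ex) (rule open_add_nhds[OF that], blast)
  define V where "V n = (nxt ^^ n) U" for n
  have V0: "V 0 = U" and VSuc: "V (Suc n) = nxt (V n)" for n by (simp_all add: V_def)
  have V: "open (V n) \<and> 0 \<in> V n" for n
    by (induction n) (use assms nxt in \<open>auto simp: V0 VSuc\<close>)
  have Vadd: "x + y \<in> V n" if "x \<in> V (Suc n)" "y \<in> V (Suc n)" for n x y
    using nxt[of "V n"] V that by (auto simp: VSuc)
  have Vneg: "- x \<in> V (Suc n)" if "x \<in> V (Suc n)" for n x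
    using nxt[of "V n"] V that by (auto simp: VSuc)
  define f where "f x = max 0 (1 - dyadic_gauge V x)" for x
  have nonneg: "0 \<le> dyadic_gauge V x" for x
    unfolding dyadic_gauge_def by (rule cInf_greatest[OF dyadic_gauge_nonempty]) auto
  have "uniformly_continuous_group (\<lambda>x. complex_of_real (f x))"
    unfolding uniformly_continuous_group_def
  proof (intro allI impI)
    fix e :: real assume e: "0 < e"
    obtain n where n: "(1 / 2) ^ n < e"
      using real_arch_pow_inv[OF e, of "1 / 2"] by auto
    \<comment> \<open>The index shift absorbs the factor 2 in the gauge estimate, and symmetry is
      available for the sets of positive index only.\<close>
    let ?N = "Suc n"
    have "norm (complex_of_real (f (x + w)) - complex_of_real (f x)) < e" if w: "w \<in> V ?N" for x w
    proof -
      have "dyadic_gauge V (x + w) \<le> dyadic_gauge V x + 2 / 2 ^ ?N"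
        using V by (intro dyadic_gauge_add_le Vadd w) auto
      moreover have "dyadic_gauge V (x + w + - w) \<le> dyadic_gauge V (x + w) + 2 / 2 ^ ?N"
        using V by (intro dyadic_gauge_add_le Vadd Vneg w) auto
      moreover have "2 / 2 ^ ?N = (1 / 2 :: real) ^ n" by (simp add: power_divide)
      ultimately have "\<bar>f (x + w) - f x\<bar> < e"
        using n by (auto simp: f_def)
      then show ?thesis by (metis norm_of_real of_real_diff)
    qed
    then show "\<exists>W. open W \<and> 0 \<in> W \<and>
        (\<forall>w\<in>W. \<forall>x. norm (complex_of_real (f (x + w)) - complex_of_real (f x)) < e)"
      using V[of ?N] by (intro exI[of _ "V ?N"]) auto
  qed
  moreover have "dyadic_gauge V 0 \<le> real 0 / 2 ^ 0" by (rule dyadic_gauge_le) simp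
  then have "f 0 = 1" using nonneg[of 0] by (simp add: f_def)
  moreover have "x \<in> U" if "f x \<noteq> 0" for x
  proof -
    have "Inf {real j / 2 ^ N | j N. x \<in> dyadic_nbhd V N j} < 1"
      using that by (simp add: f_def dyadic_gauge_def max_def split: if_splits)
    then obtain j N where j: "x \<in> dyadic_nbhd V N j" "real j / 2 ^ N < 1"
      by (subst (asm) cInf_less_iff[OF dyadic_gauge_nonempty]) (auto intro!: bdd_belowI[of _ 0])
    then have "real j < real (2 ^ N)" by simp
    \<comment> \<open>The factor 1 is kept to match \<open>dyadic_nbhd_double\<close>, which
      rescales to level 0.\<close>
    then have "j \<le> 2 ^ N * 1" unfolding of_nat_less_iff by simp
    then have "x \<in> dyadic_nbhd V (0 + N) (2 ^ N * 1)"
      using dyadic_nbhd_mono[of V j "2 ^ N * 1" N] V Vadd j(1) by auto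
    then show ?thesis unfolding dyadic_nbhd_double by (simp add: V0)
  qed
  ultimately show ?thesis using nonneg by (intro that[of f]) (auto simp: f_def)
qed

lemma unitary_characterD:
  assumes "unitary_character \<xi>"
  shows "continuous_on UNIV \<xi>" "\<xi> (x + y) = \<xi> x * \<xi> y" "norm (\<xi> x) = 1"
    "\<xi> 0 = 1" "\<xi> (- x) = cnj (\<xi> x)"
proof -
  show 1: "continuous_on UNIV \<xi>" and 2: "\<xi> (x + y) = \<xi> x * \<xi> y" and 3: "norm (\<xi> x) = 1" for x y
    using assms by (auto simp: unitary_character_def)
  have "\<xi> 0 * \<xi> 0 = \<xi> 0" using 2[of 0 0] by simp
  moreover have "\<xi> 0 \<noteq> 0" using 3[of 0] by auto
  ultimately show 4: "\<xi> 0 = 1" by simp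
  have "\<xi> x * \<xi> (- x) = 1" using 2[of x "- x"] 4 by simp
  moreover have "\<xi> x * cnj (\<xi> x) = 1" using 3[of x] complex_norm_square[of "\<xi> x"] by simp
  moreover have "\<xi> x \<noteq> 0" using 3[of x] by auto
  ultimately show "\<xi> (- x) = cnj (\<xi> x)" by (metis mult_cancel_left)
qed

section \<open>Equicontinuous sets of characters and Bohr neighbourhoods\<close>

context totally_bounded_mean
begin

lemma unitary_character_bounded: "unitary_character \<xi> \<Longrightarrow> bounded (range \<xi>)" for \<xi> :: "'a \<Rightarrow> complex"
  unfolding bounded_iff using unitary_characterD(3) by (metis imageE order_refl)

text \<open>A nontrivial character has mean 0, so \<xi> - 1 has mean - 1, too large for a function
  bounded by c < 1.\<close>

lemma unitary_character_trivial:
  fixes \<xi> :: "'a \<Rightarrow> complex"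
  assumes "unitary_character \<xi>" "\<And>x. norm (\<xi> x - 1) \<le> c" "c < 1"
  shows "\<xi> x = 1"
proof (rule ccontr)
  assume "\<xi> x \<noteq> 1"
  then have "M \<xi> = 0"
    using unitary_characterD[OF assms(1)] by (intro mean_nontrivial_character[where h = x]) auto
  then have "M (\<lambda>x. \<xi> x - 1) = - 1"
    using unitary_character_bounded[OF assms(1)] by (simp add: mean_diff mean_const bounded_const_comp)
  moreover have "norm (M (\<lambda>x. \<xi> x - 1)) \<le> c" using assms(2) by (intro mean_norm_le)
  ultimately show False using assms(3) by simp
qed

text \<open>Distinct characters are uniformly far apart. Two that agree up to 1 / 8 on a finite net
  of the group differ by at most 3 / 8 everywhere, so their quotient is trivial.\<close>

lemma finite_equicontinuous_characters:
  fixes \<Phi> :: "('a \<Rightarrow> complex) set"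
  assumes \<Phi>: "\<And>\<xi>. \<xi> \<in> \<Phi> \<Longrightarrow> unitary_character \<xi>"
    and W: "open W" "0 \<in> W" "\<And>\<xi> w. \<xi> \<in> \<Phi> \<Longrightarrow> w \<in> W \<Longrightarrow> norm (\<xi> w - 1) \<le> 1 / 8"
  shows "finite \<Phi>"
proof -
  obtain F where F: "finite F" "\<And>x. \<exists>a\<in>F. x - a \<in> W"
    using totally_bounded[OF W(1,2)] by blast
  have "bounded ((\<lambda>\<xi>. \<xi> a) ` \<Phi>)" for a
    unfolding bounded_iff by (intro exI[of _ 1]) (auto simp: unitary_characterD(3)[OF \<Phi>])
  then obtain N where N: "finite N" "N \<subseteq> \<Phi>"
    "\<And>\<xi>. \<xi> \<in> \<Phi> \<Longrightarrow> \<exists>\<zeta>\<in>N. \<forall>a\<in>F. norm (\<xi> a - \<zeta> a) < 1 / 8"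
    using finite_net[of F "\<lambda>a \<xi>. \<xi> a" \<Phi> "1 / 8"] F(1) by auto
  have "\<xi> \<in> N" if \<xi>: "\<xi> \<in> \<Phi>" for \<xi>
  proof -
    obtain \<zeta> where \<zeta>: "\<zeta> \<in> N" "\<And>a. a \<in> F \<Longrightarrow> norm (\<xi> a - \<zeta> a) < 1 / 8"
      using N(3)[OF \<xi>] by blast
    note u = unitary_characterD[OF \<Phi>[OF \<xi>]]
    have "\<zeta> \<in> \<Phi>" using \<zeta>(1) N(2) by blast
    note v = unitary_characterD[OF \<Phi>[OF this]]
    define \<eta> where "\<eta> x = \<xi> x * cnj (\<zeta> x)" for x
    have uc: "unitary_character \<eta>"
      unfolding unitary_character_def \<eta>_def
      using u v by (auto intro!: continuous_intros simp: norm_mult)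
    have diff: "\<eta> x - 1 = (\<xi> x - \<zeta> x) * cnj (\<zeta> x)" for x
      using v(3)[of x] complex_norm_square[of "\<zeta> x"] by (simp add: \<eta>_def left_diff_distrib)
    have "norm (\<eta> x - 1) \<le> 3 / 8" for x
    proof -
      obtain a where a: "a \<in> F" "x - a \<in> W" using F(2) by blast
      have sx: "\<xi> x = \<xi> a * \<xi> (x - a)" "\<zeta> x = \<zeta> a * \<zeta> (x - a)"
        using u(2)[of a "x - a"] v(2)[of a "x - a"] by simp_all
      have "norm (\<eta> x - 1) = norm (\<xi> x - \<zeta> x)"
        unfolding diff using v(3) by (simp add: norm_mult)
      also have "\<xi> x - \<zeta> x = \<xi> a * (\<xi> (x - a) - 1) + (\<xi> a - \<zeta> a) - \<zeta> a * (\<zeta> (x - a) - 1)"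
        by (simp add: sx algebra_simps)
      also have "norm \<dots> \<le> norm (\<xi> a * (\<xi> (x - a) - 1)) + norm (\<xi> a - \<zeta> a) + norm (\<zeta> a * (\<zeta> (x - a) - 1))"
        by (rule norm_triangle_le_diff[OF add_mono[OF norm_triangle_ineq order_refl]])
      also have "\<dots> \<le> 1 / 8 + 1 / 8 + 1 / 8"
        using W(3)[OF \<xi> a(2)] W(3)[OF \<open>\<zeta> \<in> \<Phi>\<close> a(2)] \<zeta>(2)[OF a(1)] u(3) v(3)
        by (intro add_mono) (auto simp: norm_mult)
      finally show ?thesis by simp
    qed
    with uc have "\<eta> x = 1" for x by (rule unitary_character_trivial) simp
    then have "\<xi> x = \<zeta> x" for x
      using diff[of x] v(3)[of x] by auto
    then have "\<xi> = \<zeta>" by (simp add: fun_eq_iff)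
    then show ?thesis using \<zeta>(1) by simp
  qed
  then have "\<Phi> \<subseteq> N" ..
  then show ?thesis using N(1) by (rule finite_subset)
qed

lemma uniformly_continuous_autocorrelation:
  assumes f: "uniformly_continuous_group f" "\<And>x. norm (f x) \<le> 1"
  shows "uniformly_continuous_group (autocorrelation f)"
  unfolding uniformly_continuous_group_def
proof (intro allI impI)
  fix e :: real assume "0 < e"
  then have e: "0 < e / 2" by simp
  then obtain W where W: "open W" "0 \<in> W" "\<And>w x. w \<in> W \<Longrightarrow> norm (f (x + w) - f x) < e / 2"
    using f(1) unfolding uniformly_continuous_group_def by meson
  have fb: "bounded (range f)" unfolding bounded_iff using f(2) by blast
  have "norm (autocorrelation f (x + w) - autocorrelation f x) < e" if w: "w \<in> W" for x w
  proof -
    have "autocorrelation f (x + w) - autocorrelation f x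
        = M (\<lambda>y. f (x + w + y) * cnj (f y) - f (x + y) * cnj (f y))"
      unfolding autocorrelation_def
      by (rule mean_diff[symmetric]) (intro bounded_comp_intros bounded_range_translate fb)+
    moreover have "norm (M (\<lambda>y. f (x + w + y) * cnj (f y) - f (x + y) * cnj (f y))) \<le> e / 2 * 1"
    proof (rule mean_norm_le)
      fix y
      have "norm (f (x + y + w) - f (x + y)) * norm (f y) \<le> e / 2 * 1"
        using W(3)[OF w, of "x + y"] f(2) e by (intro mult_mono) auto
      moreover have "f (x + w + y) * cnj (f y) - f (x + y) * cnj (f y)
          = (f (x + y + w) - f (x + y)) * cnj (f y)"
        by (simp add: algebra_simps)
      ultimately show "norm (f (x + w + y) * cnj (f y) - f (x + y) * cnj (f y)) \<le> e / 2 * 1"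
        by (simp only: norm_mult complex_mod_cnj)
    qed
    ultimately show ?thesis using \<open>0 < e\<close> by simp
  qed
  then show "\<exists>W. open W \<and> 0 \<in> W \<and> (\<forall>w\<in>W. \<forall>x. norm (autocorrelation f (x + w) - autocorrelation f x) < e)"
    using W(1,2) by blast
qed

text \<open>If \<open>x\<close> is not in \<open>V\<close>, then \<open>\<phi>\<close> and its translate by \<open>x\<close> have disjoint supports, so \<open>\<phi>\<close> pairs
  with \<open>F = \<phi> - \<phi> (x + _)\<close> as with itself. But every continuous character has a small pairing
  with \<open>F\<close>: either its pairing with \<open>\<phi>\<close> is small, or it belongs to the finite set \<open>E\<close> and is almost
  1 at \<open>x\<close>.\<close>

theorem ex_Bohr_nbhd:
  assumes V: "open V" "0 \<in> (V :: 'a set)"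
  obtains E \<epsilon> where "finite E" "\<And>\<xi>. \<xi> \<in> E \<Longrightarrow> unitary_character \<xi>" "0 < \<epsilon>"
    "\<And>x. (\<And>\<xi>. \<xi> \<in> E \<Longrightarrow> norm (\<xi> x - 1) < \<epsilon>) \<Longrightarrow> x \<in> V"
proof -
  \<comment> \<open>Two halvings are needed: V1 - V1 \<subseteq> V2 contains the support of \<phi>,
    and V2 - V2 \<subseteq> V separates that support from its translate.\<close>
  obtain V2 where V2: "open V2" "0 \<in> V2" "\<And>x y. x \<in> V2 \<Longrightarrow> y \<in> V2 \<Longrightarrow> x + y \<in> V" "\<And>x. x \<in> V2 \<Longrightarrow> - x \<in> V2"
    using open_add_nhds[OF V] by blast
  obtain V1 where V1: "open V1" "0 \<in> V1" "\<And>x y. x \<in> V1 \<Longrightarrow> y \<in> V1 \<Longrightarrow> x + y \<in> V2" "\<And>x. x \<in> V1 \<Longrightarrow> - x \<in> V1"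
    using open_add_nhds[OF V2(1,2)] by blast
  obtain f0 :: "'a \<Rightarrow> real" where f0: "uniformly_continuous_group (\<lambda>x. complex_of_real (f0 x))"
    "f0 0 = 1" "\<And>x. 0 \<le> f0 x" "\<And>x. f0 x \<le> 1" "\<And>x. f0 x \<noteq> 0 \<Longrightarrow> x \<in> V1"
    using ex_uniformly_continuous_bump[OF V1(1,2)] by metis
  define f where "f x = complex_of_real (f0 x)" for x
  have f: "uniformly_continuous_group f" "f 0 = 1" "\<And>x. norm (f x) \<le> 1" "\<And>x. f x \<noteq> 0 \<Longrightarrow> x \<in> V1"
    using f0 by (auto simp: f_def[abs_def])
  have fb: "bounded (range f)" unfolding bounded_iff using f(3) by blast
  define \<phi> where "\<phi> = autocorrelation f"
  have supp: "x \<in> V2" if "\<phi> x \<noteq> 0" for x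
  proof (rule ccontr)
    assume "x \<notin> V2"
    then have z: "f (x + y) * cnj (f y) = 0" for y
      using f(4)[of "x + y"] f(4)[of y] V1(3)[of "x + y" "- y"] V1(4)[of y] by auto
    show False using that unfolding \<phi>_def autocorrelation_def z by (simp add: mean_const)
  qed
  have \<phi>: "pos_def \<phi>" "uniformly_continuous_group \<phi>" "continuous_on UNIV \<phi>"
    unfolding \<phi>_def using pos_def_autocorrelation[OF fb] uniformly_continuous_autocorrelation[OF f(1,3)]
    by (auto intro: uniformly_continuous_group_continuous)
  have \<phi>b: "bounded (range \<phi>)" using \<phi>(1) by (rule pos_def_bounded)
  have \<phi>1: "norm (\<phi> x) \<le> 1" for x
    unfolding \<phi>_def autocorrelation_def
  proof (rule mean_norm_le)
    fix y
    have "norm (f (x + y)) * norm (f y) \<le> 1 * 1" by (intro mult_mono f) auto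
    then show "norm (f (x + y) * cnj (f y)) \<le> 1" by (simp add: norm_mult)
  qed
  have "\<not> pairing f f \<le> 0"
    using pairing_definite[OF uniformly_continuous_group_continuous[OF f(1)] fb, of 0] f(2) by auto
  then have r: "0 < Re (\<phi> 0)" by (simp add: \<phi>_def autocorrelation_def pairing_def)
  define c where "c = pairing \<phi> \<phi>"
  have c: "0 < c"
    using pairing_definite[OF \<phi>(3) \<phi>b, of 0] r unfolding c_def by (metis not_le zero_complex.sel(1) less_irrefl)
  \<comment> \<open>The character obtained below pairs with \<open>F\<close> to at least c / Re
    (\<phi> 0) = 4 \<rho>, whereas the case distinction on \<open>E\<close> bounds the pairing by 2
    \<rho>.\<close>
  define \<rho> where "\<rho> = c / (4 * Re (\<phi> 0))"
  have \<rho>: "0 < \<rho>" using c r by (simp add: \<rho>_def)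
  \<comment> \<open>\<open>A \<xi>\<close> is the conjugate Fourier coefficient of \<phi> at \<xi>;
    the correlation of a character with \<phi> is the character times this number.\<close>
  define A where "A \<xi> = M (\<lambda>y. \<xi> y * cnj (\<phi> y))" for \<xi>
  have corr: "correlation \<phi> \<xi> g = \<xi> g * A \<xi>" if "unitary_character \<xi>" for \<xi> g
  proof -
    have "M (\<lambda>y. \<xi> g * (\<xi> y * cnj (\<phi> y))) = \<xi> g * A \<xi>"
      unfolding A_def by (intro mean_cmult bounded_comp_intros \<phi>b unitary_character_bounded that)
    then show ?thesis by (simp add: correlation_def unitary_characterD(2)[OF that] mult.assoc)
  qed
  have u1: "norm (\<xi> x) \<le> 1" if "unitary_character \<xi>" for \<xi> and x :: 'a
    using unitary_characterD(3)[OF that, of x] by simp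
  define E where "E = {\<xi>. unitary_character \<xi> \<and> \<rho> \<le> norm (A \<xi>)}"
  have "finite E"
  proof -
    \<comment> \<open>The correlation \<xi> g * A \<xi> inherits the modulus of continuity of
      \<phi>. Dividing by a coefficient of size at least \<rho> turns \<rho> / 8 into 1 / 8, so
      \<open>E\<close> is equicontinuous.\<close>
    obtain W where W: "open W" "0 \<in> W" "\<And>w x. w \<in> W \<Longrightarrow> norm (\<phi> (x + w) - \<phi> x) < \<rho> / 8"
      using \<phi>(2) \<rho> unfolding uniformly_continuous_group_def by (metis zero_less_divide_iff zero_less_numeral)
    have "norm (\<xi> w - 1) \<le> 1 / 8" if \<xi>: "\<xi> \<in> E" and w: "- w \<in> W" for \<xi> w
    proof -
      have uc: "unitary_character \<xi>" and "\<rho> \<le> norm (A \<xi>)" using \<xi> by (auto simp: E_def)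
      have "norm (correlation \<phi> \<xi> (0 + w) - correlation \<phi> \<xi> 0) \<le> \<rho> / 8"
        using W(3)[OF w] less_imp_le by (intro norm_correlation_diff_le \<phi>b u1 uc) auto
      moreover have "correlation \<phi> \<xi> (0 + w) - correlation \<phi> \<xi> 0 = (\<xi> w - 1) * A \<xi>"
        by (simp add: corr[OF uc] unitary_characterD(4)[OF uc] left_diff_distrib)
      moreover have "norm (\<xi> w - 1) * \<rho> \<le> norm (\<xi> w - 1) * norm (A \<xi>)"
        using \<open>\<rho> \<le> norm (A \<xi>)\<close> by (intro mult_left_mono) auto
      ultimately have "norm (\<xi> w - 1) * \<rho> \<le> \<rho> / 8" by (simp add: norm_mult)
      then show ?thesis using \<rho> by (simp add: field_simps)
    qed
    then show ?thesis
      using open_uminus_group[OF W(1)] W(2)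
      by (intro finite_equicontinuous_characters[of E "{x. - x \<in> W}"]) (auto simp: E_def)
  qed
  moreover have "x \<in> V" if x: "\<And>\<xi>. \<xi> \<in> E \<Longrightarrow> norm (\<xi> x - 1) < \<rho>" for x
  proof (rule ccontr)
    assume "x \<notin> V"
    have "\<phi> y * cnj (\<phi> (x + y)) = 0" for y
      using supp[of y] supp[of "x + y"] V2(3)[of "x + y" "- y"] V2(4)[of y] \<open>x \<notin> V\<close> by auto
    then have disj: "M (\<lambda>y. \<phi> y * cnj (\<phi> (x + y))) = 0" by (simp only: mean_const)
    define F where "F y = \<phi> y - \<phi> (x + y)" for y
    have Fb: "bounded (range F)"
      unfolding F_def by (intro bounded_comp_intros \<phi>b bounded_range_translate)
    have pair: "pairing F \<psi> = Re (M (\<lambda>y. \<psi> y * cnj (\<phi> y)) - M (\<lambda>y. \<psi> y * cnj (\<phi> (x + y))))"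
      if "bounded (range \<psi>)" for \<psi>
    proof -
      have "M (\<lambda>y. \<psi> y * cnj (\<phi> y) - \<psi> y * cnj (\<phi> (x + y)))
          = M (\<lambda>y. \<psi> y * cnj (\<phi> y)) - M (\<lambda>y. \<psi> y * cnj (\<phi> (x + y)))"
        by (intro mean_diff bounded_comp_intros \<phi>b that bounded_range_translate)
      then show ?thesis by (simp add: pairing_def F_def right_diff_distrib)
    qed
    have "uniformly_continuous_group F"
      unfolding uniformly_continuous_group_def
    proof (intro allI impI)
      fix e :: real assume e: "0 < e"
      then have "0 < e / 2" by simp
      then obtain W where W: "open W" "0 \<in> W" "\<And>w x. w \<in> W \<Longrightarrow> norm (\<phi> (x + w) - \<phi> x) < e / 2"
        using \<phi>(2) unfolding uniformly_continuous_group_def by meson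
      have "norm (F (y + w) - F y) < e" if "w \<in> W" for w y
      proof -
        have "F (y + w) - F y = (\<phi> (y + w) - \<phi> y) - (\<phi> (x + y + w) - \<phi> (x + y))"
          by (simp add: F_def algebra_simps)
        then have "norm (F (y + w) - F y) \<le> norm (\<phi> (y + w) - \<phi> y) + norm (\<phi> (x + y + w) - \<phi> (x + y))"
          by (metis norm_triangle_ineq4)
        then show ?thesis using W(3)[OF that, of y] W(3)[OF that, of "x + y"] by simp
      qed
      then show "\<exists>W. open W \<and> 0 \<in> W \<and> (\<forall>w\<in>W. \<forall>y. norm (F (y + w) - F y) < e)"
        using W(1,2) by blast
    qed
    moreover have Fc: "pairing F \<phi> = c"
      using pair[OF \<phi>b] by (simp add: disj c_def pairing_def)
    ultimately obtain \<xi> where \<xi>: "unitary_character \<xi>" "c \<le> pairing F \<xi> * Re (\<phi> 0)"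
      using ex_unitary_character_pairing[OF _ Fb \<phi>(3,1)] c by metis
    have "M (\<lambda>y. \<xi> y * cnj (\<phi> (x + y))) = correlation \<phi> \<xi> (- x)"
    proof -
      have "bounded (range (\<lambda>y. \<xi> (- x + y) * cnj (\<phi> y)))"
        by (intro bounded_comp_intros \<phi>b bounded_range_translate unitary_character_bounded \<xi>)
      from mean_translate[OF this, of x] show ?thesis by (simp add: correlation_def)
    qed
    then have "pairing F \<xi> = Re (A \<xi> - cnj (\<xi> x) * A \<xi>)"
      using pair[OF unitary_character_bounded[OF \<xi>(1)]]
      by (simp add: corr[OF \<xi>(1)] unitary_characterD(5)[OF \<xi>(1)] A_def)
    also have "\<dots> \<le> norm (A \<xi> - cnj (\<xi> x) * A \<xi>)" by (rule complex_Re_le_cmod)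
    also have "A \<xi> - cnj (\<xi> x) * A \<xi> = - (cnj (\<xi> x - 1) * A \<xi>)" by (simp add: algebra_simps)
    also have "norm \<dots> = norm (\<xi> x - 1) * norm (A \<xi>)" by (simp add: norm_mult del: complex_cnj_diff)
    also have "\<dots> \<le> 2 * \<rho>"
    proof (cases "\<xi> \<in> E")
      case True
      have "norm (A \<xi>) \<le> 1"
        using norm_correlation_le[of \<phi> 1 \<xi> 0] \<phi>1 u1[OF \<xi>(1)] corr[OF \<xi>(1), of 0]
          unitary_characterD(4)[OF \<xi>(1)] by simp
      then have "norm (\<xi> x - 1) * norm (A \<xi>) \<le> \<rho> * 1"
        using x[OF True] \<rho> by (intro mult_mono) auto
      then show ?thesis using \<rho> by simp
    next
      case False
      then have "norm (A \<xi>) \<le> \<rho>" using \<xi>(1) by (simp add: E_def)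
      moreover have "norm (\<xi> x - 1) \<le> 2"
        using norm_triangle_ineq4[of "\<xi> x" 1] u1[OF \<xi>(1), of x] by simp
      ultimately show ?thesis by (intro mult_mono) auto
    qed
    finally have "pairing F \<xi> * Re (\<phi> 0) \<le> 2 * \<rho> * Re (\<phi> 0)"
      using r by (intro mult_right_mono) auto
    also have "\<dots> = c / 2" using r by (simp add: \<rho>_def)
    finally show False using \<xi>(2) c by simp
  qed
  ultimately show ?thesis
    using \<rho> by (intro that[of E \<rho>]) (auto simp: E_def)
qed

end

section \<open>The circle as a subset of the complex plane\<close>

lift_definition circle_cis :: "circle \<Rightarrow> complex" is "\<lambda>t. cis (2 * pi * t)"
proof -
  fix x y :: real assume "x - y \<in> \<int>"
  then have "cis (2 * pi * (x - y)) = 1" by (rule cis_multiple_2pi)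
  then have "cis (2 * pi * y) * cis (2 * pi * (x - y)) = cis (2 * pi * y)" by simp
  then show "cis (2 * pi * x) = cis (2 * pi * y)" by (simp only: cis_mult) (simp add: algebra_simps)
qed

lemma circle_cis_add: "circle_cis (a + b) = circle_cis a * circle_cis b"
  by transfer (simp add: cis_mult distrib_left)

lemma circle_cis_zero [simp]: "circle_cis 0 = 1"
  by transfer simp

lemma circle_cis_uminus: "circle_cis (- a) = cnj (circle_cis a)"
  by transfer (simp add: cis_cnj)

lemma circle_cis_diff: "circle_cis (a - b) = circle_cis a * cnj (circle_cis b)"
  using circle_cis_add[of a "- b"] by (simp add: circle_cis_uminus)

lemma norm_circle_cis [simp]: "norm (circle_cis a) = 1"
  by transfer simp

lemma circle_cis_cnj [simp]: "circle_cis a * cnj (circle_cis a) = 1"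
  using complex_norm_square[of "circle_cis a"] by simp

lemma circle_cis_eq_1_iff: "circle_cis a = 1 \<longleftrightarrow> a = 0"
proof
  assume *: "circle_cis a = 1"
  obtain t where t: "a = to_circle t" using to_circle_surj by blast
  have "cis (2 * pi * t) = 1" using * by (simp add: t circle_cis.abs_eq)
  then have "cos (2 * pi * t) = 1" by (metis cis.sel(1) one_complex.sel(1))
  then obtain n :: int where "2 * pi * t = n * 2 * pi" by (auto simp: cos_one_2pi_int)
  then have "t = n" by simp
  then show "a = 0" by (simp add: t zero_circle.abs_eq to_circle_eq_iff)
qed simp

lemma inj_circle_cis: "inj circle_cis"
proof (rule injI)
  fix a b assume "circle_cis a = circle_cis b"
  then have "circle_cis (a - b) = 1" by (simp add: circle_cis_diff)
  then show "a = b" by (simp add: circle_cis_eq_1_iff)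
qed

lemma range_circle_cis: "range circle_cis = sphere 0 1"
proof (intro set_eqI iffI)
  fix z :: complex assume "z \<in> sphere 0 1"
  then have "norm z = 1" "z \<noteq> 0" by auto
  then have "cis (Arg z) = z" using cis_Arg[of z] by (auto simp: sgn_div_norm)
  then have "circle_cis (to_circle (Arg z / (2 * pi))) = z" by (simp add: circle_cis.abs_eq)
  then show "z \<in> range circle_cis" by (metis rangeI)
qed auto

lemma norm_circle_cis_diff: "norm (circle_cis (a - b) - 1) = norm (circle_cis a - circle_cis b)"
proof -
  have "circle_cis (a - b) - 1 = (circle_cis a - circle_cis b) * cnj (circle_cis b)"
    by (simp add: circle_cis_diff left_diff_distrib)
  then show ?thesis by (simp add: norm_mult)
qed

lemma continuous_circle_cis: "continuous_on UNIV circle_cis"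
proof -
  have "open (circle_cis -` U)" if "open U" for U
  proof -
    have "to_circle -` (circle_cis -` U) = (\<lambda>t. cis (2 * pi * t)) -` U"
      by (auto simp: circle_cis.abs_eq)
    moreover have "continuous_on UNIV (\<lambda>t. cis (2 * pi * t))" by (intro continuous_intros)
    ultimately show ?thesis
      using that by (simp add: open_circle_def open_vimage)
  qed
  then show ?thesis by (simp add: continuous_on_open_vimage)
qed

lemma compact_circle: "compact (UNIV :: circle set)"
proof -
  have "continuous_on UNIV to_circle"
    by (simp add: continuous_on_open_vimage open_circle_def)
  then have "compact (to_circle ` {0..1})"
    by (intro compact_continuous_image) (auto intro: continuous_on_subset)
  moreover have "to_circle ` {0..1} = UNIV"
  proof -
    have "a \<in> to_circle ` {0..1}" for a
    proof -
      obtain t where t: "a = to_circle t" using to_circle_surj by blast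
      have "a = to_circle (frac t)" by (simp add: t to_circle_eq_iff frac_def)
      moreover have "frac t \<in> {0..1}" by (simp add: frac_lt_1 less_imp_le)
      ultimately show ?thesis by blast
    qed
    then show ?thesis by blast
  qed
  ultimately show ?thesis by simp
qed

text \<open>The image of the closed complement is compact, hence closed in the plane; injectivity
  recovers \<open>U\<close>. The quotient topology is thus the one induced by the plane.\<close>

lemma open_circle_vimage:
  assumes "open (U :: circle set)"
  obtains V where "open V" "U = circle_cis -` V"
proof -
  have "compact (- U)"
    using compact_circle assms by (metis closed_Compl compact_Int_closed inf_top_left)
  then have "compact (circle_cis ` (- U))"
    by (intro compact_continuous_image continuous_on_subset[OF continuous_circle_cis]) auto
  then have "open (- circle_cis ` (- U))" by (simp add: compact_imp_closed open_Compl)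
  moreover have "U = circle_cis -` (- circle_cis ` (- U))"
    using inj_circle_cis by (auto dest: injD)
  ultimately show ?thesis by (rule that)
qed

lemma continuous_map_circle_iff:
  "continuous_map X euclidean f \<longleftrightarrow> continuous_map X euclidean (\<lambda>x. circle_cis (f x))"
proof
  assume "continuous_map X euclidean f"
  then have "continuous_map X euclidean (circle_cis \<circ> f)"
    using continuous_circle_cis by (intro continuous_map_compose) auto
  then show "continuous_map X euclidean (\<lambda>x. circle_cis (f x))" by (simp add: o_def)
next
  assume *: "continuous_map X euclidean (\<lambda>x. circle_cis (f x))"
  have "openin X {x \<in> topspace X. f x \<in> U}" if U: "open U" for U
  proof -
    obtain V where V: "open V" "U = circle_cis -` V" using open_circle_vimage[OF U] .
    have "openin X {x \<in> topspace X. circle_cis (f x) \<in> V}"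
      using * V(1) by (intro openin_continuous_map_preimage) auto
    then show ?thesis by (simp add: V(2))
  qed
  then show "continuous_map X euclidean f" by (simp add: continuous_map_def)
qed

section \<open>Compact sets of characters of a Baire group\<close>

text \<open>The tails of a convergent sequence would do, but a compact space need not contain a
  nontrivial one. Either some infinite closed set cannot be split into two disjoint infinite closed
  parts, and then every continuous function is almost constant along any injective sequence in it,
  or splitting can be iterated along a binary tree. Both cases yield a countable family, as Baire's
  theorem requires.\<close>

lemma ex_small_oscillation_family:
  fixes X :: "'b topology"
  assumes X: "compact_space X" "infinite (topspace X)"
  shows "\<exists>U :: nat \<Rightarrow> 'b set. (\<forall>n. infinite (U n) \<and> U n \<subseteq> topspace X) \<and>
    (\<forall>f e. continuous_map X euclidean f \<and> 0 < e \<longrightarrow>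
      (\<exists>n. \<forall>a\<in>U n. \<forall>b\<in>U n. dist (f a) (f b :: complex) < e))"
proof (cases "\<exists>L. closedin X L \<and> infinite L \<and>
    (\<forall>A B. closedin X A \<and> closedin X B \<and> infinite A \<and> infinite B \<and> A \<subseteq> L \<and> B \<subseteq> L \<longrightarrow> A \<inter> B \<noteq> {})")
  case True
  then obtain L where L: "closedin X L" "infinite L" and
    disj: "\<forall>A B. closedin X A \<and> closedin X B \<and> infinite A \<and> infinite B \<and> A \<subseteq> L \<and> B \<subseteq> L \<longrightarrow> A \<inter> B \<noteq> {}"
    by (elim exE conjE) (rule that)
  obtain a :: "nat \<Rightarrow> 'b" where a: "inj a" "range a \<subseteq> L"
    using infinite_countable_subset[OF L(2)] by blast
  show ?thesis
  proof (intro exI[of _ "\<lambda>n. a ` {n..}"] conjI allI impI)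
    show "infinite (a ` {n..})" for n
      using a(1) by (simp add: finite_image_iff inj_on_subset infinite_Ici)
    show "a ` {n..} \<subseteq> topspace X" for n
      using a(2) closedin_subset[OF L(1)] by auto
    fix f :: "'b \<Rightarrow> complex" and e :: real
    assume "continuous_map X euclidean f \<and> 0 < e"
    then have f: "continuous_map X euclidean f" and e: "0 < e" by auto
    have "compactin euclidean (f ` topspace X)"
      using X(1) f by (intro image_compactin[of X]) (auto simp: compact_space_def)
    then have "compact (f ` topspace X)" by simp
    then obtain k where k: "finite k" "f ` topspace X \<subseteq> (\<Union>c\<in>k. ball c (e / 8))"
      using e unfolding compact_eq_totally_bounded by (metis zero_less_divide_iff zero_less_numeral)
    have "L \<subseteq> (\<Union>c\<in>k. {x \<in> L. f x \<in> cball c (e / 8)})"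
    proof
      fix x assume "x \<in> L"
      then have "f x \<in> f ` topspace X" using closedin_subset[OF L(1)] by blast
      then obtain c where "c \<in> k" "f x \<in> ball c (e / 8)" using k(2) by blast
      then show "x \<in> (\<Union>c\<in>k. {x \<in> L. f x \<in> cball c (e / 8)})"
        using \<open>x \<in> L\<close> by (auto intro!: bexI[of _ c])
    qed
    then obtain c where c: "c \<in> k" "infinite {x \<in> L. f x \<in> cball c (e / 8)}"
      using k(1) L(2) by (meson finite_UN_I finite_subset)
    have cl: "closedin X {x \<in> L. f x \<in> C}" if "closed C" for C
    proof -
      have "closedin X (L \<inter> {x \<in> topspace X. f x \<in> C})"
        using that f by (intro closedin_Int L(1) closedin_continuous_map_preimage[of X euclidean]) auto
      moreover have "L \<inter> {x \<in> topspace X. f x \<in> C} = {x \<in> L. f x \<in> C}"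
        using closedin_subset[OF L(1)] by blast
      ultimately show ?thesis by simp
    qed
    \<comment> \<open>The gap between e / 8 and e / 4 makes the two closed sets disjoint. As the
      first is infinite, the second is finite and the sequence eventually avoids it.\<close>
    let ?A = "{x \<in> L. f x \<in> cball c (e / 8)}" and ?B = "{x \<in> L. f x \<in> - ball c (e / 4)}"
    have "?A \<inter> ?B = {}" using e by auto
    moreover have "closedin X ?A" "closedin X ?B"
      by (rule cl, rule closed_cball) (rule cl, rule closed_Compl, rule open_ball)
    moreover have "?A \<subseteq> L" "?B \<subseteq> L" by auto
    ultimately have "finite ?B" using disj c(2) by meson
    then have "finite {n. a n \<in> ?B}"
      using a(1) by (rule finite_vimageI[unfolded vimage_def])
    then obtain N where N: "\<And>n. a n \<in> ?B \<Longrightarrow> n < N"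
      unfolding finite_nat_set_iff_bounded by blast
    have near: "dist (f (a n)) c < e / 4" if "N \<le> n" for n
      using N[of n] that subsetD[OF a(2) rangeI, of n] by (intro ccontr[of "dist (f (a n)) c < e / 4"]) (simp add: dist_commute not_less)
    have "dist (f (a n)) (f (a m)) < e" if "N \<le> n" "N \<le> m" for n m
      using near[OF that(1)] near[OF that(2)] dist_triangle2[of "f (a n)" "f (a m)" c] e by linarith
    then show "\<exists>n. \<forall>x\<in>a ` {n..}. \<forall>y\<in>a ` {n..}. dist (f x) (f y) < e"
      by (intro exI[of _ N]) auto
  qed
next
  case False
  define Q where "Q L A B \<longleftrightarrow> closedin X A \<and> closedin X B \<and> infinite A \<and> infinite B \<and>
    A \<subseteq> L \<and> B \<subseteq> L \<and> A \<inter> B = {}" for L A B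
  have "\<exists>A B. Q L A B" if "closedin X L" "infinite L" for L
    using False that unfolding Q_def by meson
  then obtain l r where "\<And>L. closedin X L \<Longrightarrow> infinite L \<Longrightarrow> Q L (l L) (r L)" by metis
  note lr = this[unfolded Q_def]
  \<comment> \<open>Nodes are finite binary words with the newest digit in front, so there are
    countably many and \<open>b # s\<close> is a child of \<open>s\<close>.\<close>
  define C where "C = rec_list (topspace X) (\<lambda>b _ L. if b then l L else r L)"
  have C_Nil: "C [] = topspace X" and C_Cons: "C (b # s) = (if b then l (C s) else r (C s))" for b s
    by (simp_all add: C_def)
  have C: "closedin X (C s) \<and> infinite (C s)" for s
    by (induction s) (use X(2) lr in \<open>auto simp: C_Nil C_Cons\<close>)
  have split: "C (b # s) \<subseteq> C s" "C (True # s) \<inter> C (False # s) = {}" for b s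
    using lr[of "C s"] C[of s] by (auto simp: C_Cons)
  text \<open>The complement of a maximal open set containing no \<open>C s\<close> is a minimal closed set meeting
    every \<open>C s\<close>; by minimality its traces on the \<open>C s\<close> form a \<open>\<pi>\<close>-base.\<close>
  define \<A> where "\<A> = {D. openin X D \<and> (\<forall>s. \<not> C s \<subseteq> D)}"
  have "\<exists>D\<in>\<A>. \<forall>D'\<in>\<A>. D \<subseteq> D' \<longrightarrow> D' = D"
  proof (rule subset_Zorn_nonempty)
    have "C s \<noteq> {}" for s using C[of s] by auto
    then have "{} \<in> \<A>" by (auto simp: \<A>_def)
    then show "\<A> \<noteq> {}" by blast
    fix \<C> assume \<C>: "\<C> \<noteq> {}" "subset.chain \<A> \<C>"
    then have sub: "\<C> \<subseteq> \<A>" by (simp add: subset.chain_def)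
    have "\<not> C s \<subseteq> \<Union>\<C>" for s
    proof
      assume *: "C s \<subseteq> \<Union>\<C>"
      have "compactin X (C s)" using C X(1) by (intro closedin_compact_space) auto
      moreover have "\<forall>D\<in>\<C>. openin X D" using sub by (auto simp: \<A>_def)
      ultimately obtain \<F> where \<F>: "finite \<F>" "\<F> \<subseteq> \<C>" "C s \<subseteq> \<Union>\<F>"
        using * unfolding compactin_def by blast
      have "\<F> \<noteq> {}" using \<F>(3) C[of s] by auto
      moreover have "subset.chain \<A> \<F>"
        using \<C>(2) \<F>(2) unfolding subset_chain_def by (meson subset_iff)
      ultimately have "\<Union>\<F> \<in> \<F>" using \<F>(1) by (intro Union_in_chain)
      then have "\<Union>\<F> \<in> \<A>" using \<F>(2) sub by blast
      then show False using \<F>(3) by (auto simp: \<A>_def)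
    qed
    then show "\<Union>\<C> \<in> \<A>" using sub by (auto simp: \<A>_def)
  qed
  then obtain D where D: "openin X D" "\<And>s. \<not> C s \<subseteq> D"
    and max: "\<And>D'. openin X D' \<Longrightarrow> D \<subseteq> D' \<Longrightarrow> (\<And>s. \<not> C s \<subseteq> D') \<Longrightarrow> D' = D"
    by (auto simp: \<A>_def)
  \<comment> \<open>Descent on the cardinality: passing to one child loses the points outside
    \<open>D\<close> in the other child, and there always are some.\<close>
  have inf: "infinite (C s - D)" for s
  proof
    assume "finite (C s - D)"
    then show False
    proof (induction "card (C s - D)" arbitrary: s rule: less_induct)
      case less
      obtain x where "x \<in> C (False # s) - D" using D(2)[of "False # s"] by blast
      then have "C (True # s) - D \<subset> C s - D" using split(1)[of True s] split(1)[of False s] split(2)[of s] by blast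
      then show False
        using less.hyps[of "True # s"] less.prems by (meson finite_subset psubset_card_mono psubset_imp_subset)
    qed
  qed
  show ?thesis
  proof (intro exI[of _ "\<lambda>n. C (from_nat n) - D"] conjI allI impI)
    show "infinite (C (from_nat n) - D)" for n by (rule inf)
    show "C (from_nat n) - D \<subseteq> topspace X" for n
      using C[of "from_nat n"] closedin_subset by blast
    fix f :: "'b \<Rightarrow> complex" and e :: real
    assume "continuous_map X euclidean f \<and> 0 < e"
    then have f: "continuous_map X euclidean f" and e: "0 < e" by auto
    obtain a where a: "a \<in> C [] - D" using D(2)[of "[]"] by blast
    let ?V = "{x \<in> topspace X. f x \<in> ball (f a) (e / 2)}"
    have V: "openin X ?V" using f by (intro openin_continuous_map_preimage) auto
    have "a \<in> ?V" using a e by (simp add: C_Nil)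
    \<comment> \<open>The enlarged open set contradicts maximality unless it contains some
      \<open>C s\<close>; outside \<open>D\<close>, that \<open>C s\<close> lies in
      \<open>?V\<close>, where \<open>f\<close> is close to \<open>f a\<close>.\<close>
    then have "D \<union> ?V \<noteq> D" using a by blast
    then obtain s where "C s \<subseteq> D \<union> ?V"
      using max[of "D \<union> ?V"] D(1) V by blast
    then have s: "dist (f a) (f x) < e / 2" if "x \<in> C s - D" for x using that by auto
    have "dist (f x) (f y) < e" if "x \<in> C s - D" "y \<in> C s - D" for x y
      using s[OF that(1)] s[OF that(2)] by (rule dist_triangle_half_r)
    then show "\<exists>n. \<forall>x\<in>C (from_nat n) - D. \<forall>y\<in>C (from_nat n) - D. dist (f x) (f y) < e"
      by (intro exI[of _ "to_nat s"]) auto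
  qed
qed

lemma characters_euclideanD:
  assumes "\<phi> \<in> characters (euclidean :: 'a::topological_ab_group_add topology)"
  shows "continuous_on UNIV \<phi>" "\<phi> (x + y) = \<phi> x + \<phi> y"
  using assms by (auto simp: characters_def)

lemma unitary_character_circle_cis:
  assumes "\<phi> \<in> characters (euclidean :: 'a::topological_ab_group_add topology)"
  shows "unitary_character (\<lambda>x. circle_cis (\<phi> x))"
proof -
  have "continuous_map euclidean euclidean (\<lambda>x. circle_cis (\<phi> x))"
    using assms by (simp only: continuous_map_circle_iff[symmetric]) (simp add: characters_def)
  then show ?thesis
    using characters_euclideanD(2)[OF assms] by (simp add: unitary_character_def circle_cis_add)
qed

lemma continuous_map_dual_group_evaluate:
  assumes "x \<in> topspace X"
  shows "continuous_map (dual_group X) euclidean (\<lambda>\<phi>. circle_cis (\<phi> x))"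
proof -
  have "continuous_map (dual_group X) euclidean (evaluation X x)"
    using evaluation_in_characters[OF assms] by (simp add: characters_def)
  then have "continuous_map (dual_group X) euclidean (\<lambda>\<phi>. circle_cis (evaluation X x \<phi>))"
    by (simp only: continuous_map_circle_iff)
  then show ?thesis
    by (rule continuous_map_eq) (simp add: evaluation_def)
qed

lemma (in totally_bounded_mean) finite_compactin_dual_group:
  assumes Baire: "Baire_space (euclidean :: 'a topology)"
    and K: "compactin (dual_group (euclidean :: 'a topology)) K"
  shows "finite K"
proof (rule ccontr)
  assume inf: "infinite K"
  let ?G = "euclidean :: 'a topology"
  define X where "X = subtopology (dual_group ?G) K"
  have KH: "K \<subseteq> characters ?G" using compactin_subset_topspace[OF K] by simp
  have topX: "topspace X = K" using KH by (auto simp: X_def)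
  have "compact_space X" using K by (simp add: X_def compact_space_subtopology)
  moreover have "infinite (topspace X)" using inf topX by simp
  ultimately have "\<exists>U :: nat \<Rightarrow> ('a \<Rightarrow> circle) set. (\<forall>n. infinite (U n) \<and> U n \<subseteq> topspace X) \<and>
    (\<forall>f e. continuous_map X euclidean f \<and> 0 < e \<longrightarrow>
      (\<exists>n. \<forall>a\<in>U n. \<forall>b\<in>U n. dist (f a) (f b :: complex) < e))"
    by (rule ex_small_oscillation_family)
  then obtain U :: "nat \<Rightarrow> ('a \<Rightarrow> circle) set" where U0: "\<forall>n. infinite (U n) \<and> U n \<subseteq> topspace X"
    and osc: "\<forall>f e. continuous_map X euclidean f \<and> 0 < e \<longrightarrow>
      (\<exists>n. \<forall>a\<in>U n. \<forall>b\<in>U n. dist (f a) (f b :: complex) < e)"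
    by (elim exE conjE) (rule that)
  have U: "infinite (U n)" "U n \<subseteq> topspace X" for n using U0 by auto
  have UH: "\<phi> \<in> characters ?G" if "\<phi> \<in> U n" for \<phi> n
    using U(2)[of n] that topX KH by blast
  \<comment> \<open>The closed sets \<open>N n\<close> cover the group. The bound 1 / 16 is doubled
    below to the 1 / 8 of \<open>finite_equicontinuous_characters\<close>.\<close>
  define N where "N n = {x. \<forall>\<phi>\<in>U n. \<forall>\<zeta>\<in>U n. dist (circle_cis (\<phi> x)) (circle_cis (\<zeta> x)) \<le> 1 / 16}" for n
  have cover: "\<exists>n. x \<in> N n" for x
  proof -
    have "continuous_map X euclidean (\<lambda>\<phi>. circle_cis (\<phi> x))"
      unfolding X_def by (intro continuous_map_from_subtopology continuous_map_dual_group_evaluate) simp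
    then obtain n where "\<forall>\<phi>\<in>U n. \<forall>\<zeta>\<in>U n. dist (circle_cis (\<phi> x)) (circle_cis (\<zeta> x)) < 1 / 16"
      using osc[rule_format, of "\<lambda>\<phi>. circle_cis (\<phi> x)" "1 / 16"] by auto
    then show ?thesis unfolding N_def by (auto intro: less_imp_le)
  qed
  have closed: "closed (N n)" for n
  proof -
    have "closed {x. dist (circle_cis (\<phi> x)) (circle_cis (\<zeta> x)) \<le> 1 / 16}"
      if "\<phi> \<in> U n" "\<zeta> \<in> U n" for \<phi> \<zeta>
      using unitary_characterD(1)[OF unitary_character_circle_cis[OF UH[OF that(1)]]]
        unitary_characterD(1)[OF unitary_character_circle_cis[OF UH[OF that(2)]]]
      by (intro closed_Collect_le continuous_intros)
    moreover have "N n = (\<Inter>\<phi>\<in>U n. \<Inter>\<zeta>\<in>U n. {x. dist (circle_cis (\<phi> x)) (circle_cis (\<zeta> x)) \<le> 1 / 16})"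
      by (auto simp: N_def)
    ultimately show ?thesis by (auto intro!: closed_INT)
  qed
  have "\<exists>n. ?G closure_of (- N n) \<noteq> UNIV"
  proof (rule ccontr)
    assume "\<not> (\<exists>n. ?G closure_of (- N n) \<noteq> UNIV)"
    then have "?G closure_of (\<Inter>n. - N n) = topspace ?G"
      using closed by (intro Baire[unfolded Baire_space_def, rule_format]) auto
    moreover have "(\<Inter>n. - N n) = {}" using cover by auto
    ultimately show False by simp
  qed
  then obtain n x0 where x0: "x0 \<notin> ?G closure_of (- N n)" by blast
  then obtain T where T: "open T" "x0 \<in> T" "T \<subseteq> N n"
    unfolding in_closure_of by auto
  obtain \<zeta> where \<zeta>: "\<zeta> \<in> U n" using U(1)[of n] by fastforce
  \<comment> \<open>Dividing by one fixed member \<zeta> turns small oscillation into closeness to 1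
    on \<open>T\<close>.\<close>
  define h where "h \<phi> x = circle_cis ((\<phi> - \<zeta>) x)" for \<phi> :: "'a \<Rightarrow> circle" and x
  have mem: "\<phi> - \<zeta> \<in> characters ?G" if "\<phi> \<in> U n" for \<phi>
    using add_in_characters[OF UH[OF that] minus_in_characters[OF UH[OF \<zeta>]]] by simp
  have uc: "unitary_character (h \<phi>)" if "\<phi> \<in> U n" for \<phi>
    unfolding h_def using unitary_character_circle_cis[OF mem[OF that]] .
  have small: "norm (h \<phi> x - 1) \<le> 1 / 16" if "\<phi> \<in> U n" "x \<in> N n" for \<phi> x
    using that \<zeta> by (simp add: h_def norm_circle_cis_diff N_def dist_norm)
  have "finite (h ` U n)"
  proof (rule finite_equicontinuous_characters)
    show "open {w. w + x0 \<in> T}" using T(1) by (rule open_translation_group)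
    show "0 \<in> {w. w + x0 \<in> T}" using T(2) by simp
    show "unitary_character \<xi>" if "\<xi> \<in> h ` U n" for \<xi> using that uc by blast
    fix \<xi> w assume \<xi>: "\<xi> \<in> h ` U n" and w: "w \<in> {w. w + x0 \<in> T}"
    obtain \<phi> where \<phi>: "\<phi> \<in> U n" "\<xi> = h \<phi>" using \<xi> by blast
    note u = unitary_characterD[OF uc[OF \<phi>(1)], folded \<phi>(2)]
    \<comment> \<open>Multiplication by the unimodular number \<xi> x0 moves the estimate from the
      open set \<open>T\<close> to a neighbourhood of 0.\<close>
    have "norm (\<xi> w - 1) = norm ((\<xi> w - 1) * \<xi> x0)" using u(3) by (simp add: norm_mult)
    also have "(\<xi> w - 1) * \<xi> x0 = (\<xi> (w + x0) - 1) - (\<xi> x0 - 1)"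
      by (simp add: u(2) algebra_simps)
    also have "norm \<dots> \<le> 1 / 16 + 1 / 16"
      unfolding \<phi>(2) using w T(2,3)
      by (intro norm_triangle_le_diff[OF add_mono] small[OF \<phi>(1)]) auto
    finally show "norm (\<xi> w - 1) \<le> 1 / 8" by simp
  qed
  moreover have "inj_on h (U n)"
  proof (rule inj_onI)
    fix \<phi> \<phi>' assume "h \<phi> = h \<phi>'"
    then have "circle_cis ((\<phi> - \<zeta>) x) = circle_cis ((\<phi>' - \<zeta>) x)" for x by (metis h_def)
    then have "(\<phi> - \<zeta>) x = (\<phi>' - \<zeta>) x" for x using inj_circle_cis by (blast dest: injD)
    then show "\<phi> = \<phi>'" by (simp add: fun_eq_iff)
  qed
  ultimately show False using U(1) finite_image_iff by blast
qed

section \<open>Reflexivity\<close>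

text \<open>Over a finite compact set a subbasic condition restricts finitely many values, and
  finite intersections and unions preserve this form of neighbourhood.\<close>

lemma dual_group_nbhd:
  assumes fin: "\<And>K. compactin X K \<Longrightarrow> finite K" and T: "openin (dual_group X) T" and "\<phi>\<^sub>0 \<in> T"
  shows "\<exists>I \<epsilon>. finite I \<and> 0 < \<epsilon> \<and>
    (\<forall>\<phi>\<in>characters X. (\<forall>x\<in>I. norm (circle_cis (\<phi> x) - circle_cis (\<phi>\<^sub>0 x)) < \<epsilon>) \<longrightarrow> \<phi> \<in> T)"
proof -
  define S where "S = {{\<phi> \<in> characters X. \<phi> ` K \<subseteq> U} | K U. compactin X K \<and> open U}"
  have "generate_topology_on S T"
    using T by (simp add: S_def dual_group_def openin_topology_generated_by_iff)
  then show ?thesis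
    using \<open>\<phi>\<^sub>0 \<in> T\<close>
  proof (induction arbitrary: \<phi>\<^sub>0)
    case (Int A B)
    obtain I \<epsilon> where I: "finite I" "0 < \<epsilon>"
      "\<And>\<phi>. \<phi> \<in> characters X \<Longrightarrow> \<forall>x\<in>I. norm (circle_cis (\<phi> x) - circle_cis (\<phi>\<^sub>0 x)) < \<epsilon> \<Longrightarrow> \<phi> \<in> A"
      using Int.IH(1)[of \<phi>\<^sub>0] Int.prems by auto
    obtain J \<delta> where J: "finite J" "0 < \<delta>"
      "\<And>\<phi>. \<phi> \<in> characters X \<Longrightarrow> \<forall>x\<in>J. norm (circle_cis (\<phi> x) - circle_cis (\<phi>\<^sub>0 x)) < \<delta> \<Longrightarrow> \<phi> \<in> B"
      using Int.IH(2)[of \<phi>\<^sub>0] Int.prems by auto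
    show ?case
      using I J by (intro exI[of _ "I \<union> J"] exI[of _ "min \<epsilon> \<delta>"]) auto
  next
    case (UN \<K>)
    then obtain k where k: "k \<in> \<K>" "\<phi>\<^sub>0 \<in> k" by blast
    obtain I \<epsilon> where "finite I" "0 < \<epsilon>"
      "\<And>\<phi>. \<phi> \<in> characters X \<Longrightarrow> \<forall>x\<in>I. norm (circle_cis (\<phi> x) - circle_cis (\<phi>\<^sub>0 x)) < \<epsilon> \<Longrightarrow> \<phi> \<in> k"
      using UN.IH[OF k] by auto
    then show ?case
      using k(1) by (intro exI[of _ I] exI[of _ \<epsilon>]) auto
  next
    case (Basis B)
    then obtain K U where B: "B = {\<phi> \<in> characters X. \<phi> ` K \<subseteq> U}" "compactin X K" "open U"
      unfolding S_def by blast
    obtain V where V: "open V" "U = circle_cis -` V" using open_circle_vimage[OF B(3)] by blast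
    have "\<forall>x\<in>K. \<exists>\<delta>>0. ball (circle_cis (\<phi>\<^sub>0 x)) \<delta> \<subseteq> V"
      using Basis.prems V(1) by (auto simp: B(1) V(2) open_contains_ball)
    then obtain \<delta> where \<delta>: "\<And>x. x \<in> K \<Longrightarrow> 0 < \<delta> x" "\<And>x. x \<in> K \<Longrightarrow> ball (circle_cis (\<phi>\<^sub>0 x)) (\<delta> x) \<subseteq> V"
      by metis
    have K: "finite K" using fin B(2) .
    show ?case
    proof (intro exI conjI ballI impI)
      show "finite K" by (rule K)
      \<comment> \<open>The inserted 1 covers the case of an empty \<open>K\<close>.\<close>
      show "0 < Min (insert 1 (\<delta> ` K))" using K \<delta>(1) by simp
      fix \<phi> assume \<phi>: "\<phi> \<in> characters X"
        "\<forall>x\<in>K. norm (circle_cis (\<phi> x) - circle_cis (\<phi>\<^sub>0 x)) < Min (insert 1 (\<delta> ` K))"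
      have "circle_cis (\<phi> x) \<in> V" if x: "x \<in> K" for x
      proof -
        have "norm (circle_cis (\<phi> x) - circle_cis (\<phi>\<^sub>0 x)) < \<delta> x" using \<phi>(2) x K by simp
        then have "circle_cis (\<phi> x) \<in> ball (circle_cis (\<phi>\<^sub>0 x)) (\<delta> x)"
          by (simp add: dist_norm norm_minus_commute)
        then show ?thesis using \<delta>(2)[OF x] by blast
      qed
      then show "\<phi> \<in> B" using \<phi>(1) by (auto simp: B(1) V(2))
    qed
  qed simp
qed

text \<open>A character \<open>\<psi>\<close> of the dual which is no evaluation is orthogonal to all evaluations, hence to
  the powers of \<open>k\<close>, a trigonometric polynomial that peaks at 0. This is impossible, because the
  real part of \<open>\<psi>\<close> is bounded below near 0.\<close>

theorem dual_character_is_evaluation: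
  fixes \<psi> :: "('a::topological_ab_group_add \<Rightarrow> circle) \<Rightarrow> circle"
  defines "G \<equiv> euclidean :: 'a topology"
  assumes fin: "\<And>K :: 'a set. compact K \<Longrightarrow> finite K" and \<psi>: "\<psi> \<in> characters (dual_group G)"
  obtains y where "\<And>\<phi>. \<phi> \<in> characters G \<Longrightarrow> \<psi> \<phi> = \<phi> y"
proof (rule ccontr)
  assume "\<not> thesis"
  then have no: "\<exists>\<phi>\<in>characters G. \<psi> \<phi> \<noteq> \<phi> y" for y using that by blast
  define H where "H = characters G"
  have Hzero: "0 \<in> H" and Hadd: "\<And>\<phi> \<theta>. \<phi> \<in> H \<Longrightarrow> \<theta> \<in> H \<Longrightarrow> \<phi> + \<theta> \<in> H"
    and Huminus: "\<And>\<phi>. \<phi> \<in> H \<Longrightarrow> - \<phi> \<in> H"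
    by (simp_all add: H_def zero_in_characters add_in_characters minus_in_characters)
  obtain M where "invariant_mean H M" using ex_invariant_mean[OF Hzero Hadd Huminus] by blast
  then interpret invariant_mean H M .
  have \<psi>add: "\<psi> (\<phi> + \<theta>) = \<psi> \<phi> + \<psi> \<theta>" if "\<phi> \<in> H" "\<theta> \<in> H" for \<phi> \<theta>
    using \<psi> that by (auto simp: characters_def[of "dual_group G"] H_def)
  define z where "z x \<phi> = circle_cis (\<phi> x)" for x :: 'a and \<phi> :: "'a \<Rightarrow> circle"
  have zadd: "z x (\<phi> + \<theta>) = z x \<phi> * z x \<theta>" for x \<phi> \<theta> by (simp add: z_def circle_cis_add)
  have nz: "norm (z x \<phi>) = 1" for x \<phi> by (simp add: z_def)
  have zx: "z (x + y) \<phi> = z x \<phi> * z y \<phi>" if "\<phi> \<in> H" for x y \<phi>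
    using that unfolding H_def G_def by (simp add: z_def characters_euclideanD(2) circle_cis_add)
  have zbounded: "bounded (z x ` H)" for x unfolding bounded_iff using nz by auto
  define p where "p \<phi> = cnj (circle_cis (\<psi> \<phi>))" for \<phi>
  have pbounded: "bounded (p ` H)" unfolding bounded_iff p_def by (intro exI[of _ 1]) auto
  \<comment> \<open>The product of \<open>p\<close> and \<open>z y\<close> is multiplicative on
    \<open>H\<close>, and it is nontrivial because \<psi> differs from the evaluation at
    \<open>y\<close>.\<close>
  have orth: "M (\<lambda>\<phi>. p \<phi> * z y \<phi>) = 0" for y
  proof -
    obtain \<theta> where \<theta>: "\<theta> \<in> H" "\<psi> \<theta> \<noteq> \<theta> y" using no[of y] by (auto simp: H_def)
    have "circle_cis (\<theta> y - \<psi> \<theta>) \<noteq> 1" using \<theta>(2) by (simp add: circle_cis_eq_1_iff)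
    then have "p \<theta> * z y \<theta> \<noteq> 1" by (simp add: p_def z_def circle_cis_diff mult.commute)
    with \<theta>(1) show ?thesis
      by (intro mean_nontrivial_character[where h = \<theta>])
        (auto simp: p_def \<psi>add circle_cis_add zadd norm_mult nz)
  qed
  define T where "T = {\<phi> \<in> topspace (dual_group G). circle_cis (\<psi> \<phi>) \<in> ball 1 (1 / 2)}"
  have T: "openin (dual_group G) T"
    unfolding T_def using \<psi>
    by (intro openin_continuous_map_preimage[of _ euclidean])
      (auto simp: continuous_map_circle_iff[symmetric] characters_def)
  have "\<psi> 0 = 0" using \<psi>add[OF Hzero Hzero] by simp
  then have T0: "0 \<in> T" by (simp add: T_def zero_in_characters)
  have "\<exists>I \<epsilon>. finite I \<and> 0 < \<epsilon> \<and> (\<forall>\<phi>\<in>H. (\<forall>x\<in>I. norm (z x \<phi> - 1) < \<epsilon>) \<longrightarrow> \<phi> \<in> T)"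
    using dual_group_nbhd[OF _ T T0] fin by (simp add: H_def z_def G_def)
  then obtain I \<epsilon>' where I: "finite I" "0 < \<epsilon>'" and
    nearT: "\<forall>\<phi>\<in>H. (\<forall>x\<in>I. norm (z x \<phi> - 1) < \<epsilon>') \<longrightarrow> \<phi> \<in> T"
    by (elim exE conjE) (rule that)
  have near': "circle_cis (\<psi> \<phi>) \<in> ball 1 (1 / 2)" if "\<phi> \<in> H" "\<forall>x\<in>I. norm (z x \<phi> - 1) < \<epsilon>'" for \<phi>
    using nearT that by (auto simp: T_def)
  \<comment> \<open>The cap at 1 keeps \<open>q'\<close> positive below.\<close>
  define \<epsilon> where "\<epsilon> = min 1 \<epsilon>'"
  have \<epsilon>: "0 < \<epsilon>" "\<epsilon> \<le> 1" using I(2) by (auto simp: \<epsilon>_def)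
  have near: "1 / 2 \<le> Re (p \<phi>)" if "\<phi> \<in> H" "\<forall>x\<in>I. norm (z x \<phi> - 1) < \<epsilon>" for \<phi>
  proof -
    have "norm (1 - circle_cis (\<psi> \<phi>)) < 1 / 2"
      using near'[OF that(1)] that(2) by (auto simp: \<epsilon>_def dist_norm)
    then show ?thesis
      using abs_Re_le_cmod[of "1 - circle_cis (\<psi> \<phi>)"] by (simp add: p_def)
  qed
  \<comment> \<open>The summand 1 permits division by \<open>m\<close> also when \<open>I\<close> is
    empty.\<close>
  define m where "m = real (card I) + 1"
  have m: "1 \<le> m" "real (card I) < m" by (auto simp: m_def)
  define d where "d \<phi> = (\<Sum>x\<in>I. (norm (z x \<phi> - 1))\<^sup>2)" for \<phi>
  \<comment> \<open>Each summand of \<open>d\<close> is at most 4, so \<open>k\<close> takes values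
    in [0, 1], with \<open>k 0 = 1\<close>.\<close>
  define k where "k \<phi> = 1 - d \<phi> / (4 * m)" for \<phi>
  have d_bounds: "0 \<le> d \<phi>" "d \<phi> \<le> 4 * m" for \<phi>
  proof -
    show "0 \<le> d \<phi>" by (simp add: d_def sum_nonneg)
    have "(norm (z x \<phi> - 1))\<^sup>2 \<le> 2\<^sup>2" for x
      using norm_triangle_ineq4[of "z x \<phi>" 1] nz[of x \<phi>] by (intro power_mono) auto
    then have "d \<phi> \<le> (\<Sum>x\<in>I. 4)" unfolding d_def by (intro sum_mono) auto
    then show "d \<phi> \<le> 4 * m" using m by simp
  qed
  have k_bounds: "0 \<le> k \<phi>" "k \<phi> \<le> 1" for \<phi>
    using d_bounds[of \<phi>] m by (simp_all add: k_def field_simps)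
  have d_eq: "complex_of_real (d \<phi>) = (\<Sum>x\<in>I. 2 - z x \<phi> - z (- x) \<phi>)" if \<phi>: "\<phi> \<in> H" for \<phi>
    unfolding d_def of_real_sum
  proof (rule sum.cong[OF refl])
    fix x
    have "z x \<phi> * z (- x) \<phi> = 1"
      using zx[OF \<phi>, of x "- x"] zx[OF \<phi>, of 0 0] nz[of 0 \<phi>] by auto
    moreover have "z x \<phi> * cnj (z x \<phi>) = 1" by (simp add: z_def)
    moreover have "z x \<phi> \<noteq> 0" using nz[of x \<phi>] by auto
    ultimately have "z (- x) \<phi> = cnj (z x \<phi>)" by (metis mult_cancel_left)
    then show "complex_of_real ((norm (z x \<phi> - 1))\<^sup>2) = 2 - z x \<phi> - z (- x) \<phi>"
      unfolding complex_norm_square using \<open>z x \<phi> * cnj (z x \<phi>) = 1\<close> by (simp add: algebra_simps)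
  qed
  have kb: "bounded ((\<lambda>\<phi>. complex_of_real (k \<phi>) ^ N) ` H)" for N
    unfolding bounded_iff using k_bounds by (intro exI[of _ 1]) (auto simp: norm_power power_le_one)
  note bi = bounded_comp_intros pbounded zbounded kb
  \<comment> \<open>Since |z - 1|^2 = 2 - z - cnj z on the unit circle, multiplication by
    \<open>k\<close> replaces an evaluation by a combination of evaluations at shifted points; hence
    the induction with \<open>y\<close> arbitrary.\<close>
  have zero: "M (\<lambda>\<phi>. p \<phi> * z y \<phi> * complex_of_real (k \<phi>) ^ N) = 0" for N y
  proof (induction N arbitrary: y)
    case 0
    then show ?case using orth by simp
  next
    case (Suc N)
    define g where "g y \<phi> = p \<phi> * z y \<phi> * complex_of_real (k \<phi>) ^ N" for y \<phi>
    have g: "bounded (g y ` H)" "M (g y) = 0" for y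
      unfolding g_def by (intro bi, rule Suc.IH)
    define c where "c = complex_of_real (1 / (4 * m))"
    have "M (\<lambda>\<phi>. p \<phi> * z y \<phi> * complex_of_real (k \<phi>) ^ Suc N)
        = M (\<lambda>\<phi>. g y \<phi> - c * (\<Sum>x\<in>I. 2 * g y \<phi> - g (x + y) \<phi> - g (- x + y) \<phi>))"
    proof (rule mean_cong)
      show "bounded ((\<lambda>\<phi>. p \<phi> * z y \<phi> * complex_of_real (k \<phi>) ^ Suc N) ` H)" by (intro bi)
      fix \<phi> assume \<phi>: "\<phi> \<in> H"
      have gx: "g (x + y) \<phi> = z x \<phi> * g y \<phi>" for x by (simp add: g_def zx[OF \<phi>])
      have k_eq: "complex_of_real (k \<phi>) = 1 - c * (\<Sum>x\<in>I. 2 - z x \<phi> - z (- x) \<phi>)"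
        using d_eq[OF \<phi>] by (simp add: k_def c_def)
      have "p \<phi> * z y \<phi> * complex_of_real (k \<phi>) ^ Suc N = g y \<phi> * complex_of_real (k \<phi>)"
        by (simp add: g_def)
      also have "\<dots> = g y \<phi> - c * (g y \<phi> * (\<Sum>x\<in>I. 2 - z x \<phi> - z (- x) \<phi>))"
        unfolding k_eq right_diff_distrib by simp
      also have "g y \<phi> * (\<Sum>x\<in>I. 2 - z x \<phi> - z (- x) \<phi>)
          = (\<Sum>x\<in>I. 2 * g y \<phi> - g (x + y) \<phi> - g (- x + y) \<phi>)"
        unfolding sum_distrib_left gx by (intro sum.cong refl) (simp add: algebra_simps)
      finally show "p \<phi> * z y \<phi> * complex_of_real (k \<phi>) ^ Suc N
          = g y \<phi> - c * (\<Sum>x\<in>I. 2 * g y \<phi> - g (x + y) \<phi> - g (- x + y) \<phi>)" .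
    qed
    also have "\<dots> = M (g y) - c * (\<Sum>x\<in>I. 2 * M (g y) - M (g (x + y)) - M (g (- x + y)))"
    proof -
      have t: "bounded ((\<lambda>\<phi>. 2 * g y \<phi> - g (x + y) \<phi> - g (- x + y) \<phi>) ` H)" for x
        by (intro bounded_comp_intros g)
      have t1: "bounded ((\<lambda>\<phi>. 2 * g y \<phi>) ` H)" by (intro bounded_comp_intros g)
      have "M (\<lambda>\<phi>. 2 * g y \<phi> - g (x + y) \<phi> - g (- x + y) \<phi>) = 2 * M (g y) - M (g (x + y)) - M (g (- x + y))" for x
        using mean_diff[OF bounded_minus_comp[OF t1 g(1)] g(1), of "x + y" "- x + y"]
          mean_diff[OF t1 g(1), of "x + y"] mean_cmult[OF g(1), of 2 y] by simp
      then have "M (\<lambda>\<phi>. \<Sum>x\<in>I. 2 * g y \<phi> - g (x + y) \<phi> - g (- x + y) \<phi>)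
          = (\<Sum>x\<in>I. 2 * M (g y) - M (g (x + y)) - M (g (- x + y)))"
        using mean_sum[OF t] by simp
      moreover have s: "bounded ((\<lambda>\<phi>. \<Sum>x\<in>I. 2 * g y \<phi> - g (x + y) \<phi> - g (- x + y) \<phi>) ` H)"
        by (intro bounded_sum_comp t)
      have "bounded ((\<lambda>\<phi>. c * (\<Sum>x\<in>I. 2 * g y \<phi> - g (x + y) \<phi> - g (- x + y) \<phi>)) ` H)"
        by (intro bounded_times_comp bounded_const_comp s)
      ultimately show ?thesis
        using mean_diff[OF g(1), of _ y] mean_cmult[OF s, of c] by simp
    qed
    also have "\<dots> = 0" using g(2) by simp
    finally show ?case .
  qed
  \<comment> \<open>\<open>q'\<close> bounds \<open>k\<close> from above off the
    \<epsilon>-neighbourhood. \<open>q\<close> bounds it from below on the \<delta>-neighbourhood,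
    where d \<le> m \<delta>^2 = \<epsilon>^2 / 2.\<close>
  define q q' where "q = 1 - \<epsilon>\<^sup>2 / (8 * m)" and "q' = 1 - \<epsilon>\<^sup>2 / (4 * m)"
  have e2: "0 < \<epsilon>\<^sup>2" "\<epsilon>\<^sup>2 \<le> 1" using \<epsilon> by (auto simp: power_le_one)
  have q: "0 < q'" "q' < q" using e2 m(1) by (simp_all add: q_def q'_def field_simps)
  define \<delta> where "\<delta> = \<epsilon> / sqrt (2 * m)"
  have \<delta>: "0 < \<delta>" "\<delta> \<le> \<epsilon>" "m * \<delta>\<^sup>2 = \<epsilon>\<^sup>2 / 2"
  proof -
    show "0 < \<delta>" using \<epsilon> m by (simp add: \<delta>_def)
    have "1 \<le> sqrt (2 * m)" using m by simp
    then show "\<delta> \<le> \<epsilon>" using \<epsilon> by (simp add: \<delta>_def divide_le_eq mult_le_cancel_left1)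
    show "m * \<delta>\<^sup>2 = \<epsilon>\<^sup>2 / 2" using m by (simp add: \<delta>_def power_divide)
  qed
  obtain F where F: "finite F" "F \<subseteq> H" "\<And>\<phi>. \<phi> \<in> H \<Longrightarrow> \<exists>\<theta>\<in>F. \<forall>x\<in>I. norm (z x \<phi> - z x \<theta>) < \<delta>"
    using finite_net[of I z H \<delta>] I(1) zbounded \<delta>(1) by blast
  define S where "S = {\<phi>. \<forall>x\<in>I. norm (z x \<phi> - 1) < \<delta>}"
  have FS: "\<exists>\<theta>\<in>F. \<phi> - \<theta> \<in> S" if "\<phi> \<in> H" for \<phi>
    using F(3)[OF that] by (auto simp: S_def z_def norm_circle_cis_diff)
  have ineq: "q ^ N / 2 / card F \<le> q' ^ N" for N
  proof -
    \<comment> \<open>Adding the constant q' ^ N compensates for the possibly negative real part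
      away from 0, so that \<open>mean_lower_bound\<close> applies; by orthogonality this constant
      is the whole mean.\<close>
    define f where "f \<phi> = p \<phi> * z 0 \<phi> * complex_of_real (k \<phi>) ^ N + complex_of_real (q' ^ N)" for \<phi>
    have Re_f: "Re (f \<phi>) = Re (p \<phi>) * k \<phi> ^ N + q' ^ N" if "\<phi> \<in> H" for \<phi>
    proof -
      have "z 0 \<phi> = 1" using zx[OF that, of 0 0] nz[of 0 \<phi>] by auto
      then have "f \<phi> = p \<phi> * complex_of_real (k \<phi> ^ N) + complex_of_real (q' ^ N)"
        by (simp add: f_def)
      then show ?thesis by (simp only: plus_complex.sel Re_complex_of_real) (simp add: mult.commute)
    qed
    have fb: "bounded (f ` H)" unfolding f_def by (intro bi)
    have "q ^ N / 2 / card F \<le> Re (M f)"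
    proof (rule mean_lower_bound[OF F(1,2) FS fb])
      fix \<phi> assume \<phi>: "\<phi> \<in> H"
      show "0 \<le> Re (f \<phi>)"
      proof (cases "\<forall>x\<in>I. norm (z x \<phi> - 1) < \<epsilon>")
        case True
        then have "0 \<le> Re (p \<phi>) * k \<phi> ^ N" using near[OF \<phi>] k_bounds[of \<phi>] by auto
        then show ?thesis using Re_f[OF \<phi>] q by simp
      next
        case False
        then obtain x where x: "x \<in> I" "\<epsilon> \<le> norm (z x \<phi> - 1)" by (auto simp: not_less)
        have "\<epsilon>\<^sup>2 \<le> (norm (z x \<phi> - 1))\<^sup>2" using x(2) \<epsilon> by (intro power_mono) auto
        also have "\<dots> \<le> d \<phi>" unfolding d_def using x(1) I(1) by (intro member_le_sum) auto
        finally have "k \<phi> \<le> q'" using m by (simp add: k_def q'_def divide_right_mono)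
        then have "k \<phi> ^ N \<le> q' ^ N" using k_bounds by (intro power_mono) auto
        moreover have "- 1 \<le> Re (p \<phi>)"
          using abs_Re_le_cmod[of "p \<phi>"] by (simp add: p_def)
        then have "- 1 * k \<phi> ^ N \<le> Re (p \<phi>) * k \<phi> ^ N"
          using k_bounds[of \<phi>] by (intro mult_right_mono) auto
        ultimately show ?thesis using Re_f[OF \<phi>] by simp
      qed
      assume "\<phi> \<in> S"
      then have S: "\<forall>x\<in>I. norm (z x \<phi> - 1) < \<delta>" by (simp add: S_def)
      then have "d \<phi> \<le> (\<Sum>x\<in>I. \<delta>\<^sup>2)"
        unfolding d_def by (intro sum_mono power_mono) (auto intro: less_imp_le)
      also have "\<dots> \<le> m * \<delta>\<^sup>2" using m(2) by (simp add: mult_right_mono)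
      also have "\<dots> = \<epsilon>\<^sup>2 / 2" by (rule \<delta>(3))
      finally have "d \<phi> / (4 * m) \<le> \<epsilon>\<^sup>2 / 2 / (4 * m)"
        using m by (intro divide_right_mono) auto
      then have "q \<le> k \<phi>" by (simp add: k_def q_def)
      then have "q ^ N \<le> k \<phi> ^ N" using q by (intro power_mono) auto
      moreover have "1 / 2 \<le> Re (p \<phi>)"
        using near[OF \<phi>] S \<delta>(2) by force
      ultimately have "1 / 2 * q ^ N \<le> Re (p \<phi>) * k \<phi> ^ N"
        using q by (intro mult_mono) auto
      moreover have "0 \<le> q' ^ N" using q by simp
      ultimately show "q ^ N / 2 \<le> Re (f \<phi>)" using Re_f[OF \<phi>] by linarith
    qed
    also have "M f = complex_of_real (q' ^ N)"
    proof -
      have "M f = M (\<lambda>\<phi>. p \<phi> * z 0 \<phi> * complex_of_real (k \<phi>) ^ N) + M (\<lambda>_. complex_of_real (q' ^ N))"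
        unfolding f_def by (rule mean_add) (intro bi)+
      then show ?thesis by (simp only: zero mean_const add_0_left)
    qed
    finally show ?thesis by simp
  qed
  have "F \<noteq> {}" using FS[OF Hzero] by blast
  then have cF: "0 < real (card F)" using F(1) by (simp add: card_gt_0_iff)
  \<comment> \<open>The net \<open>F\<close> does not depend on \<open>N\<close>, so the exponential
    growth of (q / q') ^ N beats its cardinality.\<close>
  obtain N where "2 * real (card F) < (q / q') ^ N"
    using real_arch_pow[of "q / q'" "2 * real (card F)"] q by auto
  then have "2 * real (card F) * q' ^ N < q ^ N"
    using q by (simp add: power_divide pos_less_divide_eq)
  moreover have "q ^ N \<le> 2 * real (card F) * q' ^ N"
    using ineq[of N] cF by (simp add: field_simps)
  ultimately show False by simp
qed

section \<open>Assembling the topological isomorphism\<close>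

lemma openin_Collect_ball_finite:
  assumes "finite E" "\<And>i. i \<in> E \<Longrightarrow> openin X {x \<in> topspace X. P i x}"
  shows "openin X {x \<in> topspace X. \<forall>i\<in>E. P i x}"
  using assms
proof (induction E rule: finite_induct)
  case (insert i E)
  have "{x \<in> topspace X. \<forall>j\<in>insert i E. P j x}
      = {x \<in> topspace X. P i x} \<inter> {x \<in> topspace X. \<forall>j\<in>E. P j x}" by auto
  then show ?case using insert by (simp add: openin_Int)
qed simp

theorem corollary3p15:
  assumes "totally_bounded_group (euclidean :: 'a::topological_ab_group_add topology)"
    and "Baire_space (euclidean :: 'a topology)"
    and "\<nexists>K :: 'a set. compact K \<and> infinite K"
  shows "Pontryagin_reflexive (euclidean :: 'a topology)"
proof -
  let ?G = "euclidean :: 'a topology"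
  have fin: "finite K" if "compact K" for K :: "'a set" using assms(3) that by blast
  obtain M :: "('a \<Rightarrow> complex) \<Rightarrow> complex" where "invariant_mean UNIV M"
    using ex_invariant_mean[of "UNIV :: 'a set"] by auto
  then interpret invariant_mean UNIV M .
  interpret totally_bounded_mean M
  proof
    fix U :: "'a set" assume "open U" "0 \<in> U"
    then have "openin ?G U \<and> U \<noteq> {}" by auto
    then obtain F where F: "finite F" "UNIV = F + U"
      using assms(1) unfolding totally_bounded_group_def by (metis topspace_euclidean)
    have "\<exists>a\<in>F. x - a \<in> U" for x
    proof -
      have "x \<in> F + U" using F(2) by blast
      then obtain a u where "a \<in> F" "u \<in> U" "x = a + u" by (auto simp: set_plus_def)
      then show ?thesis by (intro bexI[of _ a]) auto
    qed
    then show "\<exists>F. finite F \<and> (\<forall>x. \<exists>a\<in>F. x - a \<in> U)" using F(1) by blast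
  qed
  have Bohr: "\<exists>E \<epsilon>. finite E \<and> E \<subseteq> characters ?G \<and> 0 < \<epsilon> \<and>
      (\<forall>x. (\<forall>\<phi>\<in>E. norm (circle_cis (\<phi> x) - 1) < \<epsilon>) \<longrightarrow> x \<in> V)" if V: "open V" "0 \<in> V" for V
  proof -
    obtain E \<epsilon> where E: "finite E" "\<And>\<xi>. \<xi> \<in> E \<Longrightarrow> unitary_character \<xi>" "0 < \<epsilon>"
      "\<And>x. (\<And>\<xi>. \<xi> \<in> E \<Longrightarrow> norm (\<xi> x - 1) < \<epsilon>) \<Longrightarrow> x \<in> V"
      using ex_Bohr_nbhd[OF V] by metis
    \<comment> \<open>The values of \<xi> lie on the unit circle, the range of
      \<open>circle_cis\<close>, so the choice of preimages is unique and yields a circle-valued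
      character.\<close>
    define L where "L \<xi> = (\<lambda>x. inv circle_cis (\<xi> x))" for \<xi> :: "'a \<Rightarrow> complex"
    have L: "circle_cis (L \<xi> x) = \<xi> x" if "\<xi> \<in> E" for \<xi> x
      unfolding L_def using unitary_characterD(3)[OF E(2)[OF that], of x] range_circle_cis
      by (intro f_inv_into_f) auto
    have "L \<xi> \<in> characters ?G" if "\<xi> \<in> E" for \<xi>
    proof -
      note u = unitary_characterD[OF E(2)[OF that]]
      have "continuous_map ?G euclidean (L \<xi>)"
        unfolding continuous_map_circle_iff L[OF that] using u(1) by simp
      moreover have "L \<xi> (x + y) = L \<xi> x + L \<xi> y" for x y
        using inj_circle_cis by (rule injD) (simp add: circle_cis_add L[OF that] u(2))
      ultimately show ?thesis by (simp add: characters_def)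
    qed
    then show ?thesis
      using E(1,3,4) L by (intro exI[of _ "L ` E"] exI[of _ \<epsilon>]) auto
  qed
  have add: "evaluation ?G (x + y) = evaluation ?G x + evaluation ?G y" for x y
    by (auto simp: evaluation_def fun_eq_iff characters_euclideanD(2))
  have surj: "\<exists>y. \<psi> = evaluation ?G y" if \<psi>: "\<psi> \<in> characters (dual_group ?G)" for \<psi>
  proof -
    obtain y where "\<And>\<phi>. \<phi> \<in> characters ?G \<Longrightarrow> \<psi> \<phi> = \<phi> y"
      using dual_character_is_evaluation[OF fin \<psi>] by metis
    then have "\<psi> = evaluation ?G y"
      using \<psi> by (auto simp: evaluation_def fun_eq_iff characters_def[of "dual_group ?G"])
    then show ?thesis ..
  qed
  have "homeomorphic_map ?G (dual_group (dual_group ?G)) (evaluation ?G)"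
  proof (rule bijective_open_imp_homeomorphic_map)
    show "inj_on (evaluation ?G) (topspace ?G)"
    proof (rule inj_onI)
      fix x y assume eq: "evaluation ?G x = evaluation ?G y"
      show "x = y"
      proof (rule ccontr)
        assume "x \<noteq> y"
        moreover have "Hausdorff_space ?G" using assms(1) by (simp add: totally_bounded_group_def)
        ultimately obtain V where V: "open V" "0 \<in> V" "x - y \<notin> V"
          unfolding Hausdorff_space_def by (metis UNIV_I disjnt_iff open_openin right_minus_eq topspace_euclidean)
        from Bohr[OF V(1,2)] obtain E \<epsilon> where E: "E \<subseteq> characters ?G" "0 < \<epsilon>"
          "\<forall>x. (\<forall>\<phi>\<in>E. norm (circle_cis (\<phi> x) - 1) < \<epsilon>) \<longrightarrow> x \<in> V"
          by (elim exE conjE) (rule that)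
        have "circle_cis (\<phi> (x - y)) = 1" if "\<phi> \<in> E" for \<phi>
        proof -
          have \<phi>: "\<phi> \<in> characters ?G" using that E(1) by blast
          have "\<phi> x = \<phi> y" using fun_cong[OF eq, of \<phi>] \<phi> by (simp add: evaluation_def)
          moreover have "\<phi> (x - y) + \<phi> y = \<phi> x"
            using characters_euclideanD(2)[OF \<phi>, of "x - y" y] by simp
          ultimately show ?thesis by simp
        qed
        then have "x - y \<in> V" using E(2) by (intro E(3)[rule_format]) simp
        with V(3) show False ..
      qed
    qed
    show "evaluation ?G ` topspace ?G = topspace (dual_group (dual_group ?G))"
    proof (intro equalityI subsetI)
      fix \<psi> assume "\<psi> \<in> topspace (dual_group (dual_group ?G))"
      then show "\<psi> \<in> evaluation ?G ` topspace ?G" using surj[of \<psi>] by auto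
    qed (use evaluation_in_characters[of _ ?G] in auto)
    show "continuous_map ?G (dual_group (dual_group ?G)) (evaluation ?G)"
      unfolding dual_group_def[of "dual_group ?G"]
    proof (rule continuous_on_generated_topo)
      fix B assume "B \<in> {{\<phi> \<in> characters (dual_group ?G). \<phi> ` K \<subseteq> U} | K U. compactin (dual_group ?G) K \<and> open U}"
      then obtain K U where B: "B = {\<psi> \<in> characters (dual_group ?G). \<psi> ` K \<subseteq> U}"
        "compactin (dual_group ?G) K" "open U" by blast
      have K: "finite K" using assms(2) B(2) by (rule finite_compactin_dual_group)
      have KH: "\<phi> \<in> characters ?G" if "\<phi> \<in> K" for \<phi>
        using compactin_subset_topspace[OF B(2)] that by auto
      \<comment> \<open>As \<open>K\<close> is finite, the preimage of a subbasic set is a finite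
        intersection of open sets.\<close>
      have "evaluation ?G -` B \<inter> topspace ?G = (\<Inter>\<phi>\<in>K. \<phi> -` U)"
        using KH evaluation_in_characters[of _ ?G] by (auto simp: B(1) evaluation_def)
      moreover have "open (\<Inter>\<phi>\<in>K. \<phi> -` U)"
        using K B(3) characters_euclideanD(1)[OF KH] by (intro open_INT ballI open_vimage) auto
      ultimately show "openin ?G (evaluation ?G -` B \<inter> topspace ?G)" by simp
    next
      show "evaluation ?G ` topspace ?G
          \<subseteq> \<Union> {{\<phi> \<in> characters (dual_group ?G). \<phi> ` K \<subseteq> U} | K U. compactin (dual_group ?G) K \<and> open U}"
      proof
        fix \<psi> assume "\<psi> \<in> evaluation ?G ` topspace ?G"
        then have "\<psi> \<in> {\<phi> \<in> characters (dual_group ?G). \<phi> ` {} \<subseteq> UNIV}"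
          using evaluation_in_characters[of _ ?G] by auto
        moreover have "compactin (dual_group ?G) {}" "open (UNIV :: circle set)" by auto
        ultimately show "\<psi> \<in> \<Union> {{\<phi> \<in> characters (dual_group ?G). \<phi> ` K \<subseteq> U} | K U. compactin (dual_group ?G) K \<and> open U}"
          by blast
      qed
    qed
    show "open_map ?G (dual_group (dual_group ?G)) (evaluation ?G)"
      unfolding open_map_def
    proof (intro allI impI)
      fix V :: "'a set" assume "openin ?G V"
      then have V: "open V" by simp
      show "openin (dual_group (dual_group ?G)) (evaluation ?G ` V)"
      proof (subst openin_subopen, intro ballI)
        fix \<psi> assume "\<psi> \<in> evaluation ?G ` V"
        then obtain x where x: "x \<in> V" "\<psi> = evaluation ?G x" by blast
        have "open {y. y + x \<in> V}" "0 \<in> {y. y + x \<in> V}"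
          using open_translation_group(2)[OF V] x(1) by auto
        from Bohr[OF this] obtain E \<epsilon> where E: "finite E" "E \<subseteq> characters ?G" "0 < \<epsilon>"
          "\<forall>y. (\<forall>\<phi>\<in>E. norm (circle_cis (\<phi> y) - 1) < \<epsilon>) \<longrightarrow> y \<in> {y. y + x \<in> V}"
          by (elim exE conjE) (rule that)
        \<comment> \<open>Only values at the finitely many characters in \<open>E\<close> are
          restricted. By surjectivity each member of \<open>T\<close> is the evaluation at some
          \<open>y\<close>, and then \<open>y - x\<close> satisfies the Bohr condition.\<close>
        define T where "T = {\<theta> \<in> characters (dual_group ?G). \<forall>\<phi>\<in>E. circle_cis (\<theta> \<phi>) \<in> ball (circle_cis (\<phi> x)) \<epsilon>}"
        have "openin (dual_group (dual_group ?G))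
          {\<theta> \<in> topspace (dual_group (dual_group ?G)). circle_cis (\<theta> \<phi>) \<in> ball (circle_cis (\<phi> x)) \<epsilon>}"
          if "\<phi> \<in> E" for \<phi>
          using that E(2)
          by (intro openin_continuous_map_preimage[OF continuous_map_dual_group_evaluate]) auto
        then have "openin (dual_group (dual_group ?G)) T"
          unfolding T_def topspace_dual_group[symmetric] using E(1) by (intro openin_Collect_ball_finite)
        moreover have "\<psi> \<in> T"
          using E(2,3) evaluation_in_characters[of x ?G] by (auto simp: T_def x(2) evaluation_def)
        moreover have "T \<subseteq> evaluation ?G ` V"
        proof
          fix \<theta> assume \<theta>: "\<theta> \<in> T"
          then have "\<theta> \<in> characters (dual_group ?G)" by (simp add: T_def)
          then obtain y where y: "\<theta> = evaluation ?G y" using surj by blast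
          have "y - x \<in> {y. y + x \<in> V}"
          proof (rule E(4)[rule_format])
            fix \<phi> assume \<phi>: "\<phi> \<in> E"
            then have c: "\<phi> \<in> characters ?G" using E(2) by blast
            have "norm (circle_cis (\<phi> y) - circle_cis (\<phi> x)) < \<epsilon>"
              using \<theta> \<phi> c by (auto simp: T_def y evaluation_def dist_norm norm_minus_commute)
            moreover have "\<phi> (y - x) = \<phi> y - \<phi> x"
              using characters_euclideanD(2)[OF c, of "y - x" x] by (simp add: algebra_simps)
            ultimately show "norm (circle_cis (\<phi> (y - x)) - 1) < \<epsilon>"
              by (simp add: norm_circle_cis_diff)
          qed
          then show "\<theta> \<in> evaluation ?G ` V" using y by simp
        qed
        ultimately show "\<exists>T. openin (dual_group (dual_group ?G)) T \<and> \<psi> \<in> T \<and> T \<subseteq> evaluation ?G ` V"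
          by blast
      qed
    qed
  qed
  then show ?thesis using add by (simp add: Pontryagin_reflexive_def)
qed

end
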